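(* Suppose $(X,d)$ is a length space, $Y\subset X$ is non-empty, $F:Y\to\mathbb{R}$ is bounded below and has an extension to a uniformly continuous function on $X$, and either $f:X\setminus Y\to\mathbb{R}$ satisfies $f=0$ or all three of the following hold: $\inf|f|>0$, $f$ is uniformly continuous, and $X$ has finite diameter. Then the continuum value $u$ of $(X,d,Y,F,f)$ exists and is a uniformly continuous function extending $F$. Furthermore, $\|u-u^\varepsilon\|_\infty\to0$ as $\varepsilon\searrow0$. If $F$ is Lipschitz, then so is $u$. If $F$ and $f$ are Lipschitz, then $\|u-u^\varepsilon\|_\infty=O(\varepsilon)$.
   Context: A metric space $(X,d)$ is a length space if for all $x,y\in X$, $d(x,y)$ is the infimum of the lengths of continuous paths in $X$ connecting $x$ to $y$. $\varepsilon$-tug-of-war. For $\varepsilon>0$ and $x\in X$, a token starts at $x_0=x$. At the $k$-th turn a fair coin is tossed (independently) and the winner of the toss chooses $x_k\in X$ with $d(x_k,x_{k-1})<\varepsilon$. The game ends the first time $x_k\in Y$, and player I's payoff is then $F(x_k)+\varepsilon^2\sum_{i=0}^{k-1}f(x_i)$. Player I maximizes and player II minimizes. A strategy is a map from the set of partially played games (all previous moves and coin tosses) to legal moves (or to probability distributions on legal moves). For strategies $S_{\mathrm I},S_{\mathrm{II}}$, if the game terminates with probability one and the expected total payoff exists in $[-\infty,\infty]$, then $F_-(S_{\mathrm I},S_{\mathrm{II}})=F_+(S_{\mathrm I},S_{\mathrm{II}})$ is this expectation; otherwise $F_-=-\infty$ and $F_+=+\infty$. Put $u_{\mathrm I}^\varepsilon(x)=\sup_{S_{\mathrm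 I}}\inf_{S_{\mathrm{II}}}F_-$ and $u_{\mathrm{II}}^\varepsilon(x)=\inf_{S_{\mathrm{II}}}\sup_{S_{\mathrm I}}F_+$. When $u_{\mathrm I}^\varepsilon=u_{\mathrm{II}}^\varepsilon$, the common function is the value $u^\varepsilon$ of the game. When the limit $u:=\lim_{\varepsilon\to0}u^\varepsilon$ exists pointwise, $u$ is called the continuum value of $(X,d,Y,F,f)$.
   Formalization: When f is not 0, f is also assumed bounded on X\Y: a uniformly continuous f on X\Y can be unbounded, and then u^ε is unbounded and the claim fails. Strategies are deterministic, or random with countably supported distributions on legal moves. *)

theory Defs
  imports "HOL-Analysis.Analysis" "HOL-Probability.SPMF"
begin

section \<open>Length spaces\<close>

definition curve_length :: "(real \<Rightarrow> 'a::metric_space) \<Rightarrow> ereal" where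
  "curve_length g =
     (SUP ts\<in>{ts. sorted ts \<and> set ts \<subseteq> {0..1}}.
        \<Sum>i<length ts - 1. ereal (dist (g (ts ! i)) (g (ts ! Suc i))))"

text \<open>The space is the whole type. The infimum over the empty set is \<open>\<infinity>\<close>, so a length space
  is path connected.\<close>

definition length_space :: "'a::metric_space itself \<Rightarrow> bool" where
  "length_space _ \<longleftrightarrow>
     (\<forall>x y :: 'a. ereal (dist x y) =
        (INF g\<in>{g. path g \<and> pathstart g = x \<and> pathfinish g = y}. curve_length g))"


section \<open>Tug-of-war\<close>

text \<open>A history consists of the starting position and the list, oldest turn first, of the
  outcomes of the coin tosses (\<open>True\<close> if player I wins the toss) and the resulting moves.\<close>

type_synonym 'a history = "'a \<times> (bool \<times> 'a) list"

definition positions :: "'a history \<Rightarrow> 'a list" where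
  "positions h = fst h # map snd (snd h)"

definition position :: "'a history \<Rightarrow> 'a" where
  "position h = last (positions h)"

definition extend :: "'a history \<Rightarrow> bool \<Rightarrow> 'a \<Rightarrow> 'a history" where
  "extend h b y = (fst h, snd h @ [(b, y)])"

text \<open>Strategies may depend on the history in an arbitrary, possibly non-measurable way. Random
  strategies therefore choose moves according to discrete distributions, for which the law of the
  game is always well defined. Deterministic strategies are those choosing Dirac distributions.\<close>

type_synonym 'a strategy = "'a history \<Rightarrow> 'a pmf"

definition random_strategies :: "real \<Rightarrow> 'a::metric_space strategy set" where
  "random_strategies \<epsilon> = {S. \<forall>h. set_pmf (S h) \<subseteq> ball (position h) \<epsilon>}"

definition pure_strategies :: "real \<Rightarrow> 'a::metric_space strategy set" where
  "pure_strategies \<epsilon> =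
     {S. \<exists>\<sigma>. (\<forall>h. \<sigma> h \<in> ball (position h) \<epsilon>) \<and> S = (\<lambda>h. return_pmf (\<sigma> h))}"

text \<open>The law of the finished game, continued from the history \<open>h\<close>, as a subprobability on
  histories; the missing mass is the probability that the game never terminates.\<close>

partial_function (spmf) play ::
  "'a set \<Rightarrow> 'a strategy \<Rightarrow> 'a strategy \<Rightarrow> 'a history \<Rightarrow> 'a history spmf" where
  "play Y S\<^sub>1 S\<^sub>2 h =
     (if position h \<in> Y then return_spmf h
      else bind_spmf coin_spmf (\<lambda>b.
             bind_spmf (spmf_of_pmf ((if b then S\<^sub>1 else S\<^sub>2) h)) (\<lambda>y.
               play Y S\<^sub>1 S\<^sub>2 (extend h b y))))"

definition payoff :: "('a \<Rightarrow> real) \<Rightarrow> ('a \<Rightarrow> real) \<Rightarrow> real \<Rightarrow> 'a history \<Rightarrow> real" where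
  "payoff F f \<epsilon> h = F (position h) + \<epsilon>\<^sup>2 * (\<Sum>x\<leftarrow>butlast (positions h). f x)"

definition expect_pos :: "'b spmf \<Rightarrow> ('b \<Rightarrow> real) \<Rightarrow> ennreal" where
  "expect_pos p g = (\<integral>\<^sup>+ h. ennreal (g h) \<partial>measure_spmf p)"

definition expect_neg :: "'b spmf \<Rightarrow> ('b \<Rightarrow> real) \<Rightarrow> ennreal" where
  "expect_neg p g = (\<integral>\<^sup>+ h. ennreal (- g h) \<partial>measure_spmf p)"

definition has_expectation :: "'b spmf \<Rightarrow> ('b \<Rightarrow> real) \<Rightarrow> bool" where
  "has_expectation p g \<longleftrightarrow> expect_pos p g < \<infinity> \<or> expect_neg p g < \<infinity>"

definition expectation :: "'b spmf \<Rightarrow> ('b \<Rightarrow> real) \<Rightarrow> ereal" where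
  "expectation p g = enn2ereal (expect_pos p g) - enn2ereal (expect_neg p g)"

definition F_minus ::
  "'a set \<Rightarrow> ('a \<Rightarrow> real) \<Rightarrow> ('a \<Rightarrow> real) \<Rightarrow> real \<Rightarrow> 'a \<Rightarrow> 'a strategy \<Rightarrow> 'a strategy \<Rightarrow> ereal" where
  "F_minus Y F f \<epsilon> x S\<^sub>1 S\<^sub>2 =
     (let p = play Y S\<^sub>1 S\<^sub>2 (x, []) in
      if lossless_spmf p \<and> has_expectation p (payoff F f \<epsilon>)
      then expectation p (payoff F f \<epsilon>) else -\<infinity>)"

definition F_plus ::
  "'a set \<Rightarrow> ('a \<Rightarrow> real) \<Rightarrow> ('a \<Rightarrow> real) \<Rightarrow> real \<Rightarrow> 'a \<Rightarrow> 'a strategy \<Rightarrow> 'a strategy \<Rightarrow> ereal" where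
  "F_plus Y F f \<epsilon> x S\<^sub>1 S\<^sub>2 =
     (let p = play Y S\<^sub>1 S\<^sub>2 (x, []) in
      if lossless_spmf p \<and> has_expectation p (payoff F f \<epsilon>)
      then expectation p (payoff F f \<epsilon>) else \<infinity>)"

text \<open>The argument \<open>\<S>\<close> maps \<open>\<epsilon>\<close> to the strategies the players may use, and is either
  \<^const>\<open>pure_strategies\<close> or \<^const>\<open>random_strategies\<close>.\<close>

definition value_I ::
  "(real \<Rightarrow> 'a strategy set) \<Rightarrow> 'a set \<Rightarrow> ('a \<Rightarrow> real) \<Rightarrow> ('a \<Rightarrow> real) \<Rightarrow> real \<Rightarrow> 'a \<Rightarrow> ereal" where
  "value_I \<S> Y F f \<epsilon> x = (SUP S\<^sub>1\<in>\<S> \<epsilon>. INF S\<^sub>2\<in>\<S> \<epsilon>. F_minus Y F f \<epsilon> x S\<^sub>1 S\<^sub>2)"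

definition value_II ::
  "(real \<Rightarrow> 'a strategy set) \<Rightarrow> 'a set \<Rightarrow> ('a \<Rightarrow> real) \<Rightarrow> ('a \<Rightarrow> real) \<Rightarrow> real \<Rightarrow> 'a \<Rightarrow> ereal" where
  "value_II \<S> Y F f \<epsilon> x = (INF S\<^sub>2\<in>\<S> \<epsilon>. SUP S\<^sub>1\<in>\<S> \<epsilon>. F_plus Y F f \<epsilon> x S\<^sub>1 S\<^sub>2)"

definition has_value ::
  "(real \<Rightarrow> 'a strategy set) \<Rightarrow> 'a set \<Rightarrow> ('a \<Rightarrow> real) \<Rightarrow> ('a \<Rightarrow> real) \<Rightarrow> real \<Rightarrow> bool" where
  "has_value \<S> Y F f \<epsilon> \<longleftrightarrow> value_I \<S> Y F f \<epsilon> = value_II \<S> Y F f \<epsilon>"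

text \<open>Meaningful only if \<^const>\<open>has_value\<close> holds.\<close>

definition game_value ::
  "(real \<Rightarrow> 'a strategy set) \<Rightarrow> 'a set \<Rightarrow> ('a \<Rightarrow> real) \<Rightarrow> ('a \<Rightarrow> real) \<Rightarrow> real \<Rightarrow> 'a \<Rightarrow> ereal" where
  "game_value \<S> Y F f \<epsilon> = value_I \<S> Y F f \<epsilon>"

definition is_continuum_value ::
  "(real \<Rightarrow> 'a strategy set) \<Rightarrow> 'a set \<Rightarrow> ('a \<Rightarrow> real) \<Rightarrow> ('a \<Rightarrow> real) \<Rightarrow> ('a \<Rightarrow> real) \<Rightarrow> bool" where
  "is_continuum_value \<S> Y F f u \<longleftrightarrow>
     (\<forall>\<^sub>F \<epsilon> in at_right 0. has_value \<S> Y F f \<epsilon>) \<and>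
     (\<forall>x. ((\<lambda>\<epsilon>. game_value \<S> Y F f \<epsilon> x) \<longlongrightarrow> ereal (u x)) (at_right 0))"

definition sup_dist :: "('a \<Rightarrow> real) \<Rightarrow> ('a \<Rightarrow> ereal) \<Rightarrow> ereal" where
  "sup_dist u v = (SUP x. \<bar>ereal (u x) - v x\<bar>)"

definition is_lipschitz_on :: "'a::metric_space set \<Rightarrow> ('a \<Rightarrow> real) \<Rightarrow> bool" where
  "is_lipschitz_on A g \<longleftrightarrow> (\<exists>L. L-lipschitz_on A g)"

end

theory Submission
  imports Defs
begin

text \<open>For a running payoff \<open>f \<ge> 0\<close> the value of the game with step \<open>\<epsilon>\<close> is the least function \<open>v\<close> that is
  bounded below by the infimum of \<open>F\<close>, at least \<open>F\<close> on \<open>Y\<close>, and a supersolution, i.e.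
  \<open>2 v x \<ge> sup v + inf v + 2 \<epsilon>\<^sup>2 f x\<close> over the ball of radius \<open>\<epsilon>\<close> about \<open>x \<notin> Y\<close>: player II can follow
  any such \<open>v\<close>, and the value for player I is itself a supersolution. The only difficulty is to make
  the game stop, which is done by giving \<open>v\<close> a definite drop at every point.

  Let \<open>u\<close> be the least supersolution for step \<open>R\<close>. Away from \<open>Y\<close> the infimum over balls of radius
  \<open>R = k \<epsilon>\<close> of a supersolution for step \<open>\<epsilon>\<close> is one for step \<open>R\<close>, since its infima over concentric balls
  are concave in the radius. Conversely the infimum over balls of radius \<open>R\<close> of \<open>u\<close> dominates the
  optimal cost of a random walk towards a target, which yields a supersolution for step \<open>\<epsilon>\<close>. As least
  supersolutions are nearly Lipschitz, the values for the steps \<open>R\<close> and \<open>R / k\<close> differ by an error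
  depending only on \<open>R\<close>. Concavity passes to the limit of the values for \<open>R / 2 ^ n\<close> and then holds at
  all scales, so that this limit can be compared with the value for an arbitrary step.

  Negative \<open>f\<close> is treated by exchanging the players, and if \<open>\<bar>f\<bar>\<close> is bounded away from \<open>0\<close> then short
  moves between points outside \<open>Y\<close> do not change the sign of \<open>f\<close>.\<close>

text \<open>Comparing each step only with its half would not suffice: for a merely uniformly
  continuous \<open>F\<close> the errors at \<open>R / 2 ^ n\<close> need not be summable. Hence a
  single comparison of \<open>R\<close> with \<open>R / k\<close> whose error does not depend on
  \<open>k\<close>. An additive error in \<open>f\<close> would be charged once per turn, for a
  number of turns that is not bounded in advance. The oscillation of \<open>f\<close> over a
  distance \<open>2 * R\<close> is therefore recorded as a factor \<open>1 - \<kappa>\<close>, which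
  scaling a supersolution removes; this is one place where a positive lower bound of
  \<open>\<bar>f\<bar>\<close> enters. If \<open>f = 0\<close>, a least supersolution may be
  constant on balls, and a player following it could wander there for ever; this is why it is first
  raised slightly on such flat pieces. Ball infima fail to be supersolutions near \<open>Y\<close>.
  In that layer the functions are compared through cones with vertices on \<open>Y\<close>, and
  these cones account for the error terms \<open>2 * \<eta>\<close> and
  \<open>7 * slope L * R\<close>.\<close>

declare split_paired_All [simp del] split_paired_Ex [simp del]

section \<open>Subprobabilities: sequencing and limits of chains\<close>

lemma nn_integral_bind_spmf:
  "(\<integral>\<^sup>+ x. g x \<partial>measure_spmf (bind_spmf p f)) = (\<integral>\<^sup>+ y. \<integral>\<^sup>+ x. g x \<partial>measure_spmf (f y) \<partial>measure_spmf p)"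
  unfolding measure_spmf_bind
  by (subst nn_integral_bind[where B = "count_space UNIV"]) (auto simp: space_measure_spmf)

text \<open>Monotone convergence works for chains of any cardinality because all mass lives on the
  countable support of the least upper bound. This is the admissibility needed for induction over
  \<open>play\<close>.\<close>

lemma nn_integral_lub_spmf_le:
  assumes chain: "Complete_Partial_Order.chain (ord_spmf (=)) C" and "C \<noteq> {}"
    and le: "\<And>p. p \<in> C \<Longrightarrow> (\<integral>\<^sup>+ x. g x \<partial>measure_spmf p) \<le> J"
  shows "(\<integral>\<^sup>+ x. g x \<partial>measure_spmf (lub_spmf C)) \<le> J"
proof -
  let ?B = "set_spmf (lub_spmf C)"
  have "(\<integral>\<^sup>+ x. g x \<partial>measure_spmf (lub_spmf C))
      = (\<integral>\<^sup>+ x. (SUP p\<in>C. ennreal (spmf p x) * g x) \<partial>count_space ?B)"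
    using assms(2)
    by (simp add: nn_integral_measure_spmf' ennreal_spmf_lub_spmf[OF chain] SUP_mult_right_ennreal)
  also have "\<dots> = (SUP p\<in>C. \<integral>\<^sup>+ x. ennreal (spmf p x) * g x \<partial>count_space ?B)"
  proof (rule nn_integral_monotone_convergence_SUP_countable[OF assms(2)])
    show "Complete_Partial_Order.chain (\<le>) ((\<lambda>p x. ennreal (spmf p x) * g x) ` C)"
      using chain by (rule chain_imageI)
        (auto simp: le_fun_def intro!: mult_right_mono dest: ord_spmf_eq_leD)
  qed simp
  also have "\<dots> \<le> J"
  proof (rule SUP_least)
    fix p assume "p \<in> C"
    have "(\<integral>\<^sup>+ x. ennreal (spmf p x) * g x \<partial>count_space ?B)
        \<le> (\<integral>\<^sup>+ x. ennreal (spmf p x) * g x \<partial>count_space UNIV)"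
      by (subst nn_integral_count_space_indicator)
        (auto intro!: nn_integral_mono split: split_indicator)
    also have "\<dots> \<le> J" using le[OF \<open>p \<in> C\<close>] by (simp add: nn_integral_measure_spmf)
    finally show "(\<integral>\<^sup>+ x. ennreal (spmf p x) * g x \<partial>count_space ?B) \<le> J" .
  qed
  finally show ?thesis .
qed

section \<open>Integrals over the law of the game\<close>

definition game_int :: "'a set \<Rightarrow> 'a strategy \<Rightarrow> 'a strategy \<Rightarrow> ('a history \<Rightarrow> ennreal) \<Rightarrow> 'a history \<Rightarrow> ennreal"
  where "game_int Y S1 S2 g h = (\<integral>\<^sup>+ h'. g h' \<partial>measure_spmf (play Y S1 S2 h))"

abbreviation toss_mean :: "'a strategy \<Rightarrow> 'a strategy \<Rightarrow> ('a history \<Rightarrow> ennreal) \<Rightarrow> 'a history \<Rightarrow> ennreal" where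
  "toss_mean S1 S2 J h \<equiv> ((\<integral>\<^sup>+ y. J (extend h True y) \<partial>measure_pmf (S1 h))
     + (\<integral>\<^sup>+ y. J (extend h False y) \<partial>measure_pmf (S2 h))) / 2"

lemma nn_integral_coin_bind:
  "(\<integral>\<^sup>+ x. g x \<partial>measure_spmf (bind_spmf coin_spmf (\<lambda>b. bind_spmf (spmf_of_pmf (p b)) (f b))))
   = ((\<integral>\<^sup>+ y. \<integral>\<^sup>+ x. g x \<partial>measure_spmf (f True y) \<partial>p True)
      + (\<integral>\<^sup>+ y. \<integral>\<^sup>+ x. g x \<partial>measure_spmf (f False y) \<partial>p False)) / 2"
proof -
  have "coin_spmf = spmf_of_pmf (pmf_of_set (UNIV :: bool set))" by simp
  then show ?thesis
    unfolding nn_integral_bind_spmf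
    by (simp only: measure_spmf_spmf_of_pmf) (simp add: nn_integral_pmf_of_set UNIV_bool add.commute)
qed

lemma play_stop: "position h \<in> Y \<Longrightarrow> play Y S1 S2 h = return_spmf h"
  by (subst play.simps) simp

lemma game_int_stop: "position h \<in> Y \<Longrightarrow> game_int Y S1 S2 g h = g h"
  unfolding game_int_def by (subst play.simps) (simp add: measure_spmf_return_spmf nn_integral_return)

lemma game_int_step:
  "position h \<notin> Y \<Longrightarrow> game_int Y S1 S2 g h =
     toss_mean S1 S2 (game_int Y S1 S2 g) h"
  unfolding game_int_def
  by (subst play.simps) (simp only: if_False nn_integral_coin_bind, simp)

text \<open>The law of the game is a least fixed point, so its integrals stay below every
  \<open>J\<close> satisfying the one-step inequality; \<open>J\<close> may be infinite on
  irrelevant histories. Lower bounds do not follow in this way, since mass may be lost to plays that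
  never end.\<close>

lemma game_int_least:
  assumes stop: "\<And>h. position h \<in> Y \<Longrightarrow> g h \<le> J h"
    and step: "\<And>h. position h \<notin> Y \<Longrightarrow>
       toss_mean S1 S2 J h \<le> J h"
  shows "game_int Y S1 S2 g h \<le> J h"
proof -
  have "\<forall>h. (\<integral>\<^sup>+ h'. g h' \<partial>measure_spmf (play Y S1 S2 h)) \<le> J h"
  proof (induction rule: play.fixp_induct)
    case 1
    show ?case
    proof (rule ccpo.admissibleI, intro allI)
      fix A h
      assume ch: "Complete_Partial_Order.chain spmf.le_fun A" and ne: "A \<noteq> {}"
        and le: "\<forall>f\<in>A. \<forall>h. (\<integral>\<^sup>+ h'. g h' \<partial>measure_spmf (curry (curry (curry f)) Y S1 S2 h)) \<le> J h"
      let ?C = "{y. \<exists>f\<in>A. y = f (((Y, S1), S2), h)}"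
      have "(\<integral>\<^sup>+ h'. g h' \<partial>measure_spmf (lub_spmf ?C)) \<le> J h"
      proof (rule nn_integral_lub_spmf_le)
        show "Complete_Partial_Order.chain (ord_spmf (=)) ?C" using ch by (rule chain_fun)
        show "?C \<noteq> {}" using ne by auto
      qed (use le in \<open>auto\<close>)
      then show "(\<integral>\<^sup>+ h'. g h' \<partial>measure_spmf (curry (curry (curry (spmf.lub_fun A))) Y S1 S2 h)) \<le> J h"
        by (simp add: fun_lub_def)
    qed
  next
    case 2
    show ?case by simp
  next
    case (3 D)
    show ?case
    proof
      fix h
      show "(\<integral>\<^sup>+ h'. g h' \<partial>measure_spmf (if position h \<in> Y then return_spmf h
                else coin_spmf \<bind>
                     (\<lambda>b. spmf_of_pmf ((if b then S1 else S2) h) \<bind>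
                           (\<lambda>y. D Y S1 S2 (extend h b y))))) \<le> J h"
      proof (cases "position h \<in> Y")
        case True
        then show ?thesis using stop by (simp add: measure_spmf_return_spmf nn_integral_return)
      next
        case False
        have "((\<integral>\<^sup>+ y. \<integral>\<^sup>+ h'. g h' \<partial>measure_spmf (D Y S1 S2 (extend h True y)) \<partial>S1 h)
           + (\<integral>\<^sup>+ y. \<integral>\<^sup>+ h'. g h' \<partial>measure_spmf (D Y S1 S2 (extend h False y)) \<partial>S2 h)) / 2
          \<le> toss_mean S1 S2 J h"
          using 3 by (intro divide_right_mono_ennreal add_mono nn_integral_mono)
            (auto)
        also have "\<dots> \<le> J h" using step[OF False] .
        finally show ?thesis using False by (simp only: if_False nn_integral_coin_bind) simp
      qed
    qed
  qed
  then show ?thesis by (simp add: game_int_def)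
qed

section \<open>Termination\<close>

lemma game_int_1: "game_int Y S1 S2 (\<lambda>_. 1) h = ennreal (weight_spmf (play Y S1 S2 h))"
  by (simp add: game_int_def weight_spmf_def measure_spmf.emeasure_eq_measure space_measure_spmf)

lemma nn_integral_pmf_ge_const:
  assumes "\<And>y. y \<in> set_pmf p \<Longrightarrow> c \<le> g y"
  shows "c \<le> (\<integral>\<^sup>+ y. g y \<partial>measure_pmf p)"
proof -
  have "c = (\<integral>\<^sup>+ y. c \<partial>measure_pmf p)" by (simp add: measure_pmf.emeasure_space_1)
  also have "\<dots> \<le> (\<integral>\<^sup>+ y. g y \<partial>measure_pmf p)"
    by (rule nn_integral_mono_AE) (use assms in \<open>auto simp: AE_measure_pmf_iff\<close>)
  finally show ?thesis .
qed

lemma nn_integral_pmf_le_const: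
  assumes "\<And>y. y \<in> set_pmf p \<Longrightarrow> g y \<le> c"
  shows "(\<integral>\<^sup>+ y. g y \<partial>measure_pmf p) \<le> c"
proof -
  have "(\<integral>\<^sup>+ y. g y \<partial>measure_pmf p) \<le> (\<integral>\<^sup>+ y. c \<partial>measure_pmf p)"
    by (rule nn_integral_mono_AE) (use assms in \<open>auto simp: AE_measure_pmf_iff\<close>)
  also have "\<dots> = c" by (simp add: measure_pmf.emeasure_space_1)
  finally show ?thesis .
qed

lemma ennreal_plus_le: "ennreal (a + b) \<le> ennreal a + ennreal b"
proof -
  have "ennreal (a + b) \<le> ennreal (max 0 a + max 0 b)" by (rule ennreal_leI) auto
  also have "\<dots> = ennreal (max 0 a) + ennreal (max 0 b)" by (simp only: ennreal_plus max.cobounded1)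
  finally show ?thesis by simp
qed

lemma ennreal_average: "0 \<le> a \<Longrightarrow> 0 \<le> b \<Longrightarrow> (ennreal a + ennreal b) / 2 = ennreal ((a + b) / 2)"
  by (simp flip: ennreal_plus add: divide_ennreal[of "a + b" 2, simplified])

lemma weight_play_step:
  assumes "position h \<notin> Y"
    and r1: "\<And>y. y \<in> set_pmf (S1 h) \<Longrightarrow> r1 \<le> weight_spmf (play Y S1 S2 (extend h True y))"
    and r2: "\<And>y. y \<in> set_pmf (S2 h) \<Longrightarrow> r2 \<le> weight_spmf (play Y S1 S2 (extend h False y))"
  shows "(r1 + r2) / 2 \<le> weight_spmf (play Y S1 S2 h)"
proof -
  have "ennreal ((max 0 r1 + max 0 r2) / 2) = (ennreal (max 0 r1) + ennreal (max 0 r2)) / 2"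
    by (rule ennreal_average[symmetric]) auto
  also have "\<dots> \<le> game_int Y S1 S2 (\<lambda>_. 1) h"
    unfolding game_int_step[OF assms(1)]
    by (intro divide_right_mono_ennreal add_mono nn_integral_pmf_ge_const)
      (auto simp: game_int_1 weight_spmf_nonneg intro!: ennreal_leI r1 r2)
  finally have "(max 0 r1 + max 0 r2) / 2 \<le> weight_spmf (play Y S1 S2 h)"
    by (simp add: game_int_1 weight_spmf_nonneg)
  moreover have "(r1 + r2) / 2 \<le> (max 0 r1 + max 0 r2) / 2"
    by (intro divide_right_mono add_mono) auto
  ultimately show ?thesis by (rule order_trans[rotated])
qed

text \<open>\<open>s / (1 + s)\<close> equals \<open>1 - 1 / (1 + s)\<close>: it is bounded and
  strictly concave, and its second difference stays away from 0 while \<open>s\<close> is bounded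
  and the increment is at least \<open>g\<close>.\<close>

lemma saturating_concave:
  fixes s t :: real
  assumes "0 < g" "g \<le> t" "t \<le> s" "s \<le> M"
  shows "(s + t) / (1 + (s + t)) + (s - t) / (1 + (s - t)) \<le> 2 * (s / (1 + s)) - 2 * g\<^sup>2 / (1 + M) ^ 3"
proof -
  define a where "a = 1 + s"
  have a: "0 < a" "0 < a - t" "0 < a + t" "a \<le> 1 + M" using assms by (auto simp: a_def)
  have "2 * (s / (1 + s)) - ((s + t) / (1 + (s + t)) + (s - t) / (1 + (s - t))) = 2 * t\<^sup>2 / (a * ((a + t) * (a - t)))"
  proof -
    have "s / (1 + s) = 1 - 1 / a" "(s + t) / (1 + (s + t)) = 1 - 1 / (a + t)"
      "(s - t) / (1 + (s - t)) = 1 - 1 / (a - t)"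
      using a by (auto simp: a_def field_simps)
    then have "2 * (s / (1 + s)) - ((s + t) / (1 + (s + t)) + (s - t) / (1 + (s - t)))
       = 1 / (a + t) + 1 / (a - t) - 2 / a" by simp
    also have "\<dots> = 2 * t\<^sup>2 / (a * ((a + t) * (a - t)))"
      using a by (simp add: divide_simps) (simp add: algebra_simps power2_eq_square)
    finally show ?thesis .
  qed
  moreover have "2 * g\<^sup>2 / (1 + M) ^ 3 \<le> 2 * t\<^sup>2 / (a * ((a + t) * (a - t)))"
  proof (rule frac_le)
    show "2 * g\<^sup>2 \<le> 2 * t\<^sup>2" using assms by (simp add: power_mono)
    have "(a + t) * (a - t) \<le> a * a" by (simp add: algebra_simps)
    then have "a * ((a + t) * (a - t)) \<le> a * (a * a)" using a by (intro mult_left_mono) auto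
    also have "\<dots> = a ^ 3" by (simp add: power3_eq_cube)
    also have "\<dots> \<le> (1 + M) ^ 3" using a by (intro power_mono) auto
    finally show "a * ((a + t) * (a - t)) \<le> (1 + M) ^ 3" .
  qed (use a in auto)
  ultimately show ?thesis by linarith
qed

text \<open>The probability of never stopping is dominated by every bounded strict supersolution; strict
  ones are obtained from the potential \<open>W\<close> by adding a multiple of a strictly concave function of it.\<close>

lemma lossless_play:
  fixes W :: "'a history \<Rightarrow> real"
  assumes W0: "\<And>h. 0 \<le> W h" and g: "0 < \<gamma>"
    and W: "\<And>h. position h \<notin> Y \<Longrightarrow> \<exists>b t. \<gamma> \<le> t
       \<and> (\<forall>y\<in>set_pmf ((if b then S1 else S2) h). W (extend h b y) \<le> W h - t)
       \<and> (\<forall>y\<in>set_pmf ((if b then S2 else S1) h). W (extend h (\<not> b) y) \<le> W h + t)"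
  shows "lossless_spmf (play Y S1 S2 h)"
proof -
  define \<rho> where "\<rho> h = 1 - weight_spmf (play Y S1 S2 h)" for h
  have rho: "0 \<le> \<rho> h" "\<rho> h \<le> 1" for h
    by (auto simp: \<rho>_def weight_spmf_le_1 weight_spmf_nonneg)
  have rhoY: "\<rho> h = 0" if "position h \<in> Y" for h
    by (simp only: \<rho>_def play_stop[OF that] weight_return_spmf diff_self)
  \<comment> \<open>The linear term confines the argument to \<open>W h \<le> 1 / l\<close>, because
    a probability is at most 1; there the saturating term gains uniformly from its strict concavity.
    In the end \<open>l\<close> and \<open>q\<close> are made small.\<close>
  have main: "\<rho> h \<le> l * W h + q * (W h / (1 + W h))" if l: "0 < l" and q: "0 < q" for l q h
  proof (rule ccontr)
    define B where "B s = l * s + q * (s / (1 + s))" for s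
    have B_mono: "B r \<le> B s" if "0 \<le> r" "r \<le> s" for r s
    proof -
      have "r / (1 + r) \<le> s / (1 + s)" using that by (simp add: divide_simps) (simp add: algebra_simps)
      then show ?thesis unfolding B_def using that l q by (intro add_mono mult_left_mono) auto
    qed
    have B0: "0 \<le> B s" if "0 \<le> s" for s unfolding B_def using that l q by simp
    assume "\<not> \<rho> h \<le> l * W h + q * (W h / (1 + W h))"
    then have pos: "0 < \<rho> h - B (W h)" by (simp add: B_def)
    define \<kappa> where "\<kappa> = (SUP h. \<rho> h - B (W h))"
    have bdd: "bdd_above (range (\<lambda>h. \<rho> h - B (W h)))"
    proof (rule bdd_aboveI2[where M = 1])
      fix h show "\<rho> h - B (W h) \<le> 1" using rho(2)[of h] B0[OF W0[of h]] by linarith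
    qed
    have up: "\<rho> h - B (W h) \<le> \<kappa>" for h unfolding \<kappa>_def by (rule cSUP_upper[OF _ bdd]) simp
    have kpos: "0 < \<kappa>" using up[of h] pos by linarith
    define c where "c = q * (\<gamma>\<^sup>2 / (1 + 1 / l) ^ 3)"
    have c: "0 < c" using l q g by (simp add: c_def add_pos_pos)
    \<comment> \<open>Here the excess over the barrier is within \<open>c\<close> of its supremum,
      while averaging over one turn loses at least \<open>c\<close>: a contradiction. The minimum
      with \<open>\<kappa>\<close> keeps the excess positive, so the game has not yet
      stopped.\<close>
    obtain h1 where h1: "\<kappa> - min c \<kappa> < \<rho> h1 - B (W h1)"
      using less_cSUP_iff[OF _ bdd, of "\<kappa> - min c \<kappa>"] c kpos unfolding \<kappa>_def[symmetric] by auto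
    have p1: "0 < \<rho> h1 - B (W h1)" using h1 by linarith
    then have nY: "position h1 \<notin> Y" using rhoY[of h1] B0[OF W0[of h1]] by auto
    have "l * W h1 \<le> B (W h1)" unfolding B_def using q W0[of h1] by simp
    then have "l * W h1 \<le> 1" using p1 rho(2)[of h1] by linarith
    then have WM: "W h1 \<le> 1 / l" using l by (simp add: field_simps)
    obtain b t where t: "\<gamma> \<le> t"
      and dn: "\<And>y. y \<in> set_pmf ((if b then S1 else S2) h1) \<Longrightarrow> W (extend h1 b y) \<le> W h1 - t"
      and upw: "\<And>y. y \<in> set_pmf ((if b then S2 else S1) h1) \<Longrightarrow> W (extend h1 (\<not> b) y) \<le> W h1 + t"
      using W[OF nY] by blast
    obtain y0 where "y0 \<in> set_pmf ((if b then S1 else S2) h1)"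
      using set_pmf_not_empty by fast
    then have tW: "t \<le> W h1" using dn[of y0] W0[of "extend h1 b y0"] by linarith
    define lo where "lo = 1 - (B (W h1 - t) + \<kappa>)"
    define hi where "hi = 1 - (B (W h1 + t) + \<kappa>)"
    have dn': "lo \<le> weight_spmf (play Y S1 S2 (extend h1 b y))"
      if "y \<in> set_pmf ((if b then S1 else S2) h1)" for y
      using up[of "extend h1 b y"] B_mono[OF W0 dn[OF that]] by (simp add: \<rho>_def lo_def)
    have up': "hi \<le> weight_spmf (play Y S1 S2 (extend h1 (\<not> b) y))"
      if "y \<in> set_pmf ((if b then S2 else S1) h1)" for y
      using up[of "extend h1 (\<not> b) y"] B_mono[OF W0 upw[OF that]] by (simp add: \<rho>_def hi_def)
    have "(lo + hi) / 2 \<le> weight_spmf (play Y S1 S2 h1)"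
    proof (cases b)
      case True
      then show ?thesis using dn' up' by (intro weight_play_step[OF nY]) auto
    next
      case False
      have "(hi + lo) / 2 \<le> weight_spmf (play Y S1 S2 h1)"
        using False dn' up' by (intro weight_play_step[OF nY]) auto
      then show ?thesis by (simp add: add.commute)
    qed
    then have "\<rho> h1 \<le> (B (W h1 - t) + B (W h1 + t)) / 2 + \<kappa>"
      by (simp add: \<rho>_def lo_def hi_def field_simps)
    also have "(B (W h1 - t) + B (W h1 + t)) / 2 \<le> B (W h1) - c"
    proof -
      define u1 u2 u0 c0 where "u1 = (W h1 + t) / (1 + (W h1 + t))" and "u2 = (W h1 - t) / (1 + (W h1 - t))"
        and "u0 = W h1 / (1 + W h1)" and "c0 = \<gamma>\<^sup>2 / (1 + 1 / l) ^ 3"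
      have "u1 + u2 \<le> 2 * u0 - 2 * c0"
        using saturating_concave[OF g t tW WM] by (simp add: u1_def u2_def u0_def c0_def)
      then have "q * (u1 + u2) \<le> q * (2 * u0 - 2 * c0)" using q by (intro mult_left_mono) auto
      then show ?thesis unfolding B_def c_def u1_def[symmetric] u2_def[symmetric] u0_def[symmetric] c0_def[symmetric]
        by (simp add: field_simps)
    qed
    finally show False using h1 by linarith
  qed
  have "\<rho> h \<le> 0"
  proof (rule field_le_epsilon)
    fix e :: real assume e: "0 < e"
    let ?s = "W h"
    have s: "0 \<le> ?s" by (rule W0)
    have "\<rho> h \<le> e / 2 / (1 + ?s) * ?s + e / 2 * (?s / (1 + ?s))"
      using main[of "e / 2 / (1 + ?s)" "e / 2" h] e s by simp
    also have "e / 2 / (1 + ?s) * ?s = e / 2 * (?s / (1 + ?s))" by simp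
    also have "e / 2 * (?s / (1 + ?s)) + e / 2 * (?s / (1 + ?s)) = e * (?s / (1 + ?s))"
      by (metis distrib_right field_sum_of_halves)
    also have "\<dots> \<le> e * 1" using e s by (intro mult_left_mono) (auto simp: divide_simps)
    finally show "\<rho> h \<le> 0 + e" by simp
  qed
  then have "weight_spmf (play Y S1 S2 h) = 1"
    using weight_spmf_le_1[of "play Y S1 S2 h"] unfolding \<rho>_def by linarith
  then show ?thesis by (simp add: lossless_spmf_def)
qed


section \<open>Invariants and changes of histories\<close>

text \<open>The function that is 0 on \<open>Inv\<close> and infinite elsewhere satisfies the
  one-step inequality, so the bad endings have integral 0.\<close>

lemma play_invariant:
  assumes "Inv h"
    and pres: "\<And>h b y. Inv h \<Longrightarrow> position h \<notin> Y \<Longrightarrow> y \<in> set_pmf ((if b then S1 else S2) h) \<Longrightarrow> Inv (extend h b y)"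
    and "h' \<in> set_spmf (play Y S1 S2 h)"
  shows "Inv h' \<and> position h' \<in> Y"
proof -
  have nn0: "(\<integral>\<^sup>+ y. g y \<partial>measure_pmf p) = 0" if "\<And>y. y \<in> set_pmf p \<Longrightarrow> g y = 0" for g and p :: "'a pmf"
    using nn_integral_pmf_le_const[of p g 0] that by auto
  let ?g = "\<lambda>h. indicator {h. \<not> (Inv h \<and> position h \<in> Y)} h :: ennreal"
  have "game_int Y S1 S2 ?g h \<le> (if Inv h then 0 else top)"
  proof (rule game_int_least)
    fix h assume "position h \<notin> Y"
    show "toss_mean S1 S2 (\<lambda>h. if Inv h then 0 else top) h
      \<le> (if Inv h then 0 else top :: ennreal)"
    proof (cases "Inv h")
      case True
      have "(\<integral>\<^sup>+ y. (if Inv (extend h True y) then 0 else top) \<partial>measure_pmf (S1 h)) = (0 :: ennreal)"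
        by (rule nn0) (use pres[OF True \<open>position h \<notin> Y\<close>, of _ True] in auto)
      moreover have "(\<integral>\<^sup>+ y. (if Inv (extend h False y) then 0 else top) \<partial>measure_pmf (S2 h)) = (0 :: ennreal)"
        by (rule nn0) (use pres[OF True \<open>position h \<notin> Y\<close>, of _ False] in auto)
      ultimately show ?thesis using True by simp
    qed simp
  qed (auto split: split_indicator)
  then have "game_int Y S1 S2 ?g h = 0" using assms(1) by simp
  then have "AE h' in measure_spmf (play Y S1 S2 h). ?g h' = 0"
    unfolding game_int_def by (subst (asm) nn_integral_0_iff_AE) auto
  then show ?thesis using assms(3) by (auto simp: AE_measure_spmf_iff split: split_indicator_asm)
qed

lemma spmf_eqI_nn_integral:
  assumes "\<And>g. (\<integral>\<^sup>+ x. g x \<partial>measure_spmf p) = (\<integral>\<^sup>+ x. g x \<partial>measure_spmf q)"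
  shows "p = q"
proof (rule spmf_eqI)
  fix x
  have "ennreal (spmf p x) = ennreal (spmf q x)"
    using assms[of "indicator {x}"] by (simp add: emeasure_spmf_single)
  then show "spmf p x = spmf q x" by simp
qed

text \<open>Two changes of histories are intended: putting one more turn in front (\<open>fl\<close>
  false) and reversing all tosses (\<open>fl\<close> true). Each of the two inequalities follows
  from the minimality of one of the laws.\<close>

lemma play_transport:
  fixes \<phi> :: "'a history \<Rightarrow> 'a history"
  assumes inj: "inj \<phi>" and pos: "\<And>h. position (\<phi> h) = position h"
    and ext: "\<And>h b y. \<phi> (extend h b y) = extend (\<phi> h) (b \<noteq> fl) y"
    and T1: "\<And>h. T1 h = (if fl then S2 else S1) (\<phi> h)"
    and T2: "\<And>h. T2 h = (if fl then S1 else S2) (\<phi> h)"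
  shows "play Y S1 S2 (\<phi> h) = map_spmf \<phi> (play Y T1 T2 h)"
proof (rule spmf_eqI_nn_integral)
  fix g
  have ext': "extend (\<phi> h) b y = \<phi> (extend h (b \<noteq> fl) y)" for h b y
    using ext[of h "b \<noteq> fl" y] by (cases fl) auto
  have swap: "((\<integral>\<^sup>+ y. A True y \<partial>measure_pmf (S1 (\<phi> h))) + (\<integral>\<^sup>+ y. A False y \<partial>measure_pmf (S2 (\<phi> h)))) / 2
    = ((\<integral>\<^sup>+ y. A (True \<noteq> fl) y \<partial>measure_pmf (T1 h)) + (\<integral>\<^sup>+ y. A (False \<noteq> fl) y \<partial>measure_pmf (T2 h))) / (2 :: ennreal)"
    for A and h :: "'a history"
    by (cases fl) (simp_all add: T1 T2 add.commute)
  have "game_int Y T1 T2 (g \<circ> \<phi>) h \<le> game_int Y S1 S2 g (\<phi> h)"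
  proof (rule game_int_least)
    fix h assume "position h \<notin> Y"
    then show "toss_mean T1 T2 (\<lambda>h. game_int Y S1 S2 g (\<phi> h)) h
      \<le> game_int Y S1 S2 g (\<phi> h)"
      by (subst game_int_step[of "\<phi> h"]) (simp_all add: pos ext swap[where h = h and A = "\<lambda>b y. game_int Y S1 S2 g (extend (\<phi> h) b y)"])
  qed (simp add: game_int_stop pos)
  \<comment> \<open>Play started in the range of \<open>\<phi>\<close> never leaves it, so the bound
    may be infinite outside.\<close>
  moreover have "game_int Y S1 S2 g (\<phi> h)
      \<le> (if \<phi> h \<in> range \<phi> then game_int Y T1 T2 (g \<circ> \<phi>) (inv \<phi> (\<phi> h)) else top)"
  proof (rule game_int_least)
    fix h' :: "'a history" assume "position h' \<in> Y"
    then show "g h' \<le> (if h' \<in> range \<phi> then game_int Y T1 T2 (g \<circ> \<phi>) (inv \<phi> h') else top)"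
      by (auto simp: inv_f_f[OF inj] pos game_int_stop)
  next
    fix h' :: "'a history" assume *: "position h' \<notin> Y"
    show "toss_mean S1 S2 (\<lambda>h. if h \<in> range \<phi> then game_int Y T1 T2 (g \<circ> \<phi>) (inv \<phi> h) else top) h'
        \<le> (if h' \<in> range \<phi> then game_int Y T1 T2 (g \<circ> \<phi>) (inv \<phi> h') else top)"
    proof (cases "h' \<in> range \<phi>")
      case True
      then obtain h where h: "h' = \<phi> h" by auto
      show ?thesis using *
        unfolding h ext' swap[where h = h and A = "\<lambda>b y. if \<phi> (extend h (b \<noteq> fl) y) \<in> range \<phi>
            then game_int Y T1 T2 (g \<circ> \<phi>) (inv \<phi> (\<phi> (extend h (b \<noteq> fl) y))) else top"]
        by (cases fl) (simp_all add: inv_f_f[OF inj] pos game_int_step)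
    qed simp
  qed
  ultimately have "game_int Y S1 S2 g (\<phi> h) = game_int Y T1 T2 (g \<circ> \<phi>) h"
    by (simp add: inv_f_f[OF inj])
  then show "(\<integral>\<^sup>+ x. g x \<partial>measure_spmf (play Y S1 S2 (\<phi> h)))
    = (\<integral>\<^sup>+ x. g x \<partial>measure_spmf (map_spmf \<phi> (play Y T1 T2 h)))"
    by (simp add: game_int_def measure_map_spmf nn_integral_distr o_def)
qed

lemma play_cong:
  assumes "Inv h" and ext: "\<And>h b y. Inv h \<Longrightarrow> Inv (extend h b y)"
    and 1: "\<And>h. Inv h \<Longrightarrow> S1 h = T1 h" and 2: "\<And>h. Inv h \<Longrightarrow> S2 h = T2 h"
  shows "play Y S1 S2 h = play Y T1 T2 h"
proof (rule spmf_eqI_nn_integral)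
  fix g
  have le: "game_int Y A1 A2 g h \<le> game_int Y B1 B2 g h"
    if "\<And>h. Inv h \<Longrightarrow> A1 h = B1 h" "\<And>h. Inv h \<Longrightarrow> A2 h = B2 h" for A1 A2 B1 B2 :: "'a strategy"
  proof -
    have "game_int Y A1 A2 g h \<le> (if Inv h then game_int Y B1 B2 g h else top)"
    proof (rule game_int_least)
      fix h assume "position h \<notin> Y"
      then show "toss_mean A1 A2 (\<lambda>h. if Inv h then game_int Y B1 B2 g h else top) h
        \<le> (if Inv h then game_int Y B1 B2 g h else top)"
        by (cases "Inv h") (simp_all add: ext that game_int_step)
    qed (simp add: game_int_stop)
    then show ?thesis using assms(1) by simp
  qed
  show "(\<integral>\<^sup>+ x. g x \<partial>measure_spmf (play Y S1 S2 h)) = (\<integral>\<^sup>+ x. g x \<partial>measure_spmf (play Y T1 T2 h))"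
    using le[of S1 T1 S2 T2] le[of T1 S1 T2 S2] 1 2 unfolding game_int_def by (intro antisym) auto
qed

section \<open>Payoffs, expectations and their elementary bounds\<close>

lemma position_extend [simp]: "position (extend h b y) = y"
  by (simp add: position_def positions_def extend_def)

lemma butlast_positions_extend: "butlast (positions (extend h b y)) = butlast (positions h) @ [position h]"
  by (simp add: positions_def extend_def position_def butlast_append)

lemma position_start [simp]: "position (x, []) = x"
  by (simp add: position_def positions_def)

lemma payoff_lower:
  assumes F: "\<And>x. x \<in> Y \<Longrightarrow> m \<le> F x" and f: "\<And>x. x \<notin> Y \<Longrightarrow> 0 \<le> f x"
    and h: "h \<in> set_spmf (play Y S1 S2 (x, []))"
  shows "m \<le> payoff F f eps h"
proof -
  have "(\<forall>x\<in>set (butlast (positions h)). x \<notin> Y) \<and> position h \<in> Y"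
  proof (rule play_invariant[OF _ _ h])
    show "\<forall>y\<in>set (butlast (positions (x, []))). y \<notin> Y" by (simp add: positions_def)
  qed (auto simp: butlast_positions_extend)
  then have "0 \<le> (\<Sum>x\<leftarrow>butlast (positions h). f x)" "m \<le> F (position h)"
    using F f by (auto intro!: sum_list_nonneg)
  then show ?thesis unfolding payoff_def by (simp add: add_increasing2)
qed

lemma nn_integral_const_lossless:
  "lossless_spmf p \<Longrightarrow> (\<integral>\<^sup>+ h. c \<partial>measure_spmf p) = c"
  by (simp add: space_measure_spmf measure_spmf.emeasure_eq_measure lossless_spmf_def weight_spmf_def)

text \<open>Taking out the constant \<open>m\<close> turns expectations into integrals of
  nonnegative functions, to which the one-step inequality applies; the negative part is finite
  because it is at most \<open>\<bar>m\<bar>\<close>.\<close>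

lemma expectation_bounded_below:
  assumes p: "lossless_spmf p" and m: "\<And>h. h \<in> set_spmf p \<Longrightarrow> m \<le> g h"
  shows "has_expectation p g"
    and "expectation p g = enn2ereal (\<integral>\<^sup>+ h. ennreal (g h - m) \<partial>measure_spmf p) + ereal m"
proof -
  let ?G = "\<integral>\<^sup>+ h. ennreal (g h - m) \<partial>measure_spmf p"
  have N: "expect_neg p g \<le> ennreal \<bar>m\<bar>"
  proof -
    have "expect_neg p g \<le> (\<integral>\<^sup>+ h. ennreal \<bar>m\<bar> \<partial>measure_spmf p)"
      unfolding expect_neg_def
      by (rule nn_integral_mono_AE) (auto simp: AE_measure_spmf_iff intro!: ennreal_leI dest!: m)
    then show ?thesis by (simp only: nn_integral_const_lossless[OF p])
  qed
  then have Nfin: "expect_neg p g < top" using le_less_trans by fastforce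
  then show "has_expectation p g" by (simp add: has_expectation_def)
  have "?G + expect_neg p g + ennreal (max 0 m)
      = (\<integral>\<^sup>+ h. ennreal (g h - m) + ennreal (- g h) + ennreal (max 0 m) \<partial>measure_spmf p)"
    unfolding expect_neg_def by (simp add: nn_integral_add nn_integral_const_lossless[OF p] del: nn_integral_const)
  \<comment> \<open>This is \<open>g - m = g^+ - g^- - m^+ + m^-\<close> with each term moved to the
    side where it is added, so that nothing infinite is subtracted.\<close>
  also have "\<dots> = (\<integral>\<^sup>+ h. ennreal (g h) + ennreal (max 0 (- m)) \<partial>measure_spmf p)"
  proof (rule nn_integral_cong_AE, unfold AE_measure_spmf_iff, intro ballI)
    fix h assume "h \<in> set_spmf p"
    then have "m \<le> g h" by (rule m)
    have pos: "ennreal r = ennreal (max 0 r)" for r by (simp add: max_def ennreal_neg)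
    have plus: "ennreal (max 0 a) + ennreal (max 0 b) = ennreal (max 0 a + max 0 b)"
      "ennreal (max 0 a + max 0 b) + ennreal (max 0 c) = ennreal (max 0 a + max 0 b + max 0 c)" for a b c
      by (simp_all only: ennreal_plus max.cobounded1 add_nonneg_nonneg)
    show "ennreal (g h - m) + ennreal (- g h) + ennreal (max 0 m) = ennreal (g h) + ennreal (max 0 (- m))"
      unfolding pos[of "g h - m"] pos[of "- g h"] pos[of "g h"] plus
      using \<open>m \<le> g h\<close> by (intro arg_cong[where f = ennreal]) (simp add: max_def)
  qed
  also have "\<dots> = expect_pos p g + ennreal (max 0 (- m))"
    unfolding expect_pos_def by (simp add: nn_integral_add nn_integral_const_lossless[OF p] del: nn_integral_const)
  finally have "enn2ereal ?G + enn2ereal (expect_neg p g) + ereal (max 0 m) = enn2ereal (expect_pos p g) + ereal (max 0 (- m))"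
    by (metis enn2ereal_ennreal max.cobounded1 plus_ennreal.rep_eq)
  moreover obtain n where "enn2ereal (expect_neg p g) = ereal n"
    using Nfin by (cases "expect_neg p g" rule: ennreal_cases) auto
  moreover define a b where "a = max 0 m" and "b = max 0 (- m)"
  moreover have "m = a - b" by (simp add: a_def b_def max_def)
  ultimately show "expectation p g = enn2ereal ?G + ereal m"
    unfolding expectation_def a_def[symmetric] b_def[symmetric]
    by (cases "enn2ereal ?G"; cases "enn2ereal (expect_pos p g)") auto
qed

lemma F_minus_plus_eq:
  fixes eps m :: real
  assumes F: "\<And>x. x \<in> Y \<Longrightarrow> m \<le> F x" and f: "\<And>x. x \<notin> Y \<Longrightarrow> 0 \<le> f x"
    and p: "lossless_spmf (play Y S1 S2 (x, []))"
  defines V: "V \<equiv> enn2ereal (game_int Y S1 S2 (\<lambda>h. ennreal (payoff F f eps h - m)) (x, [])) + ereal m"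
  shows "F_minus Y F f eps x S1 S2 = V" and "F_plus Y F f eps x S1 S2 = V"
  using expectation_bounded_below[where g = "payoff F f eps", OF p payoff_lower[OF F f]] p
  by (simp_all add: F_minus_def F_plus_def Let_def V game_int_def)

lemma F_minus_stop: "x \<in> Y \<Longrightarrow> F_minus Y F f eps x S1 S2 = ereal (F x)"
  and F_plus_stop: "x \<in> Y \<Longrightarrow> F_plus Y F f eps x S1 S2 = ereal (F x)"
proof -
  assume x: "x \<in> Y"
  let ?p = "return_spmf (x, []) :: 'a history spmf"
  have "expectation ?p (payoff F f eps) = ereal (F x)" "has_expectation ?p (payoff F f eps)"
    using expectation_bounded_below[of ?p "F x" "payoff F f eps"]
    by (simp_all add: measure_spmf_return_spmf nn_integral_return payoff_def positions_def zero_ennreal.rep_eq)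
  then show "F_minus Y F f eps x S1 S2 = ereal (F x)" "F_plus Y F f eps x S1 S2 = ereal (F x)"
    using x by (simp_all add: F_minus_def F_plus_def Let_def play_stop)
qed

lemma F_minus_le_F_plus: "F_minus Y F f eps x S1 S2 \<le> F_plus Y F f eps x S1 S2"
  by (simp add: F_minus_def F_plus_def Let_def)

lemma value_I_le_value_II: "value_I \<S> Y F f eps x \<le> value_II \<S> Y F f eps x"
  unfolding value_I_def value_II_def
proof (rule SUP_least, rule INF_greatest)
  fix S1 S2 assume "S1 \<in> \<S> eps" "S2 \<in> \<S> eps"
  then have "(INF S2\<in>\<S> eps. F_minus Y F f eps x S1 S2) \<le> F_minus Y F f eps x S1 S2" by (intro INF_lower)
  also have "\<dots> \<le> F_plus Y F f eps x S1 S2" by (rule F_minus_le_F_plus)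
  also have "\<dots> \<le> (SUP S1\<in>\<S> eps. F_plus Y F f eps x S1 S2)" using \<open>S1 \<in> \<S> eps\<close> by (intro SUP_upper)
  finally show "(INF S2\<in>\<S> eps. F_minus Y F f eps x S1 S2) \<le> (SUP S1\<in>\<S> eps. F_plus Y F f eps x S1 S2)" .
qed

section \<open>Supersolutions\<close>

text \<open>\<open>2 v x \<ge> sup v + inf v + 2 eps\<^sup>2 c\<close> over the ball, phrased so that \<open>v\<close> may be unbounded.\<close>

definition super_at :: "real \<Rightarrow> real \<Rightarrow> ('a::metric_space \<Rightarrow> real) \<Rightarrow> 'a \<Rightarrow> bool" where
  "super_at eps c v x \<longleftrightarrow> (\<forall>\<eta>>0. \<exists>z\<in>ball x eps. \<forall>y\<in>ball x eps. v y + v z + 2 * eps\<^sup>2 * c \<le> 2 * v x + \<eta>)"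

text \<open>A strategy for player II that follows a supersolution with summable errors; the drop \<open>\<delta>\<close>
  forces the game to stop.\<close>

lemma F_plus_le_super:
  assumes eps: "0 < eps" and m: "\<And>x. m \<le> P x" and FP: "\<And>x. x \<in> Y \<Longrightarrow> F x \<le> P x"
    and F: "\<And>x. x \<in> Y \<Longrightarrow> m \<le> F x" and f: "\<And>x. x \<notin> Y \<Longrightarrow> 0 \<le> f x"
    and \<eta>: "0 < \<eta>" and \<delta>: "0 < \<delta>"
    and P: "\<And>x \<theta>. x \<notin> Y \<Longrightarrow> 0 < \<theta> \<Longrightarrow> \<exists>z\<in>ball x eps. P z \<le> P x - \<delta> + \<theta>
        \<and> (\<forall>y\<in>ball x eps. P y + P z + 2 * eps\<^sup>2 * f x \<le> 2 * P x + \<theta>)"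
  shows "\<exists>\<sigma>. (\<forall>h. \<sigma> h \<in> ball (position h) eps) \<and> (\<forall>S1. (\<forall>h. set_pmf (S1 h) \<subseteq> ball (position h) eps) \<longrightarrow>
           F_plus Y F f eps x S1 (\<lambda>h. return_pmf (\<sigma> h)) \<le> ereal (P x + \<eta>))"
proof -
  \<comment> \<open>At turn \<open>n\<close> half of the budget \<open>\<eta> / 2 ^ n\<close> kept
    in the potential \<open>W\<close> is spent; the cap \<open>\<delta> / 2\<close> saves half of
    the drop and thereby termination.\<close>
  define tol where "tol h = min (\<eta> / 2 ^ length (snd h)) (\<delta> / 2)" for h :: "'a history"
  have tol: "0 < tol h" "tol h \<le> \<delta> / 2" "tol h \<le> \<eta> / 2 ^ length (snd h)" for h
  proof -
    show "0 < tol h" using \<eta> \<delta> by (simp add: tol_def)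
  qed (unfold tol_def, rule min.cobounded2, rule min.cobounded1)
  have "\<exists>z\<in>ball (position h) eps. position h \<notin> Y \<longrightarrow> P z \<le> P (position h) - \<delta> + tol h
        \<and> (\<forall>y\<in>ball (position h) eps. P y + P z + 2 * eps\<^sup>2 * f (position h) \<le> 2 * P (position h) + tol h)" for h
    using P[of "position h" "tol h"] tol(1) eps by (cases "position h \<in> Y") (auto intro!: exI[of _ "position h"])
  then obtain \<sigma> where \<sigma>: "\<And>h. \<sigma> h \<in> ball (position h) eps"
    and dn: "\<And>h. position h \<notin> Y \<Longrightarrow> P (\<sigma> h) \<le> P (position h) - \<delta> + tol h"
    and up: "\<And>h y. position h \<notin> Y \<Longrightarrow> y \<in> ball (position h) eps \<Longrightarrow>
        P y + P (\<sigma> h) + 2 * eps\<^sup>2 * f (position h) \<le> 2 * P (position h) + tol h"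
    by metis
  define W where "W h = P (position h) - m + \<eta> / 2 ^ length (snd h)" for h
  have W_ext: "W (extend h b y) = P y - m + \<eta> / 2 ^ length (snd h) / 2" for h b y
    unfolding W_def position_extend by (simp add: extend_def)
  have W0: "0 \<le> W h" for h using m[of "position h"] \<eta> by (simp add: W_def)
  have Wup: "W (extend h b y) + W (extend h b' (\<sigma> h)) + 2 * eps\<^sup>2 * f (position h) \<le> 2 * W h"
    if "position h \<notin> Y" "y \<in> ball (position h) eps" for h b b' y
    using up[OF that] tol(3)[of h] by (simp add: W_ext) (simp add: W_def)
  show ?thesis
  proof (intro exI conjI allI impI)
    fix S1 :: "'a strategy" assume S1: "\<forall>h. set_pmf (S1 h) \<subseteq> ball (position h) eps"
    let ?S = "\<lambda>h. return_pmf (\<sigma> h)"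
    have lossless: "lossless_spmf (play Y S1 ?S (x, []))"
    proof (rule lossless_play[where W = W and \<gamma> = "\<delta> / 2"])
      fix h assume h: "position h \<notin> Y"
      define t where "t = W h - W (extend h False (\<sigma> h))"
      have "\<delta> / 2 \<le> t" using dn[OF h] tol(2)[of h] divide_pos_pos[OF \<eta>, of "2 ^ length (snd h)"] unfolding t_def W_ext by (simp add: W_def)
      moreover have "W (extend h True y) \<le> W h + t" if "y \<in> set_pmf (S1 h)" for y
        using Wup[OF h, of y True False] f[OF h] S1 that unfolding t_def
        by (smt (verit, best) mult_nonneg_nonneg subsetD zero_le_power2)
      ultimately show "\<exists>b t. \<delta> / 2 \<le> t
         \<and> (\<forall>y\<in>set_pmf ((if b then S1 else ?S) h). W (extend h b y) \<le> W h - t)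
         \<and> (\<forall>y\<in>set_pmf ((if b then ?S else S1) h). W (extend h (\<not> b) y) \<le> W h + t)"
        by (intro exI[of _ False] exI[of _ t]) (simp add: t_def)
    qed (use W0 \<delta> in auto)
    \<comment> \<open>The potential plus the running payoff already earned. Histories that continue
      after reaching \<open>Y\<close> do not occur and get the value infinity.\<close>
    define J where "J h = (if \<forall>x\<in>set (butlast (positions h)). x \<notin> Y
       then ennreal (W h + eps\<^sup>2 * (\<Sum>x\<leftarrow>butlast (positions h). f x)) else top)" for h
    have "game_int Y S1 ?S (\<lambda>h. ennreal (payoff F f eps h - m)) (x, []) \<le> J (x, [])"
    proof (rule game_int_least)
      fix h assume h: "position h \<in> Y"
      have "payoff F f eps h - m \<le> W h + eps\<^sup>2 * (\<Sum>x\<leftarrow>butlast (positions h). f x)"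
        using FP[OF h] \<eta> by (simp add: payoff_def W_def add_increasing2)
      then show "ennreal (payoff F f eps h - m) \<le> J h" by (auto simp: J_def intro: ennreal_leI)
    next
      fix h assume h: "position h \<notin> Y"
      show "toss_mean S1 ?S J h \<le> J h"
      proof (cases "\<forall>x\<in>set (butlast (positions h)). x \<notin> Y")
        case True
        define s where "s = eps\<^sup>2 * (\<Sum>x\<leftarrow>butlast (positions h). f x)"
        have s: "0 \<le> s" using True f unfolding s_def by (intro mult_nonneg_nonneg sum_list_nonneg) auto
        have f0: "0 \<le> eps\<^sup>2 * f (position h)" using f[OF h] by simp
        have J_ext: "J (extend h b y) = ennreal (W (extend h b y) + s + eps\<^sup>2 * f (position h))" for b y
          using True h by (simp add: J_def butlast_positions_extend s_def algebra_simps)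
        have Jh: "J h = ennreal (W h + s)" using True by (simp add: J_def s_def)
        define r where "r = W (extend h False (\<sigma> h))"
        have "r \<ge> 0" unfolding r_def by (rule W0)
        define q where "q = 2 * W h - r - 2 * eps\<^sup>2 * f (position h)"
        have q: "W (extend h True y) \<le> q" if "y \<in> ball (position h) eps" for y
          using Wup[OF h that, of True False] by (simp add: q_def r_def)
        have "0 \<le> q" using q[OF \<sigma>] W0 order_trans by blast
        have "(\<integral>\<^sup>+ y. J (extend h True y) \<partial>measure_pmf (S1 h)) \<le> ennreal (q + s + eps\<^sup>2 * f (position h))"
          using S1 q by (intro nn_integral_pmf_le_const) (auto simp: J_ext subset_iff intro!: ennreal_leI)
        then have "toss_mean S1 ?S J h
          \<le> (ennreal (q + s + eps\<^sup>2 * f (position h)) + ennreal (r + s + eps\<^sup>2 * f (position h))) / 2"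
          by (intro divide_right_mono_ennreal add_mono) (simp_all add: J_ext r_def)
        also have "\<dots> = ennreal (W h + s)"
        proof -
          have "(q + s + eps\<^sup>2 * f (position h) + (r + s + eps\<^sup>2 * f (position h))) / 2 = W h + s"
            by (simp add: q_def)
          moreover have "0 \<le> q + s + eps\<^sup>2 * f (position h)" "0 \<le> r + s + eps\<^sup>2 * f (position h)"
            using s f0 \<open>0 \<le> q\<close> \<open>0 \<le> r\<close> by linarith+
          ultimately show ?thesis by (simp only: ennreal_average)
        qed
        finally show ?thesis by (simp add: Jh)
      next
        case False
        then have "J h = top" by (auto simp: J_def)
        then show ?thesis by simp
      qed
    qed
    also have "J (x, []) = ennreal (P x - m + \<eta>)" by (simp add: J_def positions_def W_def)
    finally have "enn2ereal (game_int Y S1 ?S (\<lambda>h. ennreal (payoff F f eps h - m)) (x, [])) \<le> ereal (P x - m + \<eta>)"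
      using m[of x] \<eta> by (simp add: less_eq_ennreal.rep_eq del: ennreal_plus)
    then show "F_plus Y F f eps x S1 ?S \<le> ereal (P x + \<eta>)"
      using F_minus_plus_eq(2)[where eps = eps, OF F f lossless]
      by (cases "enn2ereal (game_int Y S1 ?S (\<lambda>h. ennreal (payoff F f eps h - m)) (x, []))") auto
  qed (use \<sigma> in auto)
qed

section \<open>The value of the game as the least supersolution\<close>

text \<open>Treats pure and random strategies together. Strategies are restricted by a condition on
  each single move, so they can be pasted along histories, and every deterministic legal move is
  allowed.\<close>

locale moves =
  fixes \<S> :: "real \<Rightarrow> 'a::metric_space strategy set" and eps :: real and A :: "'a \<Rightarrow> 'a pmf set"
  assumes eps: "0 < eps" and S: "\<S> eps = {S. \<forall>h. S h \<in> A (position h)}"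
    and ret: "\<And>x y. y \<in> ball x eps \<Longrightarrow> return_pmf y \<in> A x"
    and legal: "\<And>x \<mu>. \<mu> \<in> A x \<Longrightarrow> set_pmf \<mu> \<subseteq> ball x eps"
begin

lemma pure_mem: "(\<And>h. \<sigma> h \<in> ball (position h) eps) \<Longrightarrow> (\<lambda>h. return_pmf (\<sigma> h)) \<in> \<S> eps"
  using ret by (auto simp: S)

lemma stay_mem: "(\<lambda>h. return_pmf (position h)) \<in> \<S> eps"
  using eps by (intro pure_mem) simp

lemma moves_nonempty: "\<S> eps \<noteq> {}"
  using stay_mem by auto

lemma mem_legal: "T \<in> \<S> eps \<Longrightarrow> set_pmf (T h) \<subseteq> ball (position h) eps"
  using legal S by auto

lemma value_I_stop: "x \<in> Y \<Longrightarrow> value_I \<S> Y F f eps x = ereal (F x)"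
  unfolding value_I_def by (simp add: F_minus_stop moves_nonempty)

lemma value_II_le:
  assumes "\<And>h. \<sigma> h \<in> ball (position h) eps"
    and "\<And>S1. (\<forall>h. set_pmf (S1 h) \<subseteq> ball (position h) eps) \<Longrightarrow>
           F_plus Y F f eps x S1 (\<lambda>h. return_pmf (\<sigma> h)) \<le> c"
  shows "value_II \<S> Y F f eps x \<le> c"
  unfolding value_II_def
  by (rule INF_lower2[OF pure_mem[OF assms(1)]], rule SUP_least, rule assms(2)) (use mem_legal in auto)

text \<open>Player I lowers the count \<open>j\<close> by at least 1 after each toss won, and it
  rises by at most 1 otherwise; this forces the game to stop, with a payoff of at least
  \<open>m\<close>.\<close>

lemma value_I_ge:
  assumes F: "\<And>x. x \<in> Y \<Longrightarrow> m \<le> F x" and f: "\<And>x. x \<notin> Y \<Longrightarrow> 0 \<le> f x"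
    and j: "\<And>x. x \<notin> Y \<Longrightarrow> \<exists>z\<in>ball x eps. Suc (j z) \<le> j x"
    and j': "\<And>x y. x \<notin> Y \<Longrightarrow> y \<in> ball x eps \<Longrightarrow> j y \<le> Suc (j x)"
  shows "ereal m \<le> value_I \<S> Y F f eps x"
proof -
  have "\<exists>z\<in>ball (position h) eps. position h \<notin> Y \<longrightarrow> Suc (j z) \<le> j (position h)" for h
    using j[of "position h"] eps by (cases "position h \<in> Y") (auto intro!: exI[of _ "position h"])
  then obtain \<sigma> where \<sigma>: "\<And>h. \<sigma> h \<in> ball (position h) eps"
    and dn: "\<And>h. position h \<notin> Y \<Longrightarrow> Suc (j (\<sigma> h)) \<le> j (position h)"
    by metis
  show ?thesis
    unfolding value_I_def
  proof (rule SUP_upper2[OF pure_mem[OF \<sigma>]], rule INF_greatest)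
    fix S2 assume S2: "S2 \<in> \<S> eps"
    let ?S = "\<lambda>h. return_pmf (\<sigma> h)"
    have lossless: "lossless_spmf (play Y ?S S2 (x, []))"
    proof (rule lossless_play[where W = "\<lambda>h. real (j (position h))" and \<gamma> = 1])
      fix h assume h: "position h \<notin> Y"
      have "real (j (\<sigma> h)) \<le> real (j (position h)) - 1" using dn[OF h] by simp
      moreover have "real (j y) \<le> real (j (position h)) + 1" if "y \<in> set_pmf (S2 h)" for y
        using j'[OF h, of y] mem_legal[OF S2, of h] that by fastforce
      ultimately show "\<exists>b t. 1 \<le> t
         \<and> (\<forall>y\<in>set_pmf ((if b then ?S else S2) h). real (j (position (extend h b y))) \<le> real (j (position h)) - t)
         \<and> (\<forall>y\<in>set_pmf ((if b then S2 else ?S) h). real (j (position (extend h (\<not> b) y))) \<le> real (j (position h)) + t)"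
        by (intro exI[of _ True] exI[of _ 1]) simp
    qed auto
    show "ereal m \<le> F_minus Y F f eps x ?S S2"
      using F_minus_plus_eq(1)[where eps = eps, OF F f lossless]
      by (simp add: add_increasing)
  qed
qed

text \<open>Dynamic programming by pasting: player I moves to \<open>y\<close> after winning the
  first toss, and then uses a near-optimal strategy for the position reached. The strict bounds
  \<open>a\<close> and \<open>c\<close> are there because optimal strategies need not exist.\<close>

lemma value_I_step:
  assumes F: "\<And>x. x \<in> Y \<Longrightarrow> m \<le> F x" and f: "\<And>x. x \<notin> Y \<Longrightarrow> 0 \<le> f x"
    and x: "x \<notin> Y" and y: "y \<in> ball x eps" and a: "ereal a < value_I \<S> Y F f eps y"
    and c: "\<And>z. z \<in> ball x eps \<Longrightarrow> ereal c < value_I \<S> Y F f eps z"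
  shows "ereal ((a + c) / 2 + eps\<^sup>2 * f x) \<le> value_I \<S> Y F f eps x"
proof -
  define r where "r b = (if b then a else c)" for b :: bool
  have ex: "\<exists>T\<in>\<S> eps. p \<in> ball x eps \<and> (b \<longrightarrow> p = y) \<longrightarrow> (\<forall>S2\<in>\<S> eps. ereal (r b) \<le> F_minus Y F f eps p T S2)" for b p
  proof (cases "p \<in> ball x eps \<and> (b \<longrightarrow> p = y)")
    case True
    then have "ereal (r b) < value_I \<S> Y F f eps p" using a c by (auto simp: r_def)
    then obtain T where "T \<in> \<S> eps" "ereal (r b) < (INF S2\<in>\<S> eps. F_minus Y F f eps p T S2)"
      unfolding value_I_def less_SUP_iff by auto
    then show ?thesis by (intro bexI[of _ T]) (auto intro: order_trans[OF less_imp_le INF_lower])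
  qed (use stay_mem in auto)
  define T where "T b p = (SOME T. T \<in> \<S> eps \<and>
     (p \<in> ball x eps \<and> (b \<longrightarrow> p = y) \<longrightarrow> (\<forall>S2\<in>\<S> eps. ereal (r b) \<le> F_minus Y F f eps p T S2)))" for b p
  have TT: "T b p \<in> \<S> eps \<and>
     (p \<in> ball x eps \<and> (b \<longrightarrow> p = y) \<longrightarrow> (\<forall>S2\<in>\<S> eps. ereal (r b) \<le> F_minus Y F f eps p (T b p) S2))" for b p
    using someI_ex[OF ex[of p b, unfolded Bex_def]] unfolding T_def .
  have T: "T b p \<in> \<S> eps" for b p using TT by blast
  have T_opt: "ereal (r b) \<le> F_minus Y F f eps p (T b p) S2"
    if "p \<in> ball x eps" "b \<longrightarrow> p = y" "S2 \<in> \<S> eps" for b p S2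
    using TT that by blast
  \<comment> \<open>The first turn is removed from the history before the pasted strategy is
    consulted. Histories that do not start at \<open>x\<close> only have to receive legal
    moves.\<close>
  define S1 where "S1 h = (case snd h of [] \<Rightarrow> return_pmf (if fst h = x then y else fst h)
     | e # l \<Rightarrow> T (fst e) (snd e) (snd e, l))" for h
  have "S1 h \<in> A (position h)" for h
  proof (cases "snd h")
    case Nil
    then have "position h = fst h" by (simp add: position_def positions_def)
    then show ?thesis using Nil y eps by (auto simp: S1_def intro!: ret)
  next
    case (Cons e l)
    then have "position h = position (snd e, l)" by (simp add: position_def positions_def)
    then show ?thesis using Cons T[of "fst e" "snd e"] by (auto simp: S1_def S)
  qed
  then have S1: "S1 \<in> \<S> eps" by (simp add: S)
  have "ereal ((a + c) / 2 + eps\<^sup>2 * f x) \<le> F_minus Y F f eps x S1 S2" if S2: "S2 \<in> \<S> eps" for S2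
  proof -
    define \<phi> where "\<phi> b h = (x, (b, fst h) # snd h)" for b and h :: "'a history"
    have pos_\<phi>: "positions (\<phi> b h) = x # positions h" for b h by (simp add: \<phi>_def positions_def)
    have [simp]: "position (\<phi> b h) = position h" for b h by (simp add: position_def pos_\<phi>) (simp add: positions_def)
    have payoff_\<phi>: "payoff F f eps (\<phi> b h) = payoff F f eps h + eps\<^sup>2 * f x" for b h
      by (simp add: payoff_def pos_\<phi>) (simp add: positions_def algebra_simps)
    have \<phi>_start: "\<phi> b (p, []) = extend (x, []) b p" for b p by (simp add: \<phi>_def extend_def)
    have play_\<phi>: "play Y S1 S2 (extend (x, []) b p) = map_spmf (\<phi> b) (play Y (T b p) (S2 \<circ> \<phi> b) (p, []))" for b p
    proof -
      have "play Y S1 S2 (\<phi> b (p, [])) = map_spmf (\<phi> b) (play Y (S1 \<circ> \<phi> b) (S2 \<circ> \<phi> b) (p, []))"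
        by (rule play_transport[where fl = False]) (auto simp: inj_def \<phi>_def extend_def \<open>position (\<phi> b _) = _\<close>[unfolded \<phi>_def])
      also have "play Y (S1 \<circ> \<phi> b) (S2 \<circ> \<phi> b) (p, []) = play Y (T b p) (S2 \<circ> \<phi> b) (p, [])"
        by (rule play_cong[where Inv = "\<lambda>h. fst h = p"]) (auto simp: extend_def S1_def \<phi>_def)
      finally show ?thesis by (simp only: \<phi>_start)
    qed
    have S2\<phi>: "S2 \<circ> \<phi> b \<in> \<S> eps" for b
      using S2 unfolding S by (auto simp del: split_paired_All) (metis \<open>\<And>h b. position (\<phi> b h) = position h\<close>)
    have after: "lossless_spmf (play Y S1 S2 (extend (x, []) b p))"
        "ennreal (r b - m + eps\<^sup>2 * f x) \<le> game_int Y S1 S2 (\<lambda>h. ennreal (payoff F f eps h - m)) (extend (x, []) b p)"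
      if p: "p \<in> ball x eps" "b \<longrightarrow> p = y" for b p
    proof -
      let ?Q = "play Y (T b p) (S2 \<circ> \<phi> b) (p, [])"
      have opt: "ereal (r b) \<le> F_minus Y F f eps p (T b p) (S2 \<circ> \<phi> b)" by (rule T_opt[OF p S2\<phi>])
      then have Q: "lossless_spmf ?Q" by (auto simp: F_minus_def Let_def split: if_splits)
      then show "lossless_spmf (play Y S1 S2 (extend (x, []) b p))" by (simp add: play_\<phi>)
      let ?G = "game_int Y (T b p) (S2 \<circ> \<phi> b) (\<lambda>h. ennreal (payoff F f eps h - m)) (p, [])"
      have "ereal (r b) \<le> enn2ereal ?G + ereal m"
        using opt F_minus_plus_eq(1)[where eps = eps, OF F f Q] by simp
      then have "ennreal (r b - m) \<le> ?G"
        by (cases ?G rule: ennreal_cases) (auto simp: ennreal_le_iff2 intro!: ennreal_leI)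
      then have "ennreal (r b - m) + ennreal (eps\<^sup>2 * f x) \<le> ?G + ennreal (eps\<^sup>2 * f x)" by (rule add_right_mono)
      also have "\<dots> = (\<integral>\<^sup>+ h. ennreal (payoff F f eps h - m) + ennreal (eps\<^sup>2 * f x) \<partial>measure_spmf ?Q)"
        by (simp add: nn_integral_add nn_integral_const_lossless[OF Q] game_int_def del: nn_integral_const)
      also have "\<dots> = (\<integral>\<^sup>+ h. ennreal (payoff F f eps (\<phi> b h) - m) \<partial>measure_spmf ?Q)"
      proof (rule nn_integral_cong_AE, unfold AE_measure_spmf_iff, intro ballI)
        fix h assume "h \<in> set_spmf ?Q"
        then have "0 \<le> payoff F f eps h - m" using payoff_lower[where F = F and f = f and m = m, OF F f] by simp
        moreover have "0 \<le> eps\<^sup>2 * f x" using f[OF x] by simp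
        ultimately show "ennreal (payoff F f eps h - m) + ennreal (eps\<^sup>2 * f x) = ennreal (payoff F f eps (\<phi> b h) - m)"
          unfolding payoff_\<phi> by (subst ennreal_plus[symmetric]) (auto simp: algebra_simps)
      qed
      also have "\<dots> = game_int Y S1 S2 (\<lambda>h. ennreal (payoff F f eps h - m)) (extend (x, []) b p)"
        by (simp add: game_int_def play_\<phi> measure_map_spmf nn_integral_distr comp_def)
      finally show "ennreal (r b - m + eps\<^sup>2 * f x) \<le> game_int Y S1 S2 (\<lambda>h. ennreal (payoff F f eps h - m)) (extend (x, []) b p)"
        using ennreal_plus_le[of "r b - m" "eps\<^sup>2 * f x"] by (rule order_trans[rotated])
    qed
    have x': "position (x, []) \<notin> Y" using x by simp
    have m1: "z = y" if "z \<in> set_pmf (S1 (x, []))" for z using that by (simp add: S1_def)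
    have m2: "z \<in> ball x eps" if "z \<in> set_pmf (S2 (x, []))" for z using mem_legal[OF S2, of "(x, [])"] that by auto
    have "(1 + 1) / 2 \<le> weight_spmf (play Y S1 S2 (x, []))"
      using after(1) y by (intro weight_play_step[OF x']) (auto simp: lossless_spmf_def dest!: m1 m2)
    then have lossless: "lossless_spmf (play Y S1 S2 (x, []))"
      using weight_spmf_le_1[of "play Y S1 S2 (x, [])"] by (simp add: lossless_spmf_def)
    let ?G = "game_int Y S1 S2 (\<lambda>h. ennreal (payoff F f eps h - m)) (x, [])"
    have "ennreal ((a + c) / 2 - m + eps\<^sup>2 * f x) \<le> ennreal ((max 0 (a - m + eps\<^sup>2 * f x) + max 0 (c - m + eps\<^sup>2 * f x)) / 2)"
      by (rule ennreal_leI) (simp add: max_def field_simps)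
    also have "\<dots> = (ennreal (max 0 (a - m + eps\<^sup>2 * f x)) + ennreal (max 0 (c - m + eps\<^sup>2 * f x))) / 2"
      by (rule ennreal_average[symmetric]) auto
    also have "\<dots> \<le> ?G"
      unfolding game_int_step[OF x']
      using after(2)[of _ True] after(2)[of _ False] y
      by (intro divide_right_mono_ennreal add_mono nn_integral_pmf_ge_const)
        (auto simp: r_def max_def dest!: m1 m2)
    finally have "ereal ((a + c) / 2 - m + eps\<^sup>2 * f x) \<le> enn2ereal ?G"
      by (cases ?G rule: ennreal_cases) (auto simp: ennreal_le_iff2)
    then have "ereal ((a + c) / 2 + eps\<^sup>2 * f x) \<le> enn2ereal ?G + ereal m"
      by (cases "enn2ereal ?G") auto
    then show ?thesis using F_minus_plus_eq(1)[where eps = eps, OF F f lossless] by simp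
  qed
  then show ?thesis unfolding value_I_def by (intro SUP_upper2[OF S1] INF_greatest)
qed

text \<open>Player I aims at \<open>y\<close>, and the infimum over the ball is the worst that
  player II can choose; a near-minimiser serves as \<open>z\<close>.\<close>

lemma value_I_super:
  assumes F: "\<And>x. x \<in> Y \<Longrightarrow> m \<le> F x" and f: "\<And>x. x \<notin> Y \<Longrightarrow> 0 \<le> f x"
    and u: "\<And>x. value_I \<S> Y F f eps x = ereal (u x)" and m: "\<And>x. m \<le> u x" and x: "x \<notin> Y"
  shows "super_at eps (f x) u x"
  unfolding super_at_def
proof (intro allI impI)
  fix \<eta> :: real assume \<eta>: "0 < \<eta>"
  define i where "i = (INF z\<in>ball x eps. u z)"
  have bdd: "bdd_below (u ` ball x eps)" using m by (intro bdd_belowI2)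
  have ne: "ball x eps \<noteq> {}" using eps by simp
  have i: "i \<le> u z" if "z \<in> ball x eps" for z unfolding i_def by (rule cINF_lower[OF bdd that])
  obtain z where z: "z \<in> ball x eps" "u z < i + \<eta> / 4"
    using cINF_less_iff[OF ne bdd, of "i + \<eta> / 4"] \<eta> unfolding i_def by auto
  have "u y + u z + 2 * eps\<^sup>2 * f x \<le> 2 * u x + \<eta>" if y: "y \<in> ball x eps" for y
  proof -
    have "ereal (((u y - \<eta> / 4) + (i - \<eta> / 4)) / 2 + eps\<^sup>2 * f x) \<le> value_I \<S> Y F f eps x"
    proof (rule value_I_step[where y = y])
      fix z assume "z \<in> ball x eps"
      then show "ereal (i - \<eta> / 4) < value_I \<S> Y F f eps z" using i[of z] \<eta> unfolding u by simp
    qed (use F f x y \<eta> in \<open>auto simp: u\<close>)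
    then have "((u y - \<eta> / 4) + (i - \<eta> / 4)) / 2 + eps\<^sup>2 * f x \<le> u x" unfolding u by simp
    then have "u y + i - \<eta> / 2 + 2 * eps\<^sup>2 * f x \<le> 2 * u x" by (simp add: field_simps)
    then show ?thesis using z(2) \<eta> by linarith
  qed
  then show "\<exists>z\<in>ball x eps. \<forall>y\<in>ball x eps. u y + u z + 2 * eps\<^sup>2 * f x \<le> 2 * u x + \<eta>"
    using z(1) by blast
qed

end

section \<open>Interpolation in length spaces and the number of moves to a point\<close>

definition interpolating :: "'a::metric_space itself \<Rightarrow> bool" where
  "interpolating _ \<longleftrightarrow> (\<forall>x z :: 'a. \<forall>r>0. \<forall>s>0. dist x z < r + s \<longrightarrow> (\<exists>w. dist x w < r \<and> dist w z < s))"

lemma interpolatingD: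
  fixes x z :: "'a::metric_space"
  assumes "interpolating TYPE('a)" "0 < r" "0 < s" "dist x z < r + s"
  obtains w where "dist x w < r" "dist w z < s"
  using assms unfolding interpolating_def by meson

text \<open>A curve of length \<open>k < r + s\<close> passes through a point at distance slightly
  below \<open>s\<close> from \<open>z\<close>, and what remains of the length bounds the distance
  to \<open>x\<close>. Interpolation says that open balls add up: moves of length below
  \<open>r\<close> and below \<open>s\<close> combine to any distance below
  \<open>r + s\<close>.\<close>

lemma length_space_interpolating:
  assumes "length_space TYPE('a::metric_space)"
  shows "interpolating TYPE('a)"
  unfolding interpolating_def
proof (intro allI impI)
  fix x z :: 'a and r s :: real
  assume r: "0 < r" and s: "0 < s" and d: "dist x z < r + s"
  show "\<exists>w. dist x w < r \<and> dist w z < s"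
  proof (cases "dist x z < s")
    case True
    then show ?thesis using r by (intro exI[of _ x]) simp
  next
    case False
    have "(INF g\<in>{g. path g \<and> pathstart g = x \<and> pathfinish g = z}. curve_length g) < ereal (r + s)"
      using assms d unfolding length_space_def by (metis less_ereal.simps(1))
    then obtain g where g: "path g" "g 0 = x" "g 1 = z" and l: "curve_length g < ereal (r + s)"
      unfolding INF_less_iff pathstart_def pathfinish_def by auto
    have sub: "ereal (dist x (g t) + dist (g t) z) \<le> curve_length g" if "t \<in> {0..1}" for t
    proof -
      have "(\<Sum>i<length [0, t, 1] - 1. ereal (dist (g ([0, t, 1] ! i)) (g ([0, t, 1] ! Suc i)))) \<le> curve_length g"
        unfolding curve_length_def by (rule SUP_upper) (use that in auto)
      then show ?thesis by (simp add: g numeral_2_eq_2)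
    qed
    have "ereal 0 \<le> curve_length g" using sub[of 0] by (rule order_trans[rotated]) (auto simp: g)
    then obtain k where k: "curve_length g = ereal k" using l by (cases "curve_length g") auto
    \<comment> \<open>Positive, so that the distance to \<open>z\<close> is strictly below
      \<open>s\<close>; at most \<open>s\<close>, so that the intermediate value exists; and below
      \<open>r + s - k\<close>, so that the distance to \<open>x\<close> is strictly below
      \<open>r\<close>.\<close>
    define \<mu> where "\<mu> = min s ((r + s - k) / 2)"
    have \<mu>: "0 < \<mu>" "\<mu> \<le> s" "\<mu> < r + s - k" using l s by (auto simp: \<mu>_def k min_def)
    have "continuous_on {0..1} (\<lambda>t. dist (g t) z)" using g(1) unfolding path_def by (intro continuous_intros)
    then obtain t where t: "0 \<le> t" "t \<le> 1" "dist (g t) z = s - \<mu>"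
      using IVT2'[of "\<lambda>t. dist (g t) z" 1 "s - \<mu>" 0] False \<mu> g by auto
    have "dist x (g t) + dist (g t) z \<le> k" using sub[of t] t k by simp
    then show ?thesis using t \<mu> by (intro exI[of _ "g t"]) auto
  qed
qed

text \<open>In an interpolating space this is the least number of moves of length below
  \<open>eps\<close> from \<open>x\<close> to \<open>p\<close>. Balls are open, so a distance of
  exactly \<open>n * eps\<close> takes \<open>n + 1\<close> moves; hence floor plus one and not the
  ceiling.\<close>

definition hops :: "real \<Rightarrow> 'a::metric_space \<Rightarrow> 'a \<Rightarrow> nat" where
  "hops eps p x = (if x = p then 0 else nat \<lfloor>dist x p / eps\<rfloor> + 1)"

lemma hops_self [simp]: "hops eps p p = 0"
  by (simp add: hops_def)

lemma hops_pos: "x \<noteq> p \<Longrightarrow> 1 \<le> hops eps p x"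
  by (simp add: hops_def)

lemma hops_upper: "0 < eps \<Longrightarrow> real (hops eps p x) * eps \<le> dist x p + eps"
proof (cases "x = p")
  case False
  assume e: "0 < eps"
  have "real (hops eps p x) \<le> dist x p / eps + 1" using False e by (simp add: hops_def) 
  then show ?thesis using e by (simp add: field_simps)
qed simp

lemma hops_lower: "0 < eps \<Longrightarrow> x \<noteq> p \<Longrightarrow> dist x p < real (hops eps p x) * eps"
proof -
  assume e: "0 < eps" and "x \<noteq> p"
  then have "dist x p / eps < real (hops eps p x)"
    by (simp add: hops_def) linarith
  then show ?thesis using e by (simp add: field_simps)
qed

lemma hops_lower': "0 < eps \<Longrightarrow> dist x p \<le> real (hops eps p x) * eps"
  using hops_lower[of eps x p] by (cases "x = p") auto

lemma hops_le: "0 < eps \<Longrightarrow> dist x p < real n * eps \<Longrightarrow> hops eps p x \<le> n" for n :: nat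
proof (cases "x = p")
  case False
  assume e: "0 < eps" and "dist x p < real n * eps"
  then have "dist x p / eps < n" by (simp add: field_simps)
  then have "\<lfloor>dist x p / eps\<rfloor> < int n" by (simp add: floor_less_iff)
  then show ?thesis using False e by (simp add: hops_def nat_less_iff Suc_le_eq)
qed simp

lemma hops_step: "0 < eps \<Longrightarrow> y \<in> ball x eps \<Longrightarrow> hops eps p y \<le> Suc (hops eps p x)"
  using hops_lower'[of eps x p] dist_triangle[of y p x]
  by (intro hops_le) (auto simp: dist_commute algebra_simps)

lemma hops_down:
  fixes x p :: "'a::metric_space"
  assumes "interpolating TYPE('a)" "0 < eps" "x \<noteq> p"
  obtains z where "z \<in> ball x eps" "Suc (hops eps p z) \<le> hops eps p x"
proof (cases "hops eps p x = 1")
  case True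
  then have "dist x p < eps" using hops_lower[OF assms(2,3)] by simp
  then show ?thesis using True by (intro that[of p]) auto
next
  case False
  define n where "n = hops eps p x - 1"
  have n: "hops eps p x = Suc n" "0 < n" using False hops_pos[OF assms(3), of eps] by (auto simp: n_def)
  have "dist x p < eps + real n * eps" using hops_lower[OF assms(2,3)] n by (simp add: algebra_simps)
  then obtain w where w: "dist x w < eps" "dist w p < real n * eps"
    using interpolatingD[OF assms(1,2), of "n * eps"] assms(2) n(2) by auto
  then show ?thesis using hops_le[OF assms(2) w(2)] n(1) by (intro that[of w]) auto
qed

section \<open>A supersolution with a definite drop\<close>

text \<open>Where no neighbour is lower by more than \<open>\<delta>\<close> the function is replaced by the value at the
  first other point of a chain, plus \<open>\<delta>\<close> times the length of the chain. This plays the role of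
  backtracking strategies.\<close>

inductive patch :: "'a::metric_space set \<Rightarrow> real \<Rightarrow> ('a \<Rightarrow> real) \<Rightarrow> real \<Rightarrow> 'a \<Rightarrow> real \<Rightarrow> bool"
  for Y eps v \<delta> where
  fast: "x \<in> Y \<or> (\<exists>z\<in>ball x eps. v z < v x - \<delta>) \<Longrightarrow> patch Y eps v \<delta> x (v x)"
| slow: "x \<notin> Y \<Longrightarrow> \<forall>z\<in>ball x eps. v x - \<delta> \<le> v z \<Longrightarrow> z \<in> ball x eps \<Longrightarrow> patch Y eps v \<delta> z c \<Longrightarrow> patch Y eps v \<delta> x (c + \<delta>)"

lemma patch_ge: "patch Y eps v \<delta> x c \<Longrightarrow> v x \<le> c"
  by (induction rule: patch.induct) force+

lemma patch_exists:
  fixes v :: "'a::metric_space \<Rightarrow> real"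
  assumes ip: "interpolating TYPE('a)" and "0 < eps" and "p \<in> Y"
  shows "\<exists>c. patch Y eps v \<delta> x c"
proof (induction "hops eps p x" arbitrary: x rule: less_induct)
  case less
  show ?case
  proof (cases "x \<in> Y \<or> (\<exists>z\<in>ball x eps. v z < v x - \<delta>)")
    case True
    then show ?thesis using patch.fast by blast
  next
    case False
    then have "x \<noteq> p" using assms(3) by auto
    then obtain z where z: "z \<in> ball x eps" "Suc (hops eps p z) \<le> hops eps p x" by (rule hops_down[OF ip assms(2)])
    then obtain c where c: "patch Y eps v \<delta> z c" using less[of z] by auto
    have "patch Y eps v \<delta> x (c + \<delta>)" using False by (intro patch.slow[OF _ _ z(1) c]) force+
    then show ?thesis by blast
  qed
qed

text \<open>Outside \<open>Y\<close>, either \<open>x\<close> has a strictly lower neighbour and is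
  fast for small \<open>\<delta>\<close>, or \<open>v\<close> is constant on the ball and one may go
  one hop towards \<open>p\<close> at cost \<open>\<delta>\<close>. The threshold depends on
  \<open>x\<close>, as do the drop and the length of the chain.\<close>

lemma patch_close:
  fixes v :: "'a::metric_space \<Rightarrow> real"
  assumes ip: "interpolating TYPE('a)" and eps: "0 < eps" and p: "p \<in> Y"
    and super: "\<And>x. x \<notin> Y \<Longrightarrow> super_at eps 0 v x" and "0 < \<eta>"
  shows "\<exists>\<delta>0>0. \<forall>\<delta>. 0 < \<delta> \<longrightarrow> \<delta> < \<delta>0 \<longrightarrow> (\<exists>c. patch Y eps v \<delta> x c \<and> c \<le> v x + \<eta>)"
  using \<open>0 < \<eta>\<close>
proof (induction "hops eps p x" arbitrary: x \<eta> rule: less_induct)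
  case less
  consider "x \<in> Y" | z where "z \<in> ball x eps" "v z < v x" | "x \<notin> Y" "\<forall>z\<in>ball x eps. v x \<le> v z"
    by force
  then show ?case
  proof cases
    case 1
    then show ?thesis using less(2) by (intro exI[of _ 1]) (auto intro!: exI[of _ "v x"] patch.fast)
  next
    case 2
    have "patch Y eps v \<delta> x (v x)" if "\<delta> < v x - v z" for \<delta>
      using 2 that by (intro patch.fast disjI2 bexI[of _ z]) auto
    then show ?thesis using 2 less(2) by (intro exI[of _ "v x - v z"]) (auto intro!: exI[of _ "v x"])
  next
    case 3
    \<comment> \<open>A supersolution with a local minimum outside \<open>Y\<close> is constant on
      the ball: \<open>v z\<close> is at least \<open>v x\<close>, which leaves
      \<open>v y \<le> v x\<close>.\<close>
    have const: "v y = v x" if y: "y \<in> ball x eps" for y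
    proof (rule antisym)
      show "v y \<le> v x"
      proof (rule field_le_epsilon[of "v y" "v x"])
        fix e :: real assume "0 < e"
        then obtain z where "z \<in> ball x eps" "v y + v z + 2 * eps\<^sup>2 * 0 \<le> 2 * v x + e"
          using super[OF 3(1)] y unfolding super_at_def by blast
        then show "v y \<le> v x + e" using 3(2) by force
      qed
    qed (use 3(2) y in blast)
    have "x \<noteq> p" using 3 p by auto
    then obtain z where z: "z \<in> ball x eps" "Suc (hops eps p z) \<le> hops eps p x" by (rule hops_down[OF ip eps])
    obtain \<delta>0 where \<delta>0: "0 < \<delta>0" "\<And>\<delta>. 0 < \<delta> \<Longrightarrow> \<delta> < \<delta>0 \<Longrightarrow> \<exists>c. patch Y eps v \<delta> z c \<and> c \<le> v z + \<eta> / 2"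
      using less(1)[of z "\<eta> / 2"] z(2) less(2) by auto
    show ?thesis
    proof (rule exI[of _ "min \<delta>0 (\<eta> / 2)"], intro conjI allI impI)
      fix \<delta> assume d: "0 < \<delta>" "\<delta> < min \<delta>0 (\<eta> / 2)"
      then obtain c where c: "patch Y eps v \<delta> z c" "c \<le> v z + \<eta> / 2" using \<delta>0(2)[of \<delta>] by auto
      have "patch Y eps v \<delta> x (c + \<delta>)" using 3 d by (intro patch.slow[OF _ _ z(1) c(1)]) force+
      then show "\<exists>c. patch Y eps v \<delta> x c \<and> c \<le> v x + \<eta>"
        using c(2) const[OF z(1)] d by (intro exI[of _ "c + \<delta>"]) auto
    qed (use \<delta>0(1) less(2) in auto)
  qed
qed

text \<open>At fast points \<open>v\<close> itself drops by more than \<open>\<delta>\<close>, and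
  at slow points the next point of the chain is lower by \<open>\<delta>\<close>. The supersolution
  inequality survives because a slow neighbour can join a chain at the additional cost
  \<open>\<delta>\<close>.\<close>

lemma patch_super:
  fixes v :: "'a::metric_space \<Rightarrow> real"
  assumes ip: "interpolating TYPE('a)" and eps: "0 < eps" and p: "p \<in> Y" and m: "\<And>x. m \<le> v x"
    and super: "\<And>x. x \<notin> Y \<Longrightarrow> super_at eps 0 v x" and "0 < \<eta>"
  shows "\<exists>\<delta> P. 0 < \<delta> \<and> (\<forall>x. v x \<le> P x) \<and> P x0 \<le> v x0 + \<eta> \<and>
    (\<forall>x \<theta>. x \<notin> Y \<longrightarrow> 0 < \<theta> \<longrightarrow>
      (\<exists>z\<in>ball x eps. P z \<le> P x - \<delta> + \<theta> \<and> (\<forall>y\<in>ball x eps. P y + P z \<le> 2 * P x + \<theta>)))"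
proof -
  obtain \<delta>0 where \<delta>0: "0 < \<delta>0" "\<And>\<delta>. 0 < \<delta> \<Longrightarrow> \<delta> < \<delta>0 \<Longrightarrow> \<exists>c. patch Y eps v \<delta> x0 c \<and> c \<le> v x0 + \<eta>"
    using patch_close[OF ip eps p super \<open>0 < \<eta>\<close>] by blast
  define \<delta> where "\<delta> = \<delta>0 / 2"
  have \<delta>: "0 < \<delta>" "\<delta> < \<delta>0" using \<delta>0(1) by (auto simp: \<delta>_def)
  define P where "P x = Inf {c. patch Y eps v \<delta> x c}" for x
  have ne: "{c. patch Y eps v \<delta> x c} \<noteq> {}" for x using patch_exists[OF ip eps p] by auto
  have bdd: "bdd_below {c. patch Y eps v \<delta> x c}" for x by (rule bdd_belowI[of _ "v x"]) (auto dest: patch_ge)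
  have P_le: "P x \<le> c" if "patch Y eps v \<delta> x c" for x c
    unfolding P_def using that by (intro cInf_lower bdd) auto
  have P_ge: "v x \<le> P x" for x unfolding P_def by (intro cInf_greatest ne) (auto dest: patch_ge)
  have P_fast: "P x = v x" if "x \<in> Y \<or> (\<exists>z\<in>ball x eps. v z < v x - \<delta>)" for x
    using P_le[OF patch.fast[OF that]] P_ge[of x] by (rule antisym)
  have P_slow: "\<exists>c z. z \<in> ball x eps \<and> patch Y eps v \<delta> z c \<and> c + \<delta> \<le> P x + \<theta>"
    if x: "x \<notin> Y" "\<not> (\<exists>z\<in>ball x eps. v z < v x - \<delta>)" and \<theta>: "0 < \<theta>" for x and \<theta> :: real
  proof -
    obtain c where c: "patch Y eps v \<delta> x c" "c < P x + \<theta>"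
      using cInf_less_iff[OF ne[of x] bdd[of x], of "P x + \<theta>"] \<theta> unfolding P_def by auto
    from c(1) show ?thesis using x c(2) by cases force+
  qed
  show ?thesis
  proof (intro exI[of _ \<delta>] exI[of _ P] conjI allI impI)
    show "0 < \<delta>" by fact
    show "v x \<le> P x" for x by (rule P_ge)
    show "P x0 \<le> v x0 + \<eta>" using \<delta>0(2)[OF \<delta>] P_le order_trans by blast
    fix x and \<theta> :: real assume x: "x \<notin> Y" and \<theta>: "0 < \<theta>"
    show "\<exists>z\<in>ball x eps. P z \<le> P x - \<delta> + \<theta> \<and> (\<forall>y\<in>ball x eps. P y + P z \<le> 2 * P x + \<theta>)"
    proof (cases "\<exists>z\<in>ball x eps. v z < v x - \<delta>")
      case True
      then obtain z1 where z1: "z1 \<in> ball x eps" "v z1 < v x - \<delta>" by blast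
      obtain z2 where z2: "z2 \<in> ball x eps" "\<forall>y\<in>ball x eps. v y + v z2 + 2 * eps\<^sup>2 * 0 \<le> 2 * v x + \<theta>"
        using super[OF x] \<theta> unfolding super_at_def by blast
      define z where "z = (if v z1 \<le> v z2 then z1 else z2)"
      have z: "z \<in> ball x eps" "v z < v x - \<delta>" "\<And>y. y \<in> ball x eps \<Longrightarrow> v y + v z \<le> 2 * v x + \<theta>"
        using z1 z2 by (force simp: z_def)+
      \<comment> \<open>\<open>x\<close> is a neighbour of \<open>z\<close> that is higher by more
        than \<open>\<delta>\<close>, so the inequality at \<open>z\<close> supplies one that is
        lower by more than \<open>\<delta>\<close>: \<open>z\<close> is fast and keeps its
        value.\<close>
      have "z \<in> Y \<or> (\<exists>w\<in>ball z eps. v w < v z - \<delta>)"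
      proof (cases "z \<in> Y")
        case False
        define \<eta> where "\<eta> = v x - \<delta> - v z"
        have "0 < \<eta> / 2" using z(2) by (simp add: \<eta>_def)
        moreover have "x \<in> ball z eps" using z(1) by (simp add: dist_commute)
        ultimately obtain w where w: "w \<in> ball z eps" "v x + v w + 2 * eps\<^sup>2 * 0 \<le> 2 * v z + \<eta> / 2"
          using super[OF False] unfolding super_at_def by blast
        moreover have "v x = v z + \<delta> + \<eta>" by (simp add: \<eta>_def)
        then have "v w < v z - \<delta>" using w(2) \<open>0 < \<eta> / 2\<close> by simp
        ultimately show ?thesis by blast
      qed simp
      then have Pz: "P z = v z" by (rule P_fast)
      note True' = True
      have Px: "P x = v x" using True by (intro P_fast) simp
      have "P y + P z \<le> 2 * P x + \<theta>" if y: "y \<in> ball x eps" for y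
      proof (cases "y \<in> Y \<or> (\<exists>w\<in>ball y eps. v w < v y - \<delta>)")
        case True
        then show ?thesis using z(3)[OF y] by (simp add: P_fast Pz Px)
      next
        case False
        have "x \<in> ball y eps" using y by (simp add: dist_commute)
        \<comment> \<open>\<open>y\<close> is slow but its neighbour \<open>x\<close> is fast, so a
          chain of one link suffices; the drop from \<open>x\<close> to \<open>z\<close> compensates
          the added \<open>\<delta>\<close>.\<close>
        then have "patch Y eps v \<delta> y (v x + \<delta>)"
          using False by (intro patch.slow[OF _ _ _ patch.fast[OF disjI2[OF True']]]) force+
        then show ?thesis using P_le z(2) \<theta> unfolding Pz Px by fastforce
      qed
      then show ?thesis using z \<theta> by (intro bexI[of _ z]) (auto simp: Pz Px)
    next
      case False
      then obtain c z where z: "z \<in> ball x eps" "patch Y eps v \<delta> z c" "c + \<delta> \<le> P x + \<theta> / 2"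
        using P_slow[OF x False, of "\<theta> / 2"] \<theta> by auto
      have pc: "patch Y eps v \<delta> x (c + \<delta>)" using False x by (intro patch.slow[OF _ _ z(1,2)]) force+
      have "P y + P z \<le> 2 * P x + \<theta>" if y: "y \<in> ball x eps" for y
      proof -
        \<comment> \<open>\<open>c\<close> belongs to the next chain point \<open>z\<close> and
          \<open>c + \<delta>\<close> to \<open>x\<close>; one more link reaches \<open>y\<close>.
          Together with \<open>P z \<le> c\<close> the sum is twice
          \<open>c + \<delta>\<close>.\<close>
        have "P y \<le> c + 2 * \<delta>"
        proof (cases "y \<in> Y \<or> (\<exists>w\<in>ball y eps. v w < v y - \<delta>)")
          case True
          have "v y \<le> v x + \<delta>"
          proof (rule field_le_epsilon)
            fix e :: real assume "0 < e"
            then obtain w where "w \<in> ball x eps" "v y + v w + 2 * eps\<^sup>2 * 0 \<le> 2 * v x + e"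
              using super[OF x] y unfolding super_at_def by blast
            then show "v y \<le> v x + \<delta> + e" using False by force
          qed
          then show ?thesis using patch_ge[OF pc] P_fast[OF True] by simp
        next
          case slow: False
          have "x \<in> ball y eps" using y by (simp add: dist_commute)
          then have "patch Y eps v \<delta> y (c + \<delta> + \<delta>)"
            using slow by (intro patch.slow[OF _ _ _ pc]) force+
          then show ?thesis using P_le by fastforce
        qed
        then show ?thesis using P_le[OF z(2)] z(3) by linarith
      qed
      then show ?thesis using z P_le[OF z(2)] \<theta> by (intro bexI[of _ z]) auto
    qed
  qed
qed

section \<open>Least supersolutions\<close>

definition supersol :: "'a::metric_space set \<Rightarrow> ('a \<Rightarrow> real) \<Rightarrow> ('a \<Rightarrow> real) \<Rightarrow> real \<Rightarrow> real \<Rightarrow> ('a \<Rightarrow> real) \<Rightarrow> bool" where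
  "supersol Y F f m eps v \<longleftrightarrow> (\<forall>x\<in>Y. F x \<le> v x) \<and> (\<forall>x. m \<le> v x) \<and> (\<forall>x. x \<notin> Y \<longrightarrow> super_at eps (f x) v x)"

definition least_super :: "'a::metric_space set \<Rightarrow> ('a \<Rightarrow> real) \<Rightarrow> ('a \<Rightarrow> real) \<Rightarrow> real \<Rightarrow> real \<Rightarrow> 'a \<Rightarrow> real" where
  "least_super Y F f m eps x = (INF v\<in>Collect (supersol Y F f m eps). v x)"

lemma least_super_le: "supersol Y F f m eps v \<Longrightarrow> least_super Y F f m eps x \<le> v x"
  unfolding least_super_def
  by (rule cINF_lower) (auto simp: supersol_def intro!: bdd_belowI2[where m = m])

text \<open>A supersolution that is nearly minimal at \<open>x\<close> supplies the inequality
  there, since passing to the infimum only lowers the values at the other points.\<close>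

lemma supersol_least_super:
  assumes ex: "\<exists>v. supersol Y F f m eps v"
  shows "supersol Y F f m eps (least_super Y F f m eps)"
proof -
  let ?U = "least_super Y F f m eps"
  have ge: "c \<le> ?U x" if "\<And>v. supersol Y F f m eps v \<Longrightarrow> c \<le> v x" for c x
    unfolding least_super_def by (rule cINF_greatest) (use ex that in auto)
  have "super_at eps (f x) ?U x" if x: "x \<notin> Y" for x
    unfolding super_at_def
  proof (intro allI impI)
    fix \<eta> :: real assume \<eta>: "0 < \<eta>"
    have "\<exists>v. supersol Y F f m eps v \<and> v x < ?U x + \<eta> / 4"
    proof (rule ccontr)
      assume "\<nexists>v. supersol Y F f m eps v \<and> v x < ?U x + \<eta> / 4"
      then have "?U x + \<eta> / 4 \<le> ?U x" by (intro ge) (auto simp: not_less)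
      then show False using \<eta> by simp
    qed
    then obtain v where v: "supersol Y F f m eps v" "v x < ?U x + \<eta> / 4" by blast
    have "0 < \<eta> / 2" using \<eta> by simp
    then obtain z where z: "z \<in> ball x eps" "\<forall>y\<in>ball x eps. v y + v z + 2 * eps\<^sup>2 * f x \<le> 2 * v x + \<eta> / 2"
      using v(1) x unfolding supersol_def super_at_def by blast
    have "?U y + ?U z + 2 * eps\<^sup>2 * f x \<le> 2 * ?U x + \<eta>" if "y \<in> ball x eps" for y
    proof -
      have "v y + v z + 2 * eps\<^sup>2 * f x \<le> 2 * v x + \<eta> / 2" using z(2) that by blast
      then show ?thesis using v(2) least_super_le[OF v(1), of y] least_super_le[OF v(1), of z] by linarith
    qed
    then show "\<exists>z\<in>ball x eps. \<forall>y\<in>ball x eps. ?U y + ?U z + 2 * eps\<^sup>2 * f x \<le> 2 * ?U x + \<eta>" using z(1) by blast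
  qed
  then show ?thesis unfolding supersol_def by (auto intro!: ge simp: supersol_def)
qed

lemma super_at_antimono:
  assumes "super_at eps c v x" and "w x = v x" and "\<And>y. w y \<le> v y"
  shows "super_at eps c w x"
  unfolding super_at_def
proof (intro allI impI)
  fix \<eta> :: real assume "0 < \<eta>"
  then obtain z where z: "z \<in> ball x eps" "\<forall>y\<in>ball x eps. v y + v z + 2 * eps\<^sup>2 * c \<le> 2 * v x + \<eta>"
    using assms(1) unfolding super_at_def by blast
  have "w y + w z + 2 * eps\<^sup>2 * c \<le> 2 * w x + \<eta>" if "y \<in> ball x eps" for y
    using bspec[OF z(2) that] assms(2) assms(3)[of y] assms(3)[of z] by linarith
  then show "\<exists>z\<in>ball x eps. \<forall>y\<in>ball x eps. w y + w z + 2 * eps\<^sup>2 * c \<le> 2 * w x + \<eta>" using z(1) by blast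
qed

text \<open>Lowering the value at a single point of \<open>Y\<close> to \<open>F x\<close> does not
  spoil the inequalities outside \<open>Y\<close>, so minimality forces equality.\<close>

lemma least_super_boundary:
  assumes ex: "\<exists>v. supersol Y F f m eps v" and m: "\<And>x. x \<in> Y \<Longrightarrow> m \<le> F x" and x: "x \<in> Y"
  shows "least_super Y F f m eps x = F x"
proof (rule antisym)
  let ?U = "least_super Y F f m eps"
  have U: "supersol Y F f m eps ?U" by (rule supersol_least_super[OF ex])
  then show "F x \<le> ?U x" using x by (simp add: supersol_def)
  have "supersol Y F f m eps (?U(x := F x))"
    unfolding supersol_def
  proof (intro conjI ballI allI impI)
    fix y assume "y \<notin> Y"
    then show "super_at eps (f y) (?U(x := F x)) y"
      using U x by (auto simp: supersol_def intro: super_at_antimono[of eps "f y" ?U])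
  qed (use U x m in \<open>auto simp: supersol_def\<close>)
  from least_super_le[OF this, of x] show "?U x \<le> F x" by simp
qed

context moves
begin

theorem value_eq_least_super:
  assumes ip: "interpolating TYPE('a)" and p: "p \<in> Y"
    and F: "\<And>x. x \<in> Y \<Longrightarrow> m \<le> F x" and f: "\<And>x. x \<notin> Y \<Longrightarrow> 0 \<le> f x"
    and f': "(\<forall>x. x \<notin> Y \<longrightarrow> f x = 0) \<or> (\<exists>c>0. \<forall>x. x \<notin> Y \<longrightarrow> c \<le> f x)"
    and ex: "\<exists>v. supersol Y F f m eps v"
  shows "value_I \<S> Y F f eps x = ereal (least_super Y F f m eps x)"
    and "value_II \<S> Y F f eps x = ereal (least_super Y F f m eps x)"
proof -
  let ?U = "least_super Y F f m eps"
  have U: "supersol Y F f m eps ?U" by (rule supersol_least_super[OF ex])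
  have upper: "value_II \<S> Y F f eps x \<le> ereal (?U x)" for x
  proof (rule ereal_le_epsilon2)
    fix e :: real assume e: "0 < e"
    obtain \<delta> P where \<delta>: "0 < \<delta>" and P: "\<And>x. ?U x \<le> P x" "P x \<le> ?U x + e / 2"
      and PP: "\<And>x \<theta>. x \<notin> Y \<Longrightarrow> 0 < \<theta> \<Longrightarrow> \<exists>z\<in>ball x eps. P z \<le> P x - \<delta> + \<theta>
        \<and> (\<forall>y\<in>ball x eps. P y + P z + 2 * eps\<^sup>2 * f x \<le> 2 * P x + \<theta>)"
      using f'
    proof
      assume f0: "\<forall>x. x \<notin> Y \<longrightarrow> f x = 0"
      have sup: "super_at eps 0 ?U x" if "x \<notin> Y" for x using U f0 that by (auto simp: supersol_def)
      have mU: "m \<le> ?U x" for x using U by (simp add: supersol_def)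
      have "0 < e / 2" using e by simp
      obtain \<delta> P where P: "0 < \<delta>" "\<forall>x. ?U x \<le> P x" "P x \<le> ?U x + e / 2"
        "\<forall>x \<theta>. x \<notin> Y \<longrightarrow> 0 < \<theta> \<longrightarrow>
          (\<exists>z\<in>ball x eps. P z \<le> P x - \<delta> + \<theta> \<and> (\<forall>y\<in>ball x eps. P y + P z \<le> 2 * P x + \<theta>))"
        using patch_super[OF ip eps p mU sup \<open>0 < e / 2\<close>, where ?x0.0 = x] by blast
      show thesis
      proof (rule that[of \<delta> P])
        show "0 < \<delta>" by (rule P)
        show "?U x \<le> P x" for x using P(2) by blast
        show "P x \<le> ?U x + e / 2" by (rule P)
        fix x and \<theta> :: real assume "x \<notin> Y" "0 < \<theta>"
        then have "\<exists>z\<in>ball x eps. P z \<le> P x - \<delta> + \<theta> \<and> (\<forall>y\<in>ball x eps. P y + P z \<le> 2 * P x + \<theta>)" "f x = 0"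
          using P(4) f0 by blast+
        then show "\<exists>z\<in>ball x eps. P z \<le> P x - \<delta> + \<theta>
            \<and> (\<forall>y\<in>ball x eps. P y + P z + 2 * eps\<^sup>2 * f x \<le> 2 * P x + \<theta>)" by simp
      qed
    next
      assume "\<exists>c>0. \<forall>x. x \<notin> Y \<longrightarrow> c \<le> f x"
      then obtain c where c: "0 < c" "\<And>x. x \<notin> Y \<Longrightarrow> c \<le> f x" by auto
      show thesis
      \<comment> \<open>A positive running payoff supplies the drop by itself: put
        \<open>y = x\<close> in the supersolution inequality.\<close>
      proof (rule that[of "2 * eps\<^sup>2 * c" ?U])
        show "0 < 2 * eps\<^sup>2 * c" using eps c by simp
        fix x and \<theta> :: real assume x: "x \<notin> Y" and "0 < \<theta>"
        then obtain z where z: "z \<in> ball x eps" "\<forall>y\<in>ball x eps. ?U y + ?U z + 2 * eps\<^sup>2 * f x \<le> 2 * ?U x + \<theta>"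
          using U unfolding supersol_def super_at_def by blast
        have "2 * eps\<^sup>2 * c \<le> 2 * eps\<^sup>2 * f x" using c(2)[OF x] by (intro mult_left_mono) auto
        moreover have "?U x + ?U z + 2 * eps\<^sup>2 * f x \<le> 2 * ?U x + \<theta>" using z(2) eps by auto
        ultimately have "?U z \<le> ?U x - 2 * eps\<^sup>2 * c + \<theta>" by linarith
        then show "\<exists>z\<in>ball x eps. ?U z \<le> ?U x - 2 * eps\<^sup>2 * c + \<theta> \<and>
            (\<forall>y\<in>ball x eps. ?U y + ?U z + 2 * eps\<^sup>2 * f x \<le> 2 * ?U x + \<theta>)" using z by blast
      qed (use e in auto)
    qed
    have mP: "m \<le> P x" for x using order_trans[OF _ P(1)[of x]] U by (simp add: supersol_def)
    have FP: "F x \<le> P x" if "x \<in> Y" for x using order_trans[OF _ P(1)[of x]] U that by (simp add: supersol_def)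
    have "0 < e / 2" using e by simp
    have "\<exists>\<sigma>. (\<forall>h. \<sigma> h \<in> ball (position h) eps) \<and> (\<forall>S1. (\<forall>h. set_pmf (S1 h) \<subseteq> ball (position h) eps) \<longrightarrow>
           F_plus Y F f eps x S1 (\<lambda>h. return_pmf (\<sigma> h)) \<le> ereal (P x + e / 2))"
      by (rule F_plus_le_super[where m = m and \<delta> = \<delta>])
        (fact eps mP FP F f \<open>0 < e / 2\<close> \<delta> PP)+
    then obtain \<sigma> where \<sigma>: "\<forall>h. \<sigma> h \<in> ball (position h) eps" "\<forall>S1. (\<forall>h. set_pmf (S1 h) \<subseteq> ball (position h) eps) \<longrightarrow>
           F_plus Y F f eps x S1 (\<lambda>h. return_pmf (\<sigma> h)) \<le> ereal (P x + e / 2)"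
      by (elim exE conjE)
    have "value_II \<S> Y F f eps x \<le> ereal (P x + e / 2)"
    proof (rule value_II_le)
      show "\<sigma> h \<in> ball (position h) eps" for h using \<sigma>(1) by blast
    qed (use \<sigma>(2) in blast)
    also have "\<dots> \<le> ereal (?U x) + ereal e" using P(2) by simp
    finally show "value_II \<S> Y F f eps x \<le> ereal (?U x) + ereal e" .
  qed
  have lower: "ereal m \<le> value_I \<S> Y F f eps x" for x
  proof (rule value_I_ge[where j = "hops eps p"])
    show "m \<le> F x" if "x \<in> Y" for x using that by (rule F)
    show "0 \<le> f x" if "x \<notin> Y" for x using that by (rule f)
    fix x assume "x \<notin> Y"
    then have "x \<noteq> p" using p by auto
    then obtain z where "z \<in> ball x eps" "Suc (hops eps p z) \<le> hops eps p x"
      by (rule hops_down[OF ip eps])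
    then show "\<exists>z\<in>ball x eps. Suc (hops eps p z) \<le> hops eps p x" by blast
  qed (use hops_step eps in auto)
  define u where "u x = real_of_ereal (value_I \<S> Y F f eps x)" for x
  have between: "value_I \<S> Y F f eps x \<le> ereal (?U x)" for x
    by (rule order_trans[OF value_I_le_value_II upper])
  have u: "value_I \<S> Y F f eps x = ereal (u x)" for x
    using lower[of x] between[of x] unfolding u_def by (cases "value_I \<S> Y F f eps x") auto
  have mu: "m \<le> u x" for x using lower[of x] u[of x] by simp
  have "supersol Y F f m eps u"
    unfolding supersol_def
  proof (intro conjI ballI allI impI)
    show "F x \<le> u x" if "x \<in> Y" for x using value_I_stop[OF that] u[of x] by simp
    show "super_at eps (f x) u x" if "x \<notin> Y" for x 
      by (rule value_I_super[where F = F and f = f and Y = Y and m = m and u = u]) (fact F f u mu that)+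
  qed (rule mu)
  then have "?U x \<le> u x" for x by (rule least_super_le)
  then have *: "ereal (?U x) \<le> value_I \<S> Y F f eps x" for x by (simp add: u)
  show "value_I \<S> Y F f eps x = ereal (?U x)" using * between by (rule antisym[rotated])
  show "value_II \<S> Y F f eps x = ereal (?U x)"
    using upper[of x] order_trans[OF * value_I_le_value_II] by (rule antisym)
qed

end

section \<open>Infima over balls\<close>

text \<open>The open ball of radius 0 is empty, so the value at the centre takes its place.\<close>

definition ball_inf :: "('a::metric_space \<Rightarrow> real) \<Rightarrow> real \<Rightarrow> 'a \<Rightarrow> nat \<Rightarrow> real" where
  "ball_inf v eps p j = (if j = 0 then v p else INF z\<in>ball p (real j * eps). v z)"

lemma ball_inf_0 [simp]: "ball_inf v eps p 0 = v p"
  by (simp add: ball_inf_def)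

context
  fixes v :: "'a::metric_space \<Rightarrow> real" and m eps :: real
  assumes m: "\<And>x. m \<le> v x" and eps: "0 < eps"
begin

lemma bdd_below_image: "bdd_below (v ` A)"
  using m by (rule bdd_belowI2)

lemma ball_inf_le: "dist p z < real j * eps \<Longrightarrow> ball_inf v eps p j \<le> v z"
  by (cases "j = 0") (auto simp: ball_inf_def intro!: cINF_lower bdd_below_image)

lemma ball_inf_ge: "m \<le> ball_inf v eps p j"
proof (cases "j = 0")
  case False
  then have "0 < real j * eps" using eps by simp
  then show ?thesis using m False by (auto simp: ball_inf_def simp del: of_nat_0_less_iff zero_less_mult_iff intro!: cINF_greatest)
qed (simp add: m)

lemma ball_inf_approx:
  assumes "0 < j" "0 < \<theta>"
  obtains z where "dist p z < real j * eps" "v z < ball_inf v eps p j + \<theta>"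
proof -
  have "0 < real j * eps" using assms eps by simp
  then have "ball p (real j * eps) \<noteq> {}" by (simp only: ball_eq_empty not_le)
  then show ?thesis
    using cINF_less_iff[OF _ bdd_below_image, of "ball p (real j * eps)" "ball_inf v eps p j + \<theta>"] assms that
    by (auto simp: ball_inf_def)
qed

text \<open>A low neighbour of \<open>w\<close> lies in the ball one step larger, and going from
  \<open>w\<close> towards \<open>p\<close> gives a neighbour in the ball one step smaller. For
  near-minimisers \<open>w\<close> this becomes concavity in the radius.\<close>

lemma ball_inf_super:
  assumes ip: "interpolating TYPE('a)" and w: "dist p w < real (Suc i) * eps" and sup: "super_at eps c v w"
  shows "ball_inf v eps p (Suc (Suc i)) + ball_inf v eps p i + 2 * eps\<^sup>2 * c \<le> 2 * v w"
proof (rule field_le_epsilon)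
  fix \<eta> :: real assume "0 < \<eta>"
  then obtain z where z: "dist w z < eps" "\<And>y. dist w y < eps \<Longrightarrow> v y + v z + 2 * eps\<^sup>2 * c \<le> 2 * v w + \<eta>"
    using sup unfolding super_at_def by auto
  have "dist p z < real (Suc (Suc i)) * eps"
    using w z(1) dist_triangle[of p z w] by (simp add: algebra_simps)
  then have 1: "ball_inf v eps p (Suc (Suc i)) \<le> v z" by (rule ball_inf_le)
  have "\<exists>y. dist w y < eps \<and> ball_inf v eps p i \<le> v y"
  proof (cases "i = 0")
    case True
    then show ?thesis using w by (intro exI[of _ p]) (simp add: dist_commute)
  next
    case False
    have "dist w p < eps + real i * eps" using w by (simp add: algebra_simps dist_commute)
    then obtain y where "dist w y < eps" "dist y p < real i * eps"
      using interpolatingD[OF ip eps, of "real i * eps" w p] False eps by auto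
    then show ?thesis by (intro exI[of _ y]) (auto intro!: ball_inf_le simp: dist_commute)
  qed
  then obtain y where "dist w y < eps" "ball_inf v eps p i \<le> v y" by blast
  then show "ball_inf v eps p (Suc (Suc i)) + ball_inf v eps p i + 2 * eps\<^sup>2 * c \<le> 2 * v w + \<eta>"
    using z(2)[of y] 1 by linarith
qed

text \<open>Below the cone the infima over balls are concave in the radius, so once below the cone they
  would decrease linearly for ever.\<close>

lemma cone_lower:
  assumes ip: "interpolating TYPE('a)" and sup: "\<And>x. x \<notin> Y \<Longrightarrow> super_at eps 0 v x"
    and bd: "\<And>z. z \<in> Y \<Longrightarrow> c - a * dist z p \<le> v z" and c: "c \<le> v p" and a: "0 \<le> a"
  shows "c - a * (dist x p + eps) \<le> v x"
proof -
  define e where "e j = ball_inf v eps p j - (c - a * (real j * eps))" for j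
  have concave: "e (Suc (Suc i)) - e (Suc i) \<le> e (Suc i) - e i" if neg: "e (Suc i) < 0" for i
  proof -
    have "ball_inf v eps p (Suc (Suc i)) + ball_inf v eps p i \<le> 2 * ball_inf v eps p (Suc i)"
    proof (rule field_le_epsilon)
      fix \<eta> :: real assume "0 < \<eta>"
      \<comment> \<open>The tolerance \<open>- e (Suc i)\<close> keeps \<open>w\<close> strictly
        below the cone, whereas points of \<open>Y\<close> lie on or above it.\<close>
      then obtain w where w: "dist p w < real (Suc i) * eps" "v w < ball_inf v eps p (Suc i) + min (\<eta> / 2) (- e (Suc i))"
        using ball_inf_approx[of "Suc i" "min (\<eta> / 2) (- e (Suc i))" p] neg by auto
      have "w \<notin> Y"
      proof
        assume "w \<in> Y"
        then have "c - a * dist w p \<le> v w" by (rule bd)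
        moreover have "a * dist w p \<le> a * (real (Suc i) * eps)"
          using w(1) a by (intro mult_left_mono) (auto simp: dist_commute)
        moreover have "v w < ball_inf v eps p (Suc i) + (- e (Suc i))" using w(2) by linarith
        ultimately show False unfolding e_def by linarith
      qed
      then show "ball_inf v eps p (Suc (Suc i)) + ball_inf v eps p i \<le> 2 * ball_inf v eps p (Suc i) + \<eta>"
        using ball_inf_super[OF ip w(1) sup] w(2) by (auto simp: min_def split: if_splits)
    qed
    then show ?thesis by (simp add: e_def algebra_simps)
  qed
  have e_lower: "m - c \<le> e j" for j
    using ball_inf_ge[of p j] mult_nonneg_nonneg[OF a, of "real j * eps"] eps by (simp add: e_def)
  have e_nonneg: "0 \<le> e j" for j
  proof (rule ccontr)
    assume "\<not> 0 \<le> e j"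
    then have "\<exists>j. e j < 0" by (auto simp: not_le)
    define l where "l = (LEAST j. e j < 0)"
    have l: "e l < 0" unfolding l_def using \<open>\<exists>j. e j < 0\<close> by (rule LeastI_ex)
    have "e 0 \<ge> 0" using c by (simp add: e_def)
    then have "l \<noteq> 0" using l by (metis not_le)
    then obtain i where i: "l = Suc i" by (cases l) auto
    have "\<not> e i < 0" using not_less_Least[of i "\<lambda>j. e j < 0"] i by (simp add: l_def)
    \<comment> \<open>The increment at the first index below the cone is negative, and by concavity
      later increments are no larger; this contradicts the lower bound \<open>m\<close>.\<close>
    define d where "d = e (Suc i) - e i"
    have d: "d < 0" using l \<open>\<not> e i < 0\<close> i by (simp add: d_def)
    have ind: "e (Suc i + n) \<le> e (Suc i) + real n * d \<and> e (Suc i + n) - e (i + n) \<le> d" for n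
    proof (induction n)
      case (Suc n)
      have "real n * d \<le> 0" using d by (simp add: mult_nonneg_nonpos)
      then have "e (Suc i + n) < 0" using Suc l[unfolded i] by linarith
      then have "e (Suc (Suc (i + n))) - e (Suc (i + n)) \<le> e (Suc (i + n)) - e (i + n)"
        using concave[of "i + n"] by simp
      then show ?case using Suc by (simp add: algebra_simps)
    qed (simp add: d_def)
    obtain n :: nat where "real n > (e (Suc i) - (m - c)) / (- d)" using reals_Archimedean2 by blast
    then have "real n * d < - (e (Suc i) - (m - c))" using d by (simp add: field_simps)
    then show False using ind[of n] e_lower[of "Suc i + n"] by linarith
  qed
  show ?thesis
  proof (cases "x = p")
    case True
    moreover have "0 \<le> a * eps" using a eps by simp
    ultimately show ?thesis using c by (simp del: zero_le_mult_iff)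
  next
    case False
    let ?j = "hops eps p x"
    have "ball_inf v eps p ?j \<le> v x"
      using hops_lower[OF eps False] by (intro ball_inf_le) (simp add: dist_commute)
    moreover have "a * (real ?j * eps) \<le> a * (dist x p + eps)"
      using hops_upper[OF eps] a by (intro mult_left_mono) auto
    ultimately show ?thesis using e_nonneg[of ?j] by (simp add: e_def)
  qed
qed

end

section \<open>Concavity of ball infima in the radius\<close>

lemma concave_midpoint:
  fixes h :: "nat \<Rightarrow> real"
  assumes h: "\<And>i. Suc i < 2 * k \<Longrightarrow> h (Suc (Suc i)) + h i + c \<le> 2 * h (Suc i)"
  shows "h (2 * k) + h 0 + real k ^ 2 * c \<le> 2 * h k"
proof -
  \<comment> \<open>\<open>c * j^2 / 2\<close> has second difference \<open>c\<close>, so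
    \<open>e\<close> is concave; the contribution of the quadratic at 0, \<open>k\<close> and
    \<open>2 * k\<close> is \<open>k^2 * c\<close>.\<close>
  define e where "e j = h j + c * real j ^ 2 / 2" for j
  have e: "e (Suc (Suc i)) - e (Suc i) \<le> e (Suc i) - e i" if "Suc i < 2 * k" for i
  proof -
    have "c * real (Suc (Suc i)) ^ 2 / 2 + c * real i ^ 2 / 2 = 2 * (c * real (Suc i) ^ 2 / 2) + c"
    proof -
      have "real (Suc (Suc i)) ^ 2 + real i ^ 2 = 2 * real (Suc i) ^ 2 + 2"
        by (simp add: algebra_simps power2_eq_square)
      then have "c * real (Suc (Suc i)) ^ 2 + c * real i ^ 2 = c * (2 * real (Suc i) ^ 2 + 2)"
        by (simp only: distrib_left[symmetric])
      also have "\<dots> = 2 * (c * real (Suc i) ^ 2) + 2 * c" by algebra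
      finally show ?thesis by linarith
    qed
    then show ?thesis using h[OF that] unfolding e_def by linarith
  qed
  have mono: "e (Suc j) - e j \<le> e (Suc i) - e i" if "i \<le> j" "j < 2 * k" for i j
    using that
  proof (induction j)
    case (Suc j)
    show ?case
    proof (cases "i = Suc j")
      case False
      then have "e (Suc j) - e j \<le> e (Suc i) - e i" using Suc.prems by (intro Suc.IH) auto
      moreover have "e (Suc (Suc j)) - e (Suc j) \<le> e (Suc j) - e j" using Suc.prems by (intro e) simp
      ultimately show ?thesis by linarith
    qed simp
  qed simp
  have "e (k + n) + e (k - n) \<le> 2 * e k" if "n \<le> k" for n
    using that
  proof (induction n)
    case (Suc n)
    have "e (Suc (k + n)) - e (k + n) \<le> e (Suc (k - Suc n)) - e (k - Suc n)"
      using Suc(2) by (intro mono) auto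
    moreover have "Suc (k - Suc n) = k - n" using Suc(2) by simp
    moreover have "e (k + n) + e (k - n) \<le> 2 * e k" using Suc by simp
    ultimately show ?case by simp
  qed simp
  from this[of k] have "e (2 * k) + e 0 \<le> 2 * e k" by (simp flip: mult_2)
  moreover have "c * real (2 * k) ^ 2 / 2 = 2 * (real k ^ 2 * c)" "c * real k ^ 2 / 2 = real k ^ 2 * c / 2"
    by (simp_all add: power_mult_distrib)
  ultimately show ?thesis by (simp add: e_def mult.commute[of c])
qed

text \<open>Midpoint concavity of ball infima at the radii 0, \<open>R\<close> and
  \<open>2 * R\<close>. Points and a tolerance replace the infima, and the step of the game does not
  occur, so the property passes to uniform limits.\<close>

definition concave_at :: "'a::metric_space set \<Rightarrow> ('a \<Rightarrow> real) \<Rightarrow> ('a \<Rightarrow> real) \<Rightarrow> real \<Rightarrow> bool" where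
  "concave_at Y f u R \<longleftrightarrow> (\<forall>x g. (\<forall>z\<in>ball x (2 * R). z \<notin> Y \<and> g \<le> f z) \<longrightarrow>
     (\<forall>w\<in>ball x R. \<forall>\<theta>>0. \<exists>w'\<in>ball x (2 * R). u w' + u x + 2 * R\<^sup>2 * g \<le> 2 * u w + \<theta>))"

lemma super_at_mono:
  assumes "super_at eps c v x" "d \<le> c"
  shows "super_at eps d v x"
  unfolding super_at_def
proof (intro allI impI)
  fix \<eta> :: real assume "0 < \<eta>"
  then obtain z where z: "z \<in> ball x eps" "\<forall>y\<in>ball x eps. v y + v z + 2 * eps\<^sup>2 * c \<le> 2 * v x + \<eta>"
    using assms(1) unfolding super_at_def by blast
  have "2 * eps\<^sup>2 * d \<le> 2 * eps\<^sup>2 * c" using assms(2) by (intro mult_left_mono) auto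
  then have "v y + v z + 2 * eps\<^sup>2 * d \<le> 2 * v x + \<eta>" if "y \<in> ball x eps" for y
    using bspec[OF z(2) that] by linarith
  then show "\<exists>z\<in>ball x eps. \<forall>y\<in>ball x eps. v y + v z + 2 * eps\<^sup>2 * d \<le> 2 * v x + \<eta>"
    using z(1) by blast
qed

lemma concave_at_super:
  fixes v :: "'a::metric_space \<Rightarrow> real"
  assumes ip: "interpolating TYPE('a)" and eps: "0 < eps" and m: "\<And>x. m \<le> v x"
    and sup: "\<And>x. x \<notin> Y \<Longrightarrow> super_at eps (f x) v x" and k: "0 < k"
  shows "concave_at Y f v (real k * eps)"
  unfolding concave_at_def
proof (intro allI impI ballI)
  fix x w and g \<theta> :: real
  assume int: "\<forall>z\<in>ball x (2 * (real k * eps)). z \<notin> Y \<and> g \<le> f z" and w: "w \<in> ball x (real k * eps)" and \<theta>: "0 < \<theta>"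
  let ?h = "ball_inf v eps x"
  have "?h (Suc (Suc i)) + ?h i + 2 * eps\<^sup>2 * g \<le> 2 * ?h (Suc i)" if i: "Suc i < 2 * k" for i
  proof (rule field_le_epsilon)
    fix \<eta> :: real assume "0 < \<eta>"
    then obtain z where z: "dist x z < real (Suc i) * eps" "v z < ?h (Suc i) + \<eta> / 2"
      using ball_inf_approx[where v = v and m = m and p = x and j = "Suc i" and \<theta> = "\<eta> / 2" and eps = eps] m eps
      by (metis half_gt_zero zero_less_Suc)
    have "real (Suc i) * eps \<le> real (2 * k) * eps" using i eps by (intro mult_right_mono) auto
    then have "z \<in> ball x (2 * (real k * eps))" using z(1) by simp
    then have "z \<notin> Y" "g \<le> f z" using int by blast+
    then have "super_at eps g v z" using super_at_mono[OF sup] by blast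
    from ball_inf_super[where v = v and m = m, OF m eps ip z(1) this]
    show "?h (Suc (Suc i)) + ?h i + 2 * eps\<^sup>2 * g \<le> 2 * ?h (Suc i) + \<eta>" using z(2) by linarith
  qed
  then have "?h (2 * k) + ?h 0 + real k ^ 2 * (2 * eps\<^sup>2 * g) \<le> 2 * ?h k" by (rule concave_midpoint)
  moreover have "?h k \<le> v w" using w by (intro ball_inf_le[where v = v and m = m, OF m eps]) simp
  moreover obtain w' where w': "dist x w' < real (2 * k) * eps" "v w' < ?h (2 * k) + \<theta>"
    by (rule ball_inf_approx[where v = v and m = m and p = x and j = "2 * k" and \<theta> = \<theta> and eps = eps])
      (use m eps k \<theta> in simp_all)
  ultimately have "v w' + v x + 2 * (real k * eps)\<^sup>2 * g \<le> 2 * v w + \<theta>"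
    by (simp add: power_mult_distrib algebra_simps)
  then show "\<exists>w'\<in>ball x (2 * (real k * eps)). v w' + v x + 2 * (real k * eps)\<^sup>2 * g \<le> 2 * v w + \<theta>"
    using w'(1) by (intro bexI[of _ w']) auto
qed

section \<open>Comparison of step sizes\<close>

text \<open>In an interpolating space a function with a uniformly continuous extension satisfies
  this for every \<open>\<eta> > 0\<close> with a suitable \<open>L\<close>; a Lipschitz function
  satisfies it with \<open>\<eta> = 0\<close>.\<close>

definition modulus_on :: "'a::metric_space set \<Rightarrow> ('a \<Rightarrow> real) \<Rightarrow> real \<Rightarrow> real \<Rightarrow> bool" where
  "modulus_on Y F \<eta> L \<longleftrightarrow> 0 \<le> \<eta> \<and> 0 \<le> L \<and> (\<forall>x\<in>Y. \<forall>y\<in>Y. F x \<le> F y + \<eta> + L * dist x y)"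

text \<open>\<open>K\<close> bounds the running payoff and \<open>D\<close> the diameter; for \<open>K = 0\<close> the diameter is unrestricted.\<close>

locale tug =
  fixes Y :: "'a::metric_space set" and F f :: "'a \<Rightarrow> real" and m K D :: real
  assumes ip: "interpolating TYPE('a)" and Y: "Y \<noteq> {}"
    and F_ge: "\<And>x. x \<in> Y \<Longrightarrow> m \<le> F x" and f_ge: "\<And>x. x \<notin> Y \<Longrightarrow> 0 \<le> f x"
    and f_le: "\<And>x. x \<notin> Y \<Longrightarrow> f x \<le> K" and K: "0 \<le> K" and D: "0 \<le> D"
    and KD: "\<And>x y :: 'a. K * dist x y \<le> K * D"
    and modulus: "\<exists>\<eta> L. modulus_on Y F \<eta> L"
begin

text \<open>The barrier below is \<open>slope L * s - K * s\<^sup>2\<close> with \<open>s\<close>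
  the number of hops times \<open>eps\<close>. For \<open>K > 0\<close>, \<open>s\<close> is at most
  \<open>D + 1\<close>, and one further step leads to at most \<open>D + 2\<close>, where the
  derivative is still at least \<open>L\<close>; hence \<open>2 * D + 4\<close>.\<close>

definition slope :: "real \<Rightarrow> real" where "slope L = L + K * (2 * D + 4)"

abbreviation U :: "real \<Rightarrow> 'a \<Rightarrow> real" where "U \<equiv> least_super Y F f m"

lemma slope_nonneg: "0 \<le> L \<Longrightarrow> 0 \<le> slope L"
  using K D by (simp add: slope_def)

text \<open>The quadratic term pays for the running payoff.\<close>

lemma supersol_barrier:
  assumes mod: "modulus_on Y F \<eta> L" and y: "y \<in> Y" and eps: "0 < eps" "eps \<le> 1"
  defines "q \<equiv> \<lambda>j :: nat. slope L * (eps * real j) - K * (eps * real j)\<^sup>2"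
  shows "supersol Y F f m eps (\<lambda>x. F y + \<eta> + q (hops eps y x))"
proof -
  have \<eta>: "0 \<le> \<eta>" and L: "0 \<le> L" and Fm: "\<And>x. x \<in> Y \<Longrightarrow> F x \<le> F y + \<eta> + L * dist x y"
    using mod y by (auto simp: modulus_on_def)
  have size: "K * (eps * real (hops eps y x)) \<le> K * (D + 1)" for x
  proof -
    have "K * (eps * real (hops eps y x)) \<le> K * (dist x y + 1)"
      using hops_upper[OF eps(1), of y x] eps K by (intro mult_left_mono) (auto simp: algebra_simps)
    also have "\<dots> \<le> K * (D + 1)" using KD[of x y] by (simp add: distrib_left)
    finally show ?thesis .
  qed
  have q_mono: "q i \<le> q (Suc (hops eps y x))" "i \<le> hops eps y x \<Longrightarrow> q i \<le> q (hops eps y x)"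
    if "i \<le> Suc (hops eps y x)" for i x
  proof -
    have le: "q i \<le> q j" if "i \<le> j" "j \<le> Suc (hops eps y x)" for i j
    proof -
      have "eps * real i \<le> eps * real (Suc (hops eps y x))" "eps * real j \<le> eps * real (Suc (hops eps y x))"
        using that eps by (auto intro!: mult_left_mono simp del: of_nat_Suc)
      then have "K * (eps * real i + eps * real j) \<le> K * (2 * (eps * real (Suc (hops eps y x))))"
        using K by (intro mult_left_mono) auto
      also have "\<dots> = 2 * (K * (eps * real (hops eps y x))) + K * (2 * eps)" by (simp add: algebra_simps)
      also have "\<dots> \<le> 2 * (K * (D + 1)) + K * 2"
        using size[of x] mult_left_mono[of "2 * eps" 2 K] K eps by linarith
      also have "\<dots> \<le> slope L" using L by (simp add: slope_def algebra_simps)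
      finally have "0 \<le> (eps * real j - eps * real i) * (slope L - K * (eps * real i + eps * real j))"
        using that eps by (intro mult_nonneg_nonneg) auto
      also have "\<dots> = q j - q i" by (simp add: q_def algebra_simps power2_eq_square)
      finally show ?thesis by simp
    qed
    show "q i \<le> q (Suc (hops eps y x))" using that by (intro le) auto
    show "i \<le> hops eps y x \<Longrightarrow> q i \<le> q (hops eps y x)" by (intro le) auto
  qed
  have q0: "q 0 = 0" by (simp add: q_def)
  have qL: "L * dist x y \<le> q (hops eps y x)" for x
  proof -
    let ?s = "eps * real (hops eps y x)"
    have "L * dist x y \<le> L * ?s"
      using hops_lower'[OF eps(1), of x y] L by (intro mult_left_mono) (auto simp: mult.commute)
    also have "\<dots> \<le> (slope L - K * ?s) * ?s"
    proof (rule mult_right_mono)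
      have "0 \<le> K * D" using K D by simp
      then show "L \<le> slope L - K * ?s" using size[of x] K unfolding slope_def by (simp add: algebra_simps)
    qed (use eps in auto)
    also have "\<dots> = q (hops eps y x)" by (simp add: q_def algebra_simps power2_eq_square)
    finally show ?thesis .
  qed
  have q_nonneg: "0 \<le> q (hops eps y x)" for x using qL[of x] L by (meson mult_nonneg_nonneg order_trans zero_le_dist)
  show ?thesis
    unfolding supersol_def
  proof (intro conjI ballI allI impI)
    show "F x \<le> F y + \<eta> + q (hops eps y x)" if "x \<in> Y" for x using Fm[OF that] qL[of x] by linarith
    show "m \<le> F y + \<eta> + q (hops eps y x)" for x using F_ge[OF y] \<eta> q_nonneg[of x] by linarith
    fix x assume x: "x \<notin> Y"
    then have "x \<noteq> y" using y by auto
    obtain z where z: "z \<in> ball x eps" "Suc (hops eps y z) \<le> hops eps y x" by (rule hops_down[OF ip eps(1) \<open>x \<noteq> y\<close>])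
    obtain j where j: "hops eps y x = Suc j" using z(2) by (cases "hops eps y x") auto
    \<comment> \<open>A neighbour exactly one hop closer is wanted, because the estimate is an exact
      second difference of \<open>q\<close>; that no more than one hop is gained is
      \<open>hops_step\<close> read backwards.\<close>
    obtain p where p: "p \<in> ball x eps" "Suc (hops eps y p) = hops eps y x"
      using z hops_step[OF eps(1), of x z y] by (auto simp: dist_commute)
    have "q (hops eps y w) + q (hops eps y p) + 2 * eps\<^sup>2 * f x \<le> 2 * q (hops eps y x)" if w: "w \<in> ball x eps" for w
    proof -
      have "q (hops eps y w) \<le> q (Suc (hops eps y x))" using hops_step[OF eps(1) w] by (rule q_mono)
      moreover have "hops eps y p = j" using p(2) j by simp
      moreover have "eps\<^sup>2 * f x \<le> eps\<^sup>2 * K" using f_le[OF x] by (intro mult_left_mono) auto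
      moreover have "q (Suc (Suc j)) + q j + 2 * (eps\<^sup>2 * K) = 2 * q (Suc j)"
        by (simp add: q_def algebra_simps power2_eq_square)
      ultimately show ?thesis using j by simp
    qed
    then have "\<forall>w\<in>ball x eps. F y + \<eta> + q (hops eps y w) + (F y + \<eta> + q (hops eps y p)) + 2 * eps\<^sup>2 * f x
        \<le> 2 * (F y + \<eta> + q (hops eps y x)) + \<theta>" if "0 < \<theta>" for \<theta>
      using that by fastforce
    then show "super_at eps (f x) (\<lambda>x. F y + \<eta> + q (hops eps y x)) x"
      unfolding super_at_def using p(1) by blast
  qed
qed

lemma supersol_exists: "0 < eps \<Longrightarrow> eps \<le> 1 \<Longrightarrow> \<exists>v. supersol Y F f m eps v"
  using modulus supersol_barrier Y by blast

lemma supersol_U: "0 < eps \<Longrightarrow> eps \<le> 1 \<Longrightarrow> supersol Y F f m eps (U eps)"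
  by (intro supersol_least_super supersol_exists)

lemma U_boundary: "0 < eps \<Longrightarrow> eps \<le> 1 \<Longrightarrow> x \<in> Y \<Longrightarrow> U eps x = F x"
  by (intro least_super_boundary supersol_exists F_ge)

lemma U_ge: "0 < eps \<Longrightarrow> eps \<le> 1 \<Longrightarrow> m \<le> U eps x"
  using supersol_U by (simp add: supersol_def)

lemma U_super: "0 < eps \<Longrightarrow> eps \<le> 1 \<Longrightarrow> x \<notin> Y \<Longrightarrow> super_at eps (f x) (U eps) x"
  using supersol_U by (simp add: supersol_def)

lemma U_upper:
  assumes "modulus_on Y F \<eta> L" "y \<in> Y" "0 < eps" "eps \<le> 1"
  shows "U eps x \<le> F y + \<eta> + slope L * (dist x y + eps)"
proof -
  have "U eps x \<le> F y + \<eta> + (slope L * (eps * real (hops eps y x)) - K * (eps * real (hops eps y x))\<^sup>2)"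
    by (rule least_super_le[OF supersol_barrier[OF assms]])
  moreover have "0 \<le> K * (eps * real (hops eps y x))\<^sup>2" using K by simp
  moreover have "slope L * (eps * real (hops eps y x)) \<le> slope L * (dist x y + eps)"
    using hops_upper[OF assms(3), of y x] slope_nonneg assms(1)
    by (intro mult_left_mono) (auto simp: modulus_on_def mult.commute)
  ultimately show ?thesis by linarith
qed

lemma U_cone:
  assumes mod: "modulus_on Y F \<eta> L" and eps: "0 < eps" "eps \<le> 1"
    and c: "c \<le> U eps p" and bd: "\<And>z. z \<in> Y \<Longrightarrow> c - slope L * dist z p \<le> F z"
  shows "c - slope L * (dist x p + eps) \<le> U eps x"
proof (rule cone_lower[where m = m and Y = Y])
  show "super_at eps 0 (U eps) x" if "x \<notin> Y" for x
    using U_super[OF eps that] f_ge[OF that] by (rule super_at_mono)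
  show "c - slope L * dist z p \<le> U eps z" if "z \<in> Y" for z using bd[OF that] U_boundary[OF eps that] by simp
  show "0 \<le> slope L" using mod by (auto simp: modulus_on_def intro: slope_nonneg)
qed (use U_ge[OF eps] eps c ip in auto)

lemma slope_ge: "L \<le> slope L"
  using K D by (simp add: slope_def)

lemma U_lower:
  assumes mod: "modulus_on Y F \<eta> L" and y: "y \<in> Y" and eps: "0 < eps" "eps \<le> 1"
  shows "F y - \<eta> - slope L * (dist x y + eps) \<le> U eps x"
proof (rule U_cone[OF mod eps])
  show "F y - \<eta> \<le> U eps y" using mod U_boundary[OF eps y] by (simp add: modulus_on_def)
  fix z assume "z \<in> Y"
  then have "F y \<le> F z + \<eta> + L * dist z y" using mod y by (auto simp: modulus_on_def dist_commute)
  moreover have "L * dist z y \<le> slope L * dist z y" using slope_ge by (intro mult_right_mono) auto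
  ultimately show "F y - \<eta> - slope L * dist z y \<le> F z" by linarith
qed

text \<open>The cone opening downwards from slightly below \<open>U eps p\<close> lies below
  \<open>F\<close> on \<open>Y\<close> by the upper bound for \<open>U eps p\<close>, hence nearly
  below \<open>U eps\<close> everywhere. Lowering the vertex pays for the error in that
  bound.\<close>

lemma U_near_lipschitz:
  assumes mod: "modulus_on Y F \<eta> L" and eps: "0 < eps" "eps \<le> 1"
  shows "U eps p \<le> U eps x + \<eta> + slope L * (dist x p + 2 * eps)"
proof -
  have "(U eps p - \<eta> - slope L * eps) - slope L * (dist x p + eps) \<le> U eps x"
  proof (rule U_cone[OF mod eps])
    have "0 \<le> \<eta>" "0 \<le> slope L * eps" using mod eps by (auto simp: modulus_on_def intro!: mult_nonneg_nonneg slope_nonneg)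
    then show "U eps p - \<eta> - slope L * eps \<le> U eps p" by linarith
    show "U eps p - \<eta> - slope L * eps - slope L * dist z p \<le> F z" if "z \<in> Y" for z
      using U_upper[OF mod that eps, of p] by (simp add: algebra_simps dist_commute)
  qed
  then show ?thesis by (simp add: algebra_simps)
qed

section \<open>Comparison of step sizes away from a layer around \<open>Y\<close>\<close>

definition rel_modulus :: "real \<Rightarrow> real \<Rightarrow> bool" where
  "rel_modulus \<kappa> r \<longleftrightarrow> (\<forall>x z. x \<notin> Y \<longrightarrow> z \<notin> Y \<longrightarrow> dist x z < r \<longrightarrow> (1 - \<kappa>) * f x \<le> f z)"

lemma super_at_affine:
  assumes l: "0 < l" and sup: "super_at eps c v x" and cd: "d \<le> l * c"
  shows "super_at eps d (\<lambda>y. l * (v y - m) + e) x"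
  unfolding super_at_def
proof (intro allI impI)
  fix \<eta> :: real assume "0 < \<eta>"
  then have "0 < \<eta> / l" using l by simp
  then obtain z where z: "z \<in> ball x eps" "\<forall>y\<in>ball x eps. v y + v z + 2 * eps\<^sup>2 * c \<le> 2 * v x + \<eta> / l"
    using sup unfolding super_at_def by blast
  have "l * (v y - m) + e + (l * (v z - m) + e) + 2 * eps\<^sup>2 * d \<le> 2 * (l * (v x - m) + e) + \<eta>" if "y \<in> ball x eps" for y
  proof -
    have "l * (v y + v z + 2 * eps\<^sup>2 * c) \<le> l * (2 * v x + \<eta> / l)"
      using z(2) that l by (intro mult_left_mono) auto
    moreover have "2 * eps\<^sup>2 * d \<le> 2 * eps\<^sup>2 * (l * c)" using cd by (intro mult_left_mono) auto
    ultimately show ?thesis using l by (simp add: algebra_simps)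
  qed
  then show "\<exists>z\<in>ball x eps. \<forall>y\<in>ball x eps. l * (v y - m) + e + (l * (v z - m) + e) + 2 * eps\<^sup>2 * d
      \<le> 2 * (l * (v x - m) + e) + \<eta>" using z(1) by blast
qed

text \<open>In the layer \<open>N\<close> the minimum of \<open>U eps\<close> and the competitor is \<open>U eps\<close> itself; the factor \<open>1 - \<kappa>\<close>
  is absorbed by scaling.\<close>

lemma U_le_super_off_layer:
  assumes eps: "0 < eps" "eps \<le> 1" and V: "\<And>x. m \<le> V x" and \<kappa>: "0 \<le> \<kappa>" "\<kappa> \<le> 1 / 2" and e: "0 \<le> e"
    and layer: "\<And>x. x \<in> Y \<or> x \<in> N \<Longrightarrow> U eps x \<le> V x + e"
    and sup: "\<And>x. x \<notin> Y \<Longrightarrow> x \<notin> N \<Longrightarrow> super_at eps ((1 - \<kappa>) * f x) V x"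
  shows "U eps x \<le> V x + e + 2 * (\<kappa> * (V x - m))"
proof -
  \<comment> \<open>Scaling by \<open>l\<close> turns the running payoff
    \<open>(1 - \<kappa>) * f\<close> back into \<open>f\<close>, and
    \<open>\<kappa> \<le> 1 / 2\<close> yields \<open>l - 1 \<le> 2 * \<kappa>\<close>.\<close>
  define l where "l = 1 / (1 - \<kappa>)"
  have l: "1 \<le> l" "0 < l" "l \<le> 2" and l1: "l * (1 - \<kappa>) = 1" using \<kappa> by (auto simp: l_def field_simps)
  then have "l - 1 = \<kappa> * l" by (simp add: algebra_simps)
  also have "\<dots> \<le> \<kappa> * 2" using l \<kappa> by (intro mult_left_mono)
  finally have l2: "l - 1 \<le> 2 * \<kappa>" by simp
  define P where "P x = l * (V x - m) + (m + e)" for x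
  have P_ge: "V x + e \<le> P x" for x
    using mult_right_mono[OF l(1), of "V x - m"] V[of x] by (simp add: P_def)
  define W where "W x = min (U eps x) (P x)" for x
  have "supersol Y F f m eps W"
    unfolding supersol_def
  proof (intro conjI ballI allI impI)
    show "F x \<le> W x" if "x \<in> Y" for x
      using U_boundary[OF eps that] layer[of x] P_ge[of x] that by (simp add: W_def)
    show "m \<le> W x" for x using U_ge[OF eps] V[of x] P_ge[of x] e unfolding W_def by (smt (verit))
    fix x assume x: "x \<notin> Y"
    show "super_at eps (f x) W x"
    proof (cases "W x = U eps x")
      case True
      with U_super[OF eps x] show ?thesis by (rule super_at_antimono) (auto simp: W_def)
    next
      case False
      then have WP: "W x = P x" "\<not> U eps x \<le> P x" by (auto simp: W_def min_def split: if_splits)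
      then have "x \<notin> N" using layer[of x] P_ge[of x] by auto
      have "l * ((1 - \<kappa>) * f x) = f x" by (simp add: mult.assoc[symmetric] l1)
      then have "super_at eps (f x) P x"
        unfolding P_def by (intro super_at_affine[OF l(2) sup[OF x \<open>x \<notin> N\<close>]]) (simp only: order_refl)
      then show ?thesis using WP(1) by (rule super_at_antimono) (auto simp: W_def)
    qed
  qed
  then have "U eps x \<le> P x" using least_super_le[of Y F f m eps W x] by (simp add: W_def)
  also have "P x = V x + e + (l - 1) * (V x - m)" by (simp add: P_def algebra_simps)
  also have "\<dots> \<le> V x + e + 2 * \<kappa> * (V x - m)" using l2 V[of x] by (intro add_left_mono mult_right_mono) auto
  finally show ?thesis by (simp add: mult.assoc)
qed

text \<open>Away from \<open>Y\<close> the infima of \<open>u\<close> over balls of radius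
  \<open>R\<close> form a supersolution: concavity produces a low point at distance below
  \<open>2 * R\<close>, and a move of length below \<open>R\<close> brings it within reach. In the
  layer the cone bounds cost \<open>3 * R\<close> and \<open>4 * R\<close> times the slope, whence
  the 7.\<close>

lemma U_le_concave:
  assumes R: "0 < R" "R \<le> 1" and u: "\<And>x. m \<le> u x" and conc: "concave_at Y f u R"
    and \<kappa>: "0 \<le> \<kappa>" "\<kappa> \<le> 1 / 2" "rel_modulus \<kappa> (2 * R)" and mod: "modulus_on Y F \<eta> L"
    and u_lower: "\<And>w y. y \<in> Y \<Longrightarrow> F y - \<eta> - slope L * (dist w y + R) \<le> u w"
  shows "U R x \<le> u x + (2 * \<eta> + 7 * slope L * R) + 2 * (\<kappa> * (u x - m))"
proof -
  let ?e = "2 * \<eta> + 7 * slope L * R"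
  have sl: "0 \<le> slope L" "0 \<le> \<eta>" using mod by (auto simp: modulus_on_def intro: slope_nonneg)
  define B where "B x = (INF w\<in>ball x R. u w)" for x
  have bdd: "bdd_below (u ` A)" for A using u by (rule bdd_belowI2)
  have B_le: "B x \<le> u w" if "dist x w < R" for x w unfolding B_def using that by (intro cINF_lower bdd) auto
  have B_ge: "c \<le> B x" if "\<And>w. dist x w < R \<Longrightarrow> c \<le> u w" for c x
    unfolding B_def using that R by (intro cINF_greatest) auto
  define N where "N = {x. \<exists>y\<in>Y. dist x y < 2 * R}"
  have "U R x \<le> B x + ?e + 2 * (\<kappa> * (B x - m))"
  proof (rule U_le_super_off_layer[where N = N])
    show "m \<le> B x" for x using u by (rule B_ge)
    show "0 \<le> ?e" using sl R by simp
    show "U R x \<le> B x + ?e" if near: "x \<in> Y \<or> x \<in> N" for x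
    proof -
      obtain y where y: "y \<in> Y" "dist x y < 2 * R" using near R by (force simp: N_def)
      have "U R x \<le> F y + \<eta> + slope L * (dist x y + R)" by (rule U_upper[OF mod y(1) R])
      also have "\<dots> \<le> F y + \<eta> + slope L * (3 * R)" using y sl by (intro add_left_mono mult_left_mono) auto
      finally have 1: "U R x \<le> F y + \<eta> + slope L * (3 * R)" .
      have "F y - \<eta> - slope L * (4 * R) \<le> B x"
      proof (rule B_ge)
        fix w assume "dist x w < R"
        then have "slope L * (dist w y + R) \<le> slope L * (4 * R)"
          using y dist_triangle[of w y x] sl by (intro mult_left_mono) (auto simp: dist_commute)
        then show "F y - \<eta> - slope L * (4 * R) \<le> u w" using u_lower[OF y(1), of w] by linarith
      qed
      then show ?thesis using 1 by (simp add: algebra_simps)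
    qed
    fix x assume x: "x \<notin> Y" "x \<notin> N"
    have off: "z \<notin> Y" if "z \<in> ball x (2 * R)" for z using that x by (auto simp: N_def)
    have g: "z \<notin> Y \<and> (1 - \<kappa>) * f x \<le> f z" if "z \<in> ball x (2 * R)" for z
      using off[OF that] x(1) that \<kappa>(3) by (simp add: rel_modulus_def)
    show "super_at R ((1 - \<kappa>) * f x) B x"
      unfolding super_at_def
    proof (intro allI impI)
      fix \<theta> :: real assume \<theta>: "0 < \<theta>"
      obtain w where w: "dist x w < R" "u w < B x + \<theta> / 4"
        using cINF_less_iff[OF _ bdd, of "ball x R" "B x + \<theta> / 4"] R \<theta> unfolding B_def by auto
      obtain w' where w': "dist x w' < 2 * R" "u w' + u x + 2 * R\<^sup>2 * ((1 - \<kappa>) * f x) \<le> 2 * u w + \<theta> / 2"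
        using conc g w(1) \<theta> unfolding concave_at_def by (smt (verit) half_gt_zero mem_ball)
      obtain z where z: "dist x z < R" "dist z w' < R" using interpolatingD[OF ip R(1) R(1)] w'(1) by auto
      have "B y + B z + 2 * R\<^sup>2 * ((1 - \<kappa>) * f x) \<le> 2 * B x + \<theta>" if "y \<in> ball x R" for y
        using B_le[of y x] B_le[OF z(2)] that w(2) w'(2) by (simp add: dist_commute)
      then show "\<exists>z\<in>ball x R. \<forall>y\<in>ball x R. B y + B z + 2 * R\<^sup>2 * ((1 - \<kappa>) * f x) \<le> 2 * B x + \<theta>"
        using z(1) by (intro bexI[of _ z]) auto
    qed
  qed (use R \<kappa> in auto)
  moreover have "B x \<le> u x" using R by (intro B_le) simp
  moreover have "\<kappa> * (B x - m) \<le> \<kappa> * (u x - m)" using \<kappa> \<open>B x \<le> u x\<close> by (intro mult_left_mono) auto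
  ultimately show ?thesis by linarith
qed

end

context tug
begin

text \<open>From step \<open>R\<close> to step \<open>eps = R / k\<close>: player II aims at a point \<open>z\<close> near \<open>x\<close> and plays steps of
  length \<open>eps\<close> until the target is reached or has moved \<open>2 k\<close> steps away. \<open>cost z M j\<close> is the
  expected cost when the target is \<open>j\<close> steps away and missing it costs \<open>M\<close>.\<close>

lemma U_refine:
  assumes R: "0 < R" "R \<le> 1" and k: "0 < k"
    and \<kappa>: "0 \<le> \<kappa>" "\<kappa> \<le> 1 / 2" "rel_modulus \<kappa> (2 * R)" and mod: "modulus_on Y F \<eta> L"
  shows "U (R / real k) x \<le> U R x + (2 * \<eta> + 7 * slope L * R) + 2 * (\<kappa> * (U R x - m))"
proof -
  define eps where "eps = R / real k"
  have keps: "real k * eps = R" using k by (simp add: eps_def)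
  have "eps \<le> R" using k R by (simp add: eps_def field_simps)
  then have eps: "0 < eps" "eps \<le> 1" "eps \<le> R" using k R by (auto simp: eps_def)
  let ?v = "U R"
  let ?e = "2 * \<eta> + 7 * slope L * R"
  have sl: "0 \<le> slope L" "0 \<le> \<eta>" using mod by (auto simp: modulus_on_def intro: slope_nonneg)
  define V0 where "V0 x = (INF w\<in>ball x R. ?v w)" for x
  have bdd: "bdd_below (?v ` A)" for A using U_ge[OF R] by (rule bdd_belowI2)
  have V0_le: "V0 x \<le> ?v w" if "dist x w < R" for x w unfolding V0_def using that by (intro cINF_lower bdd) auto
  have V0_ge: "c \<le> V0 x" if "\<And>w. dist x w < R \<Longrightarrow> c \<le> ?v w" for c x
    unfolding V0_def using that R by (intro cINF_greatest) auto
  \<comment> \<open>The symmetric walk on \<open>0..2 * k\<close> started at \<open>j\<close>: the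
    linear part is its expected final cost, \<open>V0 z\<close> at 0 and \<open>M\<close> at
    \<open>2 * k\<close>, and \<open>j * (2 * k - j)\<close> is its expected duration.\<close>
  define cost where "cost z M j = V0 z + (M - V0 z) * (real j / real (2 * k)) + eps\<^sup>2 * f z * (real j * (real (2 * k) - real j))"
    for z M and j :: nat
  \<comment> \<open>\<open>M\<close> dominates \<open>V0\<close> within \<open>2 * R\<close> of the
    target, so giving up at count \<open>2 * k\<close> costs at most \<open>M\<close>.\<close>
  define adm where "adm x z M j \<longleftrightarrow> z \<notin> Y \<and> 0 < j \<and> j < 2 * k \<and> dist x z < real j * eps \<and> (\<forall>p. dist z p < 2 * R \<longrightarrow> V0 p \<le> M)"
    for x z M and j :: nat
  define C where "C x = {c. c = V0 x \<or> (\<exists>z M j. adm x z M j \<and> c = cost z M j)}" for x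
  define V where "V x = Inf (C x)" for x
  have C_ge: "\<exists>w. dist x w < 2 * R \<and> V0 w \<le> c" if c: "c \<in> C x" for x c
  proof (cases "c = V0 x")
    case True
    then show ?thesis using R by (intro exI[of _ x]) simp
  next
    case False
    then obtain z M j where a: "adm x z M j" "c = cost z M j" using c by (auto simp: C_def)
    have "real j * eps \<le> real (2 * k) * eps" using a eps by (intro mult_right_mono) (auto simp: adm_def)
    then have "dist x z < 2 * R" using a keps by (simp add: adm_def)
    moreover have "0 \<le> (M - V0 z) * (real j / real (2 * k))"
      using a R by (intro mult_nonneg_nonneg) (auto simp: adm_def)
    moreover have "0 \<le> eps\<^sup>2 * f z * (real j * (real (2 * k) - real j))"
      using a f_ge[of z] by (intro mult_nonneg_nonneg) (auto simp: adm_def)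
    ultimately show ?thesis unfolding a(2) cost_def by (intro exI[of _ z]) simp
  qed
  have V0_m: "m \<le> V0 x" for x using U_ge[OF R] by (rule V0_ge)
  have bddC: "bdd_below (C x)" for x
  proof (rule bdd_belowI)
    fix c assume "c \<in> C x"
    then show "m \<le> c" using C_ge V0_m order_trans by blast
  qed
  have C0: "V0 x \<in> C x" for x by (simp add: C_def)
  have V_V0: "V x \<le> V0 x" for x unfolding V_def by (rule cInf_lower[OF C0 bddC])
  have V_ge: "c \<le> V x" if "\<And>w. dist x w < 2 * R \<Longrightarrow> c \<le> V0 w" for c x
    unfolding V_def
  proof (rule cInf_greatest)
    show "C x \<noteq> {}" using C0 by auto
    fix d assume "d \<in> C x"
    then obtain w where "dist x w < 2 * R" "V0 w \<le> d" using C_ge by blast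
    then show "c \<le> d" using that[of w] by linarith
  qed
  have V_cost: "V y \<le> cost z M j" if a: "adm x z M i" and j: "0 < j" "j \<le> 2 * k" "dist y z < real j * eps" for x y z M i j
  proof (cases "j = 2 * k")
    case True
    have "dist z y < 2 * R" using j True keps by (simp add: dist_commute)
    then have "V0 y \<le> M" using a by (simp add: adm_def)
    also have "M = cost z M j" using True k by (simp add: cost_def)
    finally show ?thesis using V_V0[of y] by linarith
  next
    case False
    then have "adm y z M j" using a j by (simp add: adm_def)
    then show ?thesis unfolding V_def by (intro cInf_lower bddC) (auto simp: C_def)
  qed
  define N where "N = {x. \<exists>y\<in>Y. dist x y < R}"
  \<comment> \<open>Off the layer, stopping at cost \<open>V0 x\<close> can be replaced by a walk
    started at its midpoint \<open>k\<close>, so there is always a target to aim at.\<close>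
  have good: "\<exists>z M j. adm x z M j \<and> cost z M j \<le> V x + \<theta>" if x: "x \<notin> N" and \<theta>: "0 < \<theta>" for x \<theta>
  proof -
    obtain c where c: "c \<in> C x" "c < V x + \<theta> / 2"
      using cInf_less_iff[OF _ bddC[of x], of "V x + \<theta> / 2"] C0[of x] \<theta> unfolding V_def by auto
    show ?thesis
    proof (cases "c = V0 x")
      case False
      then show ?thesis using c \<theta> by (fastforce simp: C_def)
    next
      case True
      obtain y where y: "dist x y < R" "?v y < V0 x + \<theta> / 4"
        using cINF_less_iff[OF _ bdd, of "ball x R" "V0 x + \<theta> / 4"] R \<theta> unfolding V0_def by auto
      have "y \<notin> Y" using x y(1) by (auto simp: N_def)
      have "0 < \<theta> / 2" using \<theta> by simp
      then obtain z where z: "dist y z < R" "\<forall>w\<in>ball y R. ?v w + ?v z + 2 * R\<^sup>2 * f y \<le> 2 * ?v y + \<theta> / 2"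
        using U_super[OF R \<open>y \<notin> Y\<close>] unfolding super_at_def by (meson mem_ball)
      \<comment> \<open>Chosen so that the cost at \<open>j = k\<close> is
        \<open>V0 x + \<theta> / 2\<close>; the supersolution inequality at \<open>y\<close> is what
        makes this \<open>M\<close> admissible.\<close>
      define M where "M = 2 * V0 x + \<theta> - 2 * R\<^sup>2 * f y - V0 y"
      have "V0 p \<le> M" if p: "dist y p < 2 * R" for p
      proof -
        obtain w where w: "dist y w < R" "dist w p < R" using interpolatingD[OF ip R(1) R(1)] p by auto
        have "?v w + ?v z + 2 * R\<^sup>2 * f y \<le> 2 * ?v y + \<theta> / 2" using z(2) w(1) by simp
        then show ?thesis using V0_le[of p w] w(2) V0_le[OF z(1)] y(2) by (simp add: M_def dist_commute)
      qed
      then have "adm x y M k" using y(1) \<open>y \<notin> Y\<close> k by (simp add: adm_def keps)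
      moreover have "cost y M k = V0 x + \<theta> / 2"
      proof -
        have "eps\<^sup>2 * f y * (real k * (real (2 * k) - real k)) = (real k * eps)\<^sup>2 * f y"
          by (simp add: power2_eq_square algebra_simps)
        moreover have "real k / real (2 * k) = 1 / 2" using k by simp
        ultimately have "cost y M k = V0 y + (M - V0 y) * (1 / 2) + R\<^sup>2 * f y"
          unfolding cost_def keps by (simp only:)
        then show ?thesis by (simp add: M_def field_simps)
      qed
      ultimately show ?thesis using c True by (intro exI[of _ y] exI[of _ M] exI[of _ k]) simp
    qed
  qed
  have "U eps x \<le> V x + ?e + 2 * (\<kappa> * (V x - m))"
  proof (rule U_le_super_off_layer[where N = N])
    show "m \<le> V x" for x using V0_m by (rule V_ge)
    show "0 \<le> ?e" using sl R by simp
    \<comment> \<open>Here the cones contribute \<open>2 * R\<close> from above and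
      \<open>5 * R\<close> from below, again 7 in total.\<close>
    show "U eps x \<le> V x + ?e" if near: "x \<in> Y \<or> x \<in> N" for x
    proof -
      obtain y where y: "y \<in> Y" "dist x y < R" using near R by (force simp: N_def)
      have "U eps x \<le> F y + \<eta> + slope L * (dist x y + eps)" by (rule U_upper[OF mod y(1) eps(1,2)])
      also have "\<dots> \<le> F y + \<eta> + slope L * (2 * R)" using y eps sl by (intro add_left_mono mult_left_mono) auto
      finally have 1: "U eps x \<le> F y + \<eta> + slope L * (2 * R)" .
      have "F y - \<eta> - slope L * (5 * R) \<le> V x"
      proof (rule V_ge, rule V0_ge)
        fix w w' assume w: "dist x w < 2 * R" "dist w w' < R"
        have "dist w' y \<le> dist w' w + dist w x + dist x y"
          using dist_triangle[of w' y w] dist_triangle[of w y x] by linarith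
        then have "slope L * (dist w' y + R) \<le> slope L * (5 * R)"
          using y w sl by (intro mult_left_mono) (auto simp: dist_commute)
        then show "F y - \<eta> - slope L * (5 * R) \<le> ?v w'" using U_lower[OF mod y(1) R, of w'] by linarith
      qed
      then show ?thesis using 1 by (simp add: algebra_simps)
    qed
    fix x assume x: "x \<notin> Y" "x \<notin> N"
    show "super_at eps ((1 - \<kappa>) * f x) V x"
      unfolding super_at_def
    proof (intro allI impI)
      fix \<theta> :: real assume "0 < \<theta>"
      then obtain z M j where a: "adm x z M j" and c: "cost z M j \<le> V x + \<theta> / 2"
        using good[OF x(2), of "\<theta> / 2"] by auto
      then obtain i where i: "j = Suc i" by (cases j) (auto simp: adm_def)
      \<comment> \<open>Player II's move lowers the count by one; for \<open>i = 0\<close> it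
        reaches the target itself.\<close>
      have "\<exists>p\<in>ball x eps. V p \<le> cost z M i"
      proof (cases "i = 0")
        case True
        then show ?thesis using a V_V0[of z] i by (intro bexI[of _ z]) (auto simp: cost_def adm_def)
      next
        case False
        have "dist x z < eps + real i * eps" using a i by (simp add: adm_def algebra_simps)
        then obtain p where "dist x p < eps" "dist p z < real i * eps"
          using interpolatingD[OF ip eps(1), of "real i * eps" x z] False eps by auto
        then show ?thesis using False a i by (intro bexI[of _ p] V_cost[OF a]) (auto simp: adm_def)
      qed
      then obtain p where p: "p \<in> ball x eps" "V p \<le> cost z M i" by blast
      have "V y + V p + 2 * eps\<^sup>2 * ((1 - \<kappa>) * f x) \<le> 2 * V x + \<theta>" if y: "y \<in> ball x eps" for y
      proof -
        have "dist y z < real (Suc j) * eps"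
          using a y dist_triangle[of y z x] by (simp add: adm_def dist_commute algebra_simps)
        then have "V y \<le> cost z M (Suc j)" using a by (intro V_cost[OF a]) (auto simp: adm_def)
        moreover have "cost z M (Suc j) + cost z M i + 2 * (eps\<^sup>2 * f z) = 2 * cost z M j"
        proof -
          have "(M - V0 z) * (real (Suc j) / real (2 * k)) + (M - V0 z) * (real i / real (2 * k))
             = 2 * ((M - V0 z) * (real j / real (2 * k)))"
          proof -
            have "real (Suc j) / real (2 * k) + real i / real (2 * k) = (2 * real j) / real (2 * k)"
              unfolding add_divide_distrib[symmetric] by (simp add: i)
            then show ?thesis by (simp only: distrib_left[symmetric])
          qed
          moreover have "eps\<^sup>2 * f z * (real (Suc j) * (real (2 * k) - real (Suc j)))
              + eps\<^sup>2 * f z * (real i * (real (2 * k) - real i)) + 2 * (eps\<^sup>2 * f z)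
             = 2 * (eps\<^sup>2 * f z * (real j * (real (2 * k) - real j)))"
            by (simp add: i algebra_simps)
          moreover have "s + a1 + b1 + (s + a2 + b2) + c = 2 * (s + a3 + b3)"
            if "a1 + a2 = 2 * a3" "b1 + b2 + c = 2 * b3" for s a1 a2 a3 b1 b2 b3 c :: real
            using that by simp
          ultimately show ?thesis unfolding cost_def by blast
        qed
        moreover have "2 * eps\<^sup>2 * ((1 - \<kappa>) * f x) \<le> 2 * (eps\<^sup>2 * f z)"
        proof -
          have "real j * eps \<le> real (2 * k) * eps" using a eps by (intro mult_right_mono) (auto simp: adm_def)
          then have "dist x z < 2 * R" using a keps by (simp add: adm_def)
          then have "(1 - \<kappa>) * f x \<le> f z" using \<kappa>(3) x(1) a by (simp add: rel_modulus_def adm_def)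
          then have "eps\<^sup>2 * ((1 - \<kappa>) * f x) \<le> eps\<^sup>2 * f z" by (intro mult_left_mono) auto
          then show ?thesis by simp
        qed
        ultimately show ?thesis using p(2) c by linarith
      qed
      then show "\<exists>p\<in>ball x eps. \<forall>y\<in>ball x eps. V y + V p + 2 * eps\<^sup>2 * ((1 - \<kappa>) * f x) \<le> 2 * V x + \<theta>"
        using p(1) by (intro bexI[of _ p]) auto
    qed
  qed (use eps \<kappa> in auto)
  moreover have "V x \<le> ?v x" using V_V0[of x] V0_le[of x x] R by simp
  moreover have "\<kappa> * (V x - m) \<le> \<kappa> * (?v x - m)" using \<kappa> \<open>V x \<le> ?v x\<close> by (intro mult_left_mono) auto
  ultimately show ?thesis unfolding eps_def by linarith
qed

text \<open>\<open>M\<close> bounds the cost of scaling uniformly in the step. For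
  \<open>\<kappa> = 0\<close> it can be 0 even if the least supersolutions are unbounded
  above.\<close>

definition step_error :: "real \<Rightarrow> real \<Rightarrow> bool" where
  "step_error R E \<longleftrightarrow> (\<exists>\<eta> L \<kappa> M. modulus_on Y F \<eta> L \<and> 0 \<le> \<kappa> \<and> \<kappa> \<le> 1 / 2 \<and> rel_modulus \<kappa> (2 * R) \<and>
     (\<forall>eps x. 0 < eps \<longrightarrow> eps \<le> 1 \<longrightarrow> \<kappa> * (U eps x - m) \<le> M) \<and> E = 2 * \<eta> + 7 * slope L * R + 2 * M)"

text \<open>Stated for limits so that one argument serves twice: a constant sequence compares two
  steps, and repeated halving compares a step with the limit.\<close>

lemma U_le_concave_limit:
  assumes R: "0 < R" "R \<le> 1" and E: "step_error R E" and conc: "concave_at Y f u R"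
    and eps: "\<And>n. 0 < eps n" "\<And>n. eps n \<le> R" and u: "\<And>x. (\<lambda>n. U (eps n) x) \<longlonglongrightarrow> u x"
  shows "U R x \<le> u x + E"
proof -
  obtain \<eta> L \<kappa> M where mod: "modulus_on Y F \<eta> L" and \<kappa>: "0 \<le> \<kappa>" "\<kappa> \<le> 1 / 2" "rel_modulus \<kappa> (2 * R)"
    and M: "\<And>eps x. 0 < eps \<Longrightarrow> eps \<le> 1 \<Longrightarrow> \<kappa> * (U eps x - m) \<le> M" and E: "E = 2 * \<eta> + 7 * slope L * R + 2 * M"
    using E unfolding step_error_def by blast
  have eps1: "eps n \<le> 1" for n using eps(2)[of n] R by linarith
  have "U R x \<le> u x + (2 * \<eta> + 7 * slope L * R) + 2 * (\<kappa> * (u x - m))"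
  proof (rule U_le_concave[OF R _ conc \<kappa> mod])
    show "m \<le> u x" for x
      by (rule LIMSEQ_le_const[OF u]) (use U_ge[OF eps(1) eps1] in blast)
    fix w y assume y: "y \<in> Y"
    show "F y - \<eta> - slope L * (dist w y + R) \<le> u w"
    proof (rule LIMSEQ_le_const[OF u], intro exI allI impI)
      fix n
      have "0 \<le> slope L" using mod by (auto simp: modulus_on_def intro: slope_nonneg)
      then have "slope L * (dist w y + eps n) \<le> slope L * (dist w y + R)" using eps(2) by (intro mult_left_mono) auto
      then show "F y - \<eta> - slope L * (dist w y + R) \<le> U (eps n) w"
        using U_lower[OF mod y eps(1) eps1, of w n] by linarith
    qed
  qed
  moreover have "\<kappa> * (u x - m) \<le> M"
  proof (rule LIMSEQ_le_const2)
    show "(\<lambda>n. \<kappa> * (U (eps n) x - m)) \<longlonglongrightarrow> \<kappa> * (u x - m)" by (intro tendsto_intros u)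
    show "\<exists>N. \<forall>n\<ge>N. \<kappa> * (U (eps n) x - m) \<le> M" using M eps(1) eps1 by blast
  qed
  ultimately show ?thesis by (simp add: E)
qed

lemma concave_at_U: "0 < eps \<Longrightarrow> eps \<le> 1 \<Longrightarrow> 0 < k \<Longrightarrow> concave_at Y f (U eps) (real k * eps)"
  using concave_at_super[OF ip, of eps m "U eps" Y f k] U_ge U_super by auto

lemma U_step_error:
  assumes R: "0 < R" "R \<le> 1" and E: "step_error R E" and k: "0 < k"
  shows "\<bar>U R x - U (R / real k) x\<bar> \<le> E"
proof -
  have "R / real k \<le> R" using R k by (simp add: field_simps)
  then have eps: "0 < R / real k" "R / real k \<le> 1" "R / real k \<le> R" using R k by auto
  have "concave_at Y f (U (R / real k)) R" using concave_at_U[OF eps(1,2) k] k by simp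
  then have "U R x \<le> U (R / real k) x + E"
    by (rule U_le_concave_limit[OF R E, where eps = "\<lambda>_. R / real k"]) (use eps in auto)
  moreover have "U (R / real k) x \<le> U R x + E"
  proof -
    obtain \<eta> L \<kappa> M where mod: "modulus_on Y F \<eta> L" and \<kappa>: "0 \<le> \<kappa>" "\<kappa> \<le> 1 / 2" "rel_modulus \<kappa> (2 * R)"
      and M: "\<And>eps x. 0 < eps \<Longrightarrow> eps \<le> 1 \<Longrightarrow> \<kappa> * (U eps x - m) \<le> M" and E: "E = 2 * \<eta> + 7 * slope L * R + 2 * M"
      using E unfolding step_error_def by blast
    show ?thesis using U_refine[OF R k \<kappa> mod, of x] M[OF R, of x] by (simp add: E)
  qed
  ultimately show ?thesis by linarith
qed

text \<open>The game values for the steps \<open>R / 2 ^ n\<close> converge to a limit for which the concavity of ball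
  infima holds at every scale; comparison with an arbitrary step then shows that the limit does not
  depend on \<open>R\<close>.\<close>

theorem U_converges:
  assumes small: "\<And>\<theta>. 0 < \<theta> \<Longrightarrow> \<exists>r>0. \<forall>R. 0 < R \<longrightarrow> R < r \<longrightarrow> (\<exists>E\<le>\<theta>. step_error R E)"
  obtains u where "\<And>R E x. 0 < R \<Longrightarrow> R \<le> 1 \<Longrightarrow> step_error R E \<Longrightarrow> \<bar>U R x - u x\<bar> \<le> E"
    and "\<And>\<eta> L x y. modulus_on Y F \<eta> L \<Longrightarrow> u x \<le> u y + \<eta> + slope L * dist x y"
    and "\<And>x. x \<in> Y \<Longrightarrow> u x = F x"
proof -
  have step: "0 < R / 2 ^ n" "R / 2 ^ n \<le> R" if "0 < R" for R :: real and n :: nat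
    using that by (auto simp: field_simps)
  have step0: "(\<lambda>n. R / 2 ^ n) \<longlonglongrightarrow> 0" for R :: real
    using LIMSEQ_divide_realpow_zero[of 2 R] by simp
  have split: "\<bar>U (R / 2 ^ N) x - U (R / 2 ^ n) x\<bar> \<le> E"
    if R: "0 < R" "R \<le> 1" and "N \<le> n" "step_error (R / 2 ^ N) E" for R N n E x
  proof -
    have "R / 2 ^ n = R / 2 ^ N / real (2 ^ (n - N))"
      using that(3) by (simp add: power_add[symmetric] field_simps)
    moreover have "R / 2 ^ N \<le> 1" using step(2)[OF R(1), of N] R(2) by linarith
    ultimately show ?thesis
      using U_step_error[OF step(1)[OF R(1)] _ that(4), of "2 ^ (n - N)" x] by (simp only: zero_less_power zero_less_numeral)
  qed
  have small_step: "\<exists>N E. E \<le> \<theta> \<and> step_error (R / 2 ^ N) E" if R: "0 < R" and "0 < \<theta>" for R \<theta> :: real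
  proof -
    obtain r where r: "0 < r" "\<And>R. 0 < R \<Longrightarrow> R < r \<Longrightarrow> \<exists>E\<le>\<theta>. step_error R E" using small[OF \<open>0 < \<theta>\<close>] by blast
    have "\<forall>\<^sub>F n in sequentially. R / 2 ^ n < r" by (rule order_tendstoD(2)[OF step0 r(1)])
    then obtain N where "R / 2 ^ N < r" by (auto simp: eventually_sequentially)
    then show ?thesis using r(2)[OF step(1)[OF R]] by blast
  qed
  \<comment> \<open>One limit for each initial step \<open>R\<close>; their independence of
    \<open>R\<close> is proved afterwards.\<close>
  define w where "w R x = lim (\<lambda>n. U (R / 2 ^ n) x)" for R x
  have w: "(\<lambda>n. U (R / 2 ^ n) x) \<longlonglongrightarrow> w R x" if R: "0 < R" "R \<le> 1" for R x
  proof -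
    have "Cauchy (\<lambda>n. U (R / 2 ^ n) x)"
    proof (rule CauchyI')
      fix \<theta> :: real assume "0 < \<theta>"
      then obtain N E where E: "E \<le> \<theta> / 4" "step_error (R / 2 ^ N) E" using small_step[OF R(1), of "\<theta> / 4"] by auto
      have "dist (U (R / 2 ^ i) x) (U (R / 2 ^ j) x) < \<theta>" if "N \<le> i" "i < j" for i j
        using split[OF R _ E(2), of i x] split[OF R _ E(2), of j x] that E(1) \<open>0 < \<theta>\<close> by (simp add: dist_real_def abs_le_iff abs_less_iff)
      then show "\<exists>N. \<forall>i\<ge>N. \<forall>j>i. dist (U (R / 2 ^ i) x) (U (R / 2 ^ j) x) < \<theta>" by blast
    qed
    then show ?thesis unfolding w_def by (simp add: Cauchy_convergent_iff convergent_LIMSEQ_iff)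
  qed
  have w_unif: "\<bar>U (R / 2 ^ N) x - w R x\<bar> \<le> E" if R: "0 < R" "R \<le> 1" and E: "step_error (R / 2 ^ N) E" for R N E x
  proof (rule LIMSEQ_le_const2)
    show "(\<lambda>n. \<bar>U (R / 2 ^ N) x - U (R / 2 ^ n) x\<bar>) \<longlonglongrightarrow> \<bar>U (R / 2 ^ N) x - w R x\<bar>"
      by (intro tendsto_intros w R)
  qed (use split[OF R _ E] in blast)
  \<comment> \<open>\<open>R\<close> need not be a multiple of the step \<open>eps\<close>, so
    concavity of \<open>U eps\<close> is used at the largest multiple \<open>k * eps\<close> not
    exceeding \<open>R\<close>.\<close>
  have conc: "concave_at Y f (w R0) R" if R0: "0 < R0" "R0 \<le> 1" and R: "0 < R" for R0 R
    unfolding concave_at_def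
  proof (intro allI impI ballI)
    fix x p and g \<theta> :: real
    assume int: "\<forall>z\<in>ball x (2 * R). z \<notin> Y \<and> g \<le> f z" and p: "p \<in> ball x R" and \<theta>: "0 < \<theta>"
    obtain r where r: "0 < r" "\<And>R. 0 < R \<Longrightarrow> R < r \<Longrightarrow> \<exists>E\<le>\<theta> / 16. step_error R E"
      using small[of "\<theta> / 16"] \<theta> by auto
    \<comment> \<open>Three demands on the step: uniform closeness to the limit, \<open>p\<close>
      still inside the slightly smaller ball, and a small change of the quadratic payoff
      term.\<close>
    define r' where "r' = Min {r, R - dist x p, \<theta> / (8 * (R * \<bar>g\<bar> + 1))}"
    have "0 < R * \<bar>g\<bar> + 1" using R by (intro add_nonneg_pos) auto
    then have "0 < r'" using r(1) p \<theta> by (simp add: r'_def)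
    have "\<forall>\<^sub>F n in sequentially. R0 / 2 ^ n < r'" by (rule order_tendstoD(2)[OF step0 \<open>0 < r'\<close>])
    then obtain n where n: "R0 / 2 ^ n < r'" by (auto simp: eventually_sequentially)
    define eps where "eps = R0 / 2 ^ n"
    have eps: "0 < eps" "eps \<le> 1" using step[OF R0(1), of n] R0(2) unfolding eps_def by linarith+
    have eps_lt: "eps < r" "eps < R - dist x p" "eps < \<theta> / (8 * (R * \<bar>g\<bar> + 1))"
      using n by (simp_all add: eps_def r'_def)
    obtain E where E: "E \<le> \<theta> / 16" "step_error eps E" using r(2)[OF eps(1) eps_lt(1)] by blast
    have close: "\<bar>U eps y - w R0 y\<bar> \<le> \<theta> / 16" for y
      using w_unif[OF R0 E(2)[unfolded eps_def], of y] E(1) by (simp add: eps_def)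
    define k where "k = nat \<lfloor>R / eps\<rfloor>"
    have "0 \<le> R / eps" using R eps by simp
    then have "real k \<le> R / eps" "R / eps < real k + 1" unfolding k_def by linarith+
    then have k: "real k * eps \<le> R" "R < real k * eps + eps" using eps by (auto simp: field_simps)
    have pk: "p \<in> ball x (real k * eps)" using k eps_lt(2) by simp
    then have "k \<noteq> 0" by (intro notI) simp
    then have "concave_at Y f (U eps) (real k * eps)" using concave_at_U[OF eps, of k] by simp
    moreover have "\<forall>z\<in>ball x (2 * (real k * eps)). z \<notin> Y \<and> g \<le> f z" using int k(1) by auto
    moreover have "0 < \<theta> / 8" using \<theta> by simp
    ultimately obtain p' where p': "p' \<in> ball x (2 * (real k * eps))"
      "U eps p' + U eps x + 2 * (real k * eps)\<^sup>2 * g \<le> 2 * U eps p + \<theta> / 8"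
      using pk unfolding concave_at_def by blast
    have "\<bar>(R\<^sup>2 - (real k * eps)\<^sup>2) * g\<bar> \<le> \<theta> / 4"
    proof -
      have "R\<^sup>2 - (real k * eps)\<^sup>2 = (R - real k * eps) * (R + real k * eps)" by (simp add: power2_eq_square algebra_simps)
      also have "\<dots> \<le> eps * (2 * R)" using k eps R by (intro mult_mono) auto
      finally have "\<bar>R\<^sup>2 - (real k * eps)\<^sup>2\<bar> \<le> eps * (2 * R)"
        using power_mono[OF k(1), of 2] eps by simp
      then have "\<bar>R\<^sup>2 - (real k * eps)\<^sup>2\<bar> * \<bar>g\<bar> \<le> eps * (2 * R) * \<bar>g\<bar>" by (intro mult_right_mono) auto
      also have "\<dots> = 2 * (eps * (R * \<bar>g\<bar>))" by simp
      also have "\<dots> \<le> 2 * (eps * (R * \<bar>g\<bar> + 1))" using eps by (intro mult_left_mono) auto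
      also have "\<dots> \<le> \<theta> / 4" using eps_lt(3) \<open>0 < R * \<bar>g\<bar> + 1\<close> by (simp add: field_simps)
      finally show ?thesis by (simp add: abs_mult)
    qed
    then have "(R\<^sup>2 - (real k * eps)\<^sup>2) * g \<le> \<theta> / 4" by (simp only: abs_le_iff)
    moreover have "2 * R\<^sup>2 * g = 2 * (real k * eps)\<^sup>2 * g + 2 * ((R\<^sup>2 - (real k * eps)\<^sup>2) * g)" by algebra
    ultimately have "2 * R\<^sup>2 * g \<le> 2 * (real k * eps)\<^sup>2 * g + \<theta> / 2" by linarith
    then have "w R0 p' + w R0 x + 2 * R\<^sup>2 * g \<le> 2 * w R0 p + \<theta>"
      using p'(2) close[of p'] close[of x] close[of p] \<theta> unfolding abs_le_iff by linarith
    then show "\<exists>p'\<in>ball x (2 * R). w R0 p' + w R0 x + 2 * R\<^sup>2 * g \<le> 2 * w R0 p + \<theta>"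
      using p'(1) k(1) by (intro bexI[of _ p']) auto
  qed
  have upper: "U R x \<le> w R0 x + E" if R: "0 < R" "R \<le> 1" and E: "step_error R E" and R0: "0 < R0" "R0 \<le> 1" for R E R0 x
  proof -
    have "\<forall>\<^sub>F n in sequentially. R0 / 2 ^ n < R" by (rule order_tendstoD(2)[OF step0 R(1)])
    then obtain N where N: "R0 / 2 ^ N < R" by (auto simp: eventually_sequentially)
    show ?thesis
    proof (rule U_le_concave_limit[OF R E conc[OF R0 R(1)], where eps = "\<lambda>n. R0 / 2 ^ (n + N)"])
      show "0 < R0 / 2 ^ (n + N)" for n using step(1)[OF R0(1)] .
      show "R0 / 2 ^ (n + N) \<le> R" for n
      proof -
        have "R0 / 2 ^ (n + N) = R0 / 2 ^ N / 2 ^ n" by (simp add: power_add mult.commute)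
        also have "\<dots> \<le> R0 / 2 ^ N" by (rule step(2)[OF step(1)[OF R0(1)]])
        finally show ?thesis using N by linarith
      qed
      show "(\<lambda>n. U (R0 / 2 ^ (n + N)) x) \<longlonglongrightarrow> w R0 x" for x
        using LIMSEQ_ignore_initial_segment[OF w[OF R0, of x], of N] by simp
    qed
  qed
  \<comment> \<open>A late member of one sequence is close to its own limit and nearly below the
    limit of the other; by symmetry the limits coincide.\<close>
  have le: "w R x \<le> w R' x" if R: "0 < R" "R \<le> 1" and R': "0 < R'" "R' \<le> 1" for R R' x
  proof (rule field_le_epsilon)
    fix \<theta> :: real assume "0 < \<theta>"
    then obtain N E where E: "E \<le> \<theta> / 2" "step_error (R / 2 ^ N) E" using small_step[OF R(1), of "\<theta> / 2"] by auto
    have "R / 2 ^ N \<le> 1" using step(2)[OF R(1), of N] R(2) by linarith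
    from upper[OF step(1)[OF R(1)] this E(2) R', of x] w_unif[OF R E(2), of x] E(1)
    show "w R x \<le> w R' x + \<theta>" unfolding abs_le_iff by linarith
  qed
  have w1: "w R x = w 1 x" if "0 < R" "R \<le> 1" for R x
    using le[OF that, of 1 x] le[of 1 R x] that by simp
  show thesis
  proof
    show "\<bar>U R x - w 1 x\<bar> \<le> E" if "0 < R" "R \<le> 1" "step_error R E" for R E x
      using w_unif[of R 0 E x] that w1[of R x] by simp
    have lim1: "(\<lambda>n. U (1 / 2 ^ n) x) \<longlonglongrightarrow> w 1 x" for x by (rule w) auto
    have step1: "0 < (1 :: real) / 2 ^ n" "(1 :: real) / 2 ^ n \<le> 1" for n :: nat using step[of 1 n] by auto
    show "w 1 x \<le> w 1 y + \<eta> + slope L * dist x y" if mod: "modulus_on Y F \<eta> L" for \<eta> L x y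
    proof (rule LIMSEQ_le[OF lim1])
      have "(\<lambda>n. U (1 / 2 ^ n) y + \<eta> + slope L * (dist y x + 2 * (1 / 2 ^ n)))
        \<longlonglongrightarrow> w 1 y + \<eta> + slope L * (dist y x + 2 * 0)"
        by (intro tendsto_intros lim1 step0)
      then show "(\<lambda>n. U (1 / 2 ^ n) y + \<eta> + slope L * (dist y x + 2 * (1 / 2 ^ n)))
        \<longlonglongrightarrow> w 1 y + \<eta> + slope L * dist x y" by (simp add: dist_commute)
      show "\<exists>N. \<forall>n\<ge>N. U (1 / 2 ^ n) x \<le> U (1 / 2 ^ n) y + \<eta> + slope L * (dist y x + 2 * (1 / 2 ^ n))"
        using U_near_lipschitz[OF mod step1] by blast
    qed
    show "w 1 x = F x" if "x \<in> Y" for x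
      using LIMSEQ_unique[OF lim1[of x]] U_boundary[OF step1 that] by simp
  qed
qed

end

section \<open>Exchanging the players\<close>

definition flip :: "'a history \<Rightarrow> 'a history" where
  "flip h = (fst h, map (\<lambda>(b, y). (\<not> b, y)) (snd h))"

lemma positions_flip [simp]: "positions (flip h) = positions h"
  by (simp add: positions_def flip_def split_def o_def)

lemma position_flip [simp]: "position (flip h) = position h"
  by (simp add: position_def)

lemma flip_flip [simp]: "flip (flip h) = h"
  by (simp add: flip_def split_def o_def)

text \<open>Reversing tosses and signs swaps the positive and negative parts of the payoff, and
  takes the default value \<open>-\<infinity>\<close> to the negative of the default value
  \<open>\<infinity>\<close>.\<close>

lemma F_minus_flip:
  "F_minus Y F f eps x S1 S2 = - F_plus Y (\<lambda>x. - F x) (\<lambda>x. - f x) eps x (S2 \<circ> flip) (S1 \<circ> flip)"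
proof -
  define q where "q = play Y (S2 \<circ> flip) (S1 \<circ> flip) (x, [])"
  have "inj flip" by (metis injI flip_flip)
  then have "play Y S1 S2 (flip (x, [])) = map_spmf flip q"
    unfolding q_def by (rule play_transport[where fl = True]) (auto simp: flip_def extend_def position_def positions_def split_def o_def)
  then have p: "play Y S1 S2 (x, []) = map_spmf flip q" by (simp add: flip_def)
  have payoff: "payoff (\<lambda>x. - F x) (\<lambda>x. - f x) eps h = - payoff F f eps h" "payoff F f eps (flip h) = payoff F f eps h" for h
  proof -
    have "(\<Sum>x\<leftarrow>xs. - f x) = - (\<Sum>x\<leftarrow>xs. f x)" for xs by (induction xs) auto
    then show "payoff (\<lambda>x. - F x) (\<lambda>x. - f x) eps h = - payoff F f eps h" by (simp add: payoff_def)
  qed (simp add: payoff_def)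
  have pos: "expect_pos (map_spmf flip q) (payoff F f eps) = expect_neg q (payoff (\<lambda>x. - F x) (\<lambda>x. - f x) eps)"
    and neg: "expect_neg (map_spmf flip q) (payoff F f eps) = expect_pos q (payoff (\<lambda>x. - F x) (\<lambda>x. - f x) eps)"
    by (simp_all add: expect_pos_def expect_neg_def payoff measure_map_spmf nn_integral_distr comp_def)
  have has: "has_expectation (map_spmf flip q) (payoff F f eps) = has_expectation q (payoff (\<lambda>x. - F x) (\<lambda>x. - f x) eps)"
    unfolding has_expectation_def pos neg by auto
  have ex: "expectation (map_spmf flip q) (payoff F f eps) = - expectation q (payoff (\<lambda>x. - F x) (\<lambda>x. - f x) eps)"
    if "has_expectation q (payoff (\<lambda>x. - F x) (\<lambda>x. - f x) eps)"
    using that unfolding expectation_def pos neg has_expectation_def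
    by (cases "expect_pos q (payoff (\<lambda>x. - F x) (\<lambda>x. - f x) eps)" rule: ennreal_cases;
        cases "expect_neg q (payoff (\<lambda>x. - F x) (\<lambda>x. - f x) eps)" rule: ennreal_cases) auto
  show ?thesis unfolding F_minus_def F_plus_def Let_def p q_def[symmetric] has using ex by simp
qed

context moves
begin

lemma flip_mem: "T \<in> \<S> eps \<Longrightarrow> T \<circ> flip \<in> \<S> eps"
  unfolding S
proof (intro CollectI allI)
  fix h assume "T \<in> {S. \<forall>h. S h \<in> A (position h)}"
  then have "T (flip h) \<in> A (position (flip h))" by blast
  then show "(T \<circ> flip) h \<in> A (position h)" by simp
qed

lemma flip_image: "(\<lambda>T. T \<circ> flip) ` \<S> eps = \<S> eps"
proof
  show "\<S> eps \<subseteq> (\<lambda>T. T \<circ> flip) ` \<S> eps"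
  proof
    fix T assume "T \<in> \<S> eps"
    then show "T \<in> (\<lambda>T. T \<circ> flip) ` \<S> eps"
      by (intro image_eqI[of _ _ "T \<circ> flip"] flip_mem) (auto simp: fun_eq_iff)
  qed
qed (use flip_mem in auto)

lemma SUP_flip: "(SUP T\<in>\<S> eps. g (T \<circ> flip)) = (SUP T\<in>\<S> eps. g T :: ereal)"
  and INF_flip: "(INF T\<in>\<S> eps. g (T \<circ> flip)) = (INF T\<in>\<S> eps. g T :: ereal)"
proof -
  have "(\<lambda>T. g (T \<circ> flip)) ` \<S> eps = g ` (\<lambda>T. T \<circ> flip) ` \<S> eps" by (simp only: image_image)
  then show "(SUP T\<in>\<S> eps. g (T \<circ> flip)) = (SUP T\<in>\<S> eps. g T)" "(INF T\<in>\<S> eps. g (T \<circ> flip)) = (INF T\<in>\<S> eps. g T)"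
    by (simp_all only: flip_image)
qed

lemma value_I_flip: "value_I \<S> Y F f eps x = - value_II \<S> Y (\<lambda>x. - F x) (\<lambda>x. - f x) eps x"
proof -
  let ?P = "F_plus Y (\<lambda>x. - F x) (\<lambda>x. - f x) eps x"
  have "value_I \<S> Y F f eps x = (SUP S1\<in>\<S> eps. INF S2\<in>\<S> eps. - ?P (S2 \<circ> flip) (S1 \<circ> flip))"
    by (simp only: value_I_def F_minus_flip)
  also have "\<dots> = - (INF S1\<in>\<S> eps. SUP S2\<in>\<S> eps. ?P (S2 \<circ> flip) (S1 \<circ> flip))"
    by (simp only: ereal_INF_uminus_eq ereal_SUP_uminus_eq)
  also have "(INF S1\<in>\<S> eps. SUP S2\<in>\<S> eps. ?P (S2 \<circ> flip) (S1 \<circ> flip)) = (INF S1\<in>\<S> eps. SUP S2\<in>\<S> eps. ?P S2 (S1 \<circ> flip))"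
    by (intro INF_cong refl) (rule SUP_flip)
  also have "\<dots> = (INF S1\<in>\<S> eps. SUP S2\<in>\<S> eps. ?P S2 S1)" by (rule INF_flip)
  finally show ?thesis by (simp add: value_II_def)
qed

lemma value_II_flip: "value_II \<S> Y F f eps x = - value_I \<S> Y (\<lambda>x. - F x) (\<lambda>x. - f x) eps x"
  by (simp add: value_I_flip)

text \<open>Play cannot leave \<open>G\<close> before it stops, so running payoffs are collected
  only in \<open>G\<close> outside \<open>Y\<close>. This serves to replace \<open>f\<close> by
  \<open>\<bar>f\<bar>\<close> or \<open>- f\<close> by \<open>\<bar>f\<bar>\<close> on a set where
  the sign is constant.\<close>

lemma F_cong:
  assumes x: "x \<in> G" and G: "\<And>x y. x \<in> G \<Longrightarrow> x \<notin> Y \<Longrightarrow> y \<in> ball x eps \<Longrightarrow> y \<in> G"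
    and f: "\<And>x. x \<in> G \<Longrightarrow> x \<notin> Y \<Longrightarrow> f x = f' x" and S12: "S1 \<in> \<S> eps" "S2 \<in> \<S> eps"
  shows "F_minus Y F f eps x S1 S2 = F_minus Y F f' eps x S1 S2" (is ?A)
    and "F_plus Y F f eps x S1 S2 = F_plus Y F f' eps x S1 S2" (is ?B)
proof -
  let ?p = "play Y S1 S2 (x, [])"
  have "payoff F f eps h = payoff F f' eps h" if h: "h \<in> set_spmf ?p" for h
  proof -
    have "((\<forall>y\<in>set (butlast (positions h)). y \<in> G \<and> y \<notin> Y) \<and> position h \<in> G) \<and> position h \<in> Y"
    proof (rule play_invariant[OF _ _ h])
      show "(\<forall>y\<in>set (butlast (positions (x, []))). y \<in> G \<and> y \<notin> Y) \<and> position (x, []) \<in> G"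
        using x by (simp add: positions_def)
      fix h b y
      assume "(\<forall>y\<in>set (butlast (positions h)). y \<in> G \<and> y \<notin> Y) \<and> position h \<in> G" "position h \<notin> Y"
        and "y \<in> set_pmf ((if b then S1 else S2) h)"
      moreover from this have "y \<in> ball (position h) eps"
        using mem_legal[OF S12(1), of h] mem_legal[OF S12(2), of h] by (auto split: if_splits)
      ultimately show "(\<forall>y\<in>set (butlast (positions (extend h b y))). y \<in> G \<and> y \<notin> Y) \<and> position (extend h b y) \<in> G"
        using G by (auto simp: butlast_positions_extend)
    qed
    then have "map f (butlast (positions h)) = map f' (butlast (positions h))" using f by auto
    then show ?thesis by (simp only: payoff_def)
  qed
  then have "expect_pos ?p (payoff F f eps) = expect_pos ?p (payoff F f' eps)"
    "expect_neg ?p (payoff F f eps) = expect_neg ?p (payoff F f' eps)"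
    unfolding expect_pos_def expect_neg_def by (auto intro!: nn_integral_cong_AE simp: AE_measure_spmf_iff)
  then show ?A ?B
    unfolding F_minus_def F_plus_def has_expectation_def expectation_def Let_def by (simp_all only:)
qed

lemma value_cong:
  assumes "x \<in> G" and "\<And>x y. x \<in> G \<Longrightarrow> x \<notin> Y \<Longrightarrow> y \<in> ball x eps \<Longrightarrow> y \<in> G"
    and "\<And>x. x \<in> G \<Longrightarrow> x \<notin> Y \<Longrightarrow> f x = f' x"
  shows "value_I \<S> Y F f eps x = value_I \<S> Y F f' eps x" and "value_II \<S> Y F f eps x = value_II \<S> Y F f' eps x"
proof -
  note cong = F_cong[of x G Y f f', OF assms]
  show "value_I \<S> Y F f eps x = value_I \<S> Y F f' eps x"
    unfolding value_I_def by (intro SUP_cong INF_cong refl cong(1))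
  show "value_II \<S> Y F f eps x = value_II \<S> Y F f' eps x"
    unfolding value_II_def by (intro SUP_cong INF_cong refl cong(2))
qed

end

lemma pure_moves:
  assumes "0 < eps"
  shows "moves (pure_strategies :: real \<Rightarrow> 'a::metric_space strategy set) eps (\<lambda>x. return_pmf ` ball x eps)"
proof
  show "(pure_strategies eps :: 'a strategy set) = {S. \<forall>h. S h \<in> return_pmf ` ball (position h) eps}" (is "_ = ?R")
  proof
    show "?R \<subseteq> pure_strategies eps"
    proof
      fix S :: "'a strategy" assume "S \<in> ?R"
      then have "\<forall>h. \<exists>y. y \<in> ball (position h) eps \<and> S h = return_pmf y" by blast
      then obtain \<sigma> where "\<forall>h. \<sigma> h \<in> ball (position h) eps \<and> S h = return_pmf (\<sigma> h)" by metis
      then show "S \<in> pure_strategies eps" unfolding pure_strategies_def by (intro CollectI exI[of _ \<sigma>]) blast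
    qed
  qed (auto simp: pure_strategies_def)
qed (use assms in auto)

lemma random_moves: "0 < eps \<Longrightarrow> moves random_strategies eps (\<lambda>x. {\<mu>. set_pmf \<mu> \<subseteq> ball x eps})"
  by unfold_locales (auto simp: random_strategies_def)

section \<open>The continuum value\<close>

text \<open>Interpolation cuts a distance \<open>d\<close> into at most
  \<open>d / \<delta> + 1\<close> pieces shorter than \<open>\<delta>\<close>, each costing
  \<open>\<eta>\<close>; hence \<open>L = \<eta> / \<delta>\<close>. The intermediate points may
  leave \<open>Y\<close>, which is why the extension \<open>G\<close> enters.\<close>

lemma uniformly_continuous_modulus:
  fixes G :: "'a::metric_space \<Rightarrow> real"
  assumes ip: "interpolating TYPE('a)" and G: "uniformly_continuous_on UNIV G" and eq: "\<And>y. y \<in> Y \<Longrightarrow> G y = F y"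
    and \<eta>: "0 < \<eta>"
  shows "\<exists>L. modulus_on Y F \<eta> L"
proof -
  obtain \<delta> where \<delta>: "0 < \<delta>" "\<And>x y. dist x y < \<delta> \<Longrightarrow> dist (G x) (G y) < \<eta>"
    using G \<eta> unfolding uniformly_continuous_on_def by (metis UNIV_I dist_commute)
  have chain: "G x \<le> G y + real (Suc n) * \<eta>" if "dist x y < real (Suc n) * \<delta>" for n x y
    using that
  proof (induction n arbitrary: x)
    case 0
    then show ?case using \<delta>(2)[of x y] by (auto simp: dist_real_def)
  next
    case (Suc n)
    have "dist x y < \<delta> + real (Suc n) * \<delta>" using Suc(2) by (simp add: algebra_simps)
    then obtain w where "dist x w < \<delta>" "dist w y < real (Suc n) * \<delta>"
      using interpolatingD[OF ip \<delta>(1), of "real (Suc n) * \<delta>" x y] \<delta>(1) by auto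
    then have "G x < G w + \<eta>" "G w \<le> G y + real (Suc n) * \<eta>"
      using \<delta>(2)[of x w] Suc(1)[of w] by (auto simp: dist_real_def)
    then show ?case by (simp add: algebra_simps)
  qed
  have "F x \<le> F y + \<eta> + \<eta> / \<delta> * dist x y" if "x \<in> Y" "y \<in> Y" for x y
  proof -
    define n where "n = nat \<lfloor>dist x y / \<delta>\<rfloor>"
    have "0 \<le> dist x y / \<delta>" using \<delta>(1) by simp
    then have n: "real n \<le> dist x y / \<delta>" "dist x y / \<delta> < real (Suc n)" unfolding n_def by linarith+
    then have "dist x y < real (Suc n) * \<delta>" using \<delta>(1) by (simp add: field_simps)
    then have "G x \<le> G y + real (Suc n) * \<eta>" by (rule chain)
    also have "real (Suc n) * \<eta> \<le> (dist x y / \<delta> + 1) * \<eta>" using n(1) \<eta> by (intro mult_right_mono) auto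
    finally show ?thesis using that eq by (simp add: algebra_simps)
  qed
  then show ?thesis using \<eta> \<delta>(1) unfolding modulus_on_def by (intro exI[of _ "\<eta> / \<delta>"]) auto
qed

lemma lipschitz_modulus: "L-lipschitz_on Y F \<Longrightarrow> modulus_on Y F 0 L"
  unfolding modulus_on_def lipschitz_on_def dist_real_def by (auto simp: abs_le_iff algebra_simps)

text \<open>The analytic part of the theorem with the game left out and sup norms written as bounds
  uniform in \<open>x\<close>; in this form the limits for the two signs of \<open>f\<close> can be
  glued.\<close>

definition regular_limit :: "'a::metric_space set \<Rightarrow> ('a \<Rightarrow> real) \<Rightarrow> ('a \<Rightarrow> real) \<Rightarrow> (real \<Rightarrow> 'a \<Rightarrow> real) \<Rightarrow> ('a \<Rightarrow> real) \<Rightarrow> bool" where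
  "regular_limit Y F f V u \<longleftrightarrow>
     (\<forall>\<theta>>0. \<exists>r>0. \<forall>eps x. 0 < eps \<longrightarrow> eps < r \<longrightarrow> \<bar>V eps x - u x\<bar> \<le> \<theta>) \<and>
     uniformly_continuous_on UNIV u \<and> (\<forall>x\<in>Y. u x = F x) \<and>
     (is_lipschitz_on Y F \<longrightarrow> is_lipschitz_on UNIV u) \<and>
     (is_lipschitz_on Y F \<longrightarrow> is_lipschitz_on (- Y) f \<longrightarrow>
       (\<exists>C. \<exists>r>0. \<forall>eps x. 0 < eps \<longrightarrow> eps < r \<longrightarrow> \<bar>V eps x - u x\<bar> \<le> C * eps))"

lemma regular_limitD:
  assumes "regular_limit Y F f V u"
  shows "\<And>\<theta>. 0 < \<theta> \<Longrightarrow> \<exists>r>0. \<forall>eps x. 0 < eps \<longrightarrow> eps < r \<longrightarrow> \<bar>V eps x - u x\<bar> \<le> \<theta>"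
    and "uniformly_continuous_on UNIV u" and "\<And>x. x \<in> Y \<Longrightarrow> u x = F x"
    and "is_lipschitz_on Y F \<Longrightarrow> is_lipschitz_on UNIV u"
    and "is_lipschitz_on Y F \<Longrightarrow> is_lipschitz_on (- Y) f \<Longrightarrow>
      \<exists>C. \<exists>r>0. \<forall>eps x. 0 < eps \<longrightarrow> eps < r \<longrightarrow> \<bar>V eps x - u x\<bar> \<le> C * eps"
  using assms unfolding regular_limit_def by auto

lemma limit_of_least_super:
  fixes Y :: "'a::metric_space set"
  assumes ip: "interpolating TYPE('a)" and Y: "Y \<noteq> {}" and F: "\<And>x. x \<in> Y \<Longrightarrow> m \<le> F x"
    and mod: "\<And>\<eta>. 0 < \<eta> \<Longrightarrow> \<exists>L. modulus_on Y F \<eta> L"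
    and f: "(\<forall>x\<in>-Y. f x = 0) \<or> ((\<exists>c>0. \<forall>x\<in>-Y. c \<le> f x) \<and> uniformly_continuous_on (- Y) f \<and>
       (\<exists>K. \<forall>x\<in>-Y. f x \<le> K) \<and> bounded (UNIV :: 'a set))"
  shows "\<exists>u. regular_limit Y F f (least_super Y F f m) u \<and> (\<forall>eps. 0 < eps \<longrightarrow> eps \<le> 1 \<longrightarrow> (\<exists>v. supersol Y F f m eps v))"
proof -
  have "\<exists>K D. tug Y F f m K D"
    using f
  proof
    assume "\<forall>x\<in>-Y. f x = 0"
    then have "tug Y F f m 0 0" using ip Y F mod[of 1] by unfold_locales auto
    then show ?thesis by blast
  next
    assume *: "(\<exists>c>0. \<forall>x\<in>-Y. c \<le> f x) \<and> uniformly_continuous_on (- Y) f \<and>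
       (\<exists>K. \<forall>x\<in>-Y. f x \<le> K) \<and> bounded (UNIV :: 'a set)"
    then obtain c where c: "0 < c" "\<And>x. x \<notin> Y \<Longrightarrow> c \<le> f x" by blast
    from * obtain K where K: "\<And>x. x \<notin> Y \<Longrightarrow> f x \<le> K" by blast
    from * obtain D where D: "\<And>x y :: 'a. dist x y \<le> D" by (auto simp: bounded_two_points)
    have "0 \<le> D" using D[of undefined undefined] by simp
    have "0 \<le> f x" if "x \<notin> Y" for x using c(2)[OF that] c(1) by simp
    then have "tug Y F f m (max 0 K) D"
      using ip Y F mod[of 1] K D \<open>0 \<le> D\<close> by unfold_locales (auto simp: le_max_iff_disj intro!: mult_left_mono)
    then show ?thesis by blast
  qed
  then obtain K D where "tug Y F f m K D" by blast
  then interpret tug Y F f m K D .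
  \<comment> \<open>A bound on \<open>U\<close> matters only where \<open>\<kappa> > 0\<close>; in
    that case the diameter is finite and the upper cone bound supplies it.\<close>
  obtain Mx where Mx: "0 \<le> Mx" "\<And>eps x. (\<forall>x\<in>-Y. f x = 0) \<or> (0 < eps \<longrightarrow> eps \<le> 1 \<longrightarrow> U eps x - m \<le> Mx)"
  proof (cases "\<forall>x\<in>-Y. f x = 0")
    case False
    then obtain d where d: "\<And>x y :: 'a. dist x y \<le> d" using f by (auto simp: bounded_two_points)
    obtain y where y: "y \<in> Y" using Y by blast
    obtain L where L: "modulus_on Y F 1 L" using mod[of 1] by auto
    then have sl: "0 \<le> slope L" by (auto simp: modulus_on_def intro: slope_nonneg)
    have "U eps x - m \<le> max 0 (F y + 1 + slope L * (d + 1) - m)" if "0 < eps" "eps \<le> 1" for eps x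
    proof -
      have "U eps x \<le> F y + 1 + slope L * (dist x y + eps)" by (rule U_upper[OF L y that])
      also have "\<dots> \<le> F y + 1 + slope L * (d + 1)" using d[of x y] that sl by (intro add_left_mono mult_left_mono) auto
      finally show ?thesis by simp
    qed
    then show thesis by (intro that[of "max 0 (F y + 1 + slope L * (d + 1) - m)"]) auto
  qed (use that[of 0] in auto)
  have error: "step_error R (2 * \<eta> + 7 * slope L * R + 2 * (\<kappa> * Mx))"
    if "modulus_on Y F \<eta> L" and \<kappa>: "0 \<le> \<kappa>" "\<kappa> \<le> 1 / 2" "rel_modulus \<kappa> (2 * R)"
      and \<kappa>0: "(\<forall>x\<in>-Y. f x = 0) \<longrightarrow> \<kappa> = 0" for R \<eta> L \<kappa>
    unfolding step_error_def
  proof (intro exI conjI allI impI)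
    show "\<kappa> * (U eps x - m) \<le> \<kappa> * Mx" if "0 < eps" "eps \<le> 1" for eps x
      using Mx(2)[of eps x] that \<kappa> \<kappa>0 by (cases "\<forall>x\<in>-Y. f x = 0") (auto intro!: mult_left_mono)
  qed (use that in auto)
  have rel0: "rel_modulus 0 r" if "\<forall>x\<in>-Y. f x = 0" for r using that by (auto simp: rel_modulus_def)
  have rel: "rel_modulus \<kappa> r" if c: "\<forall>x\<in>-Y. c \<le> f x" and \<kappa>: "0 \<le> \<kappa>"
    and d: "\<And>x z. x \<notin> Y \<Longrightarrow> z \<notin> Y \<Longrightarrow> dist x z < r \<Longrightarrow> f x - f z \<le> \<kappa> * c" for \<kappa> c r
    unfolding rel_modulus_def
  proof (intro allI impI)
    fix x z assume xz: "x \<notin> Y" "z \<notin> Y" "dist x z < r"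
    have "\<kappa> * c \<le> \<kappa> * f x" using c xz \<kappa> by (intro mult_left_mono) auto
    then show "(1 - \<kappa>) * f x \<le> f z" using d[OF xz] by (simp add: algebra_simps)
  qed
  have small: "\<exists>r>0. \<forall>R. 0 < R \<longrightarrow> R < r \<longrightarrow> (\<exists>E\<le>\<theta>. step_error R E)" if \<theta>: "0 < \<theta>" for \<theta>
  proof -
    \<comment> \<open>The error \<open>\<theta>\<close> is spent in thirds:
      \<open>2 * (\<theta> / 6)\<close> on the modulus of \<open>F\<close>,
      \<open>7 * (\<theta> / 21)\<close> on the slope and \<open>2 * (\<theta> / 6)\<close> on
      scaling.\<close>
    obtain L where L: "modulus_on Y F (\<theta> / 6) L" using mod[of "\<theta> / 6"] \<theta> by auto
    then have sl: "0 \<le> slope L" by (auto simp: modulus_on_def intro: slope_nonneg)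
    have "\<exists>\<kappa> r. 0 \<le> \<kappa> \<and> \<kappa> \<le> 1 / 2 \<and> \<kappa> * Mx \<le> \<theta> / 6 \<and> 0 < r \<and> (\<forall>R<r. rel_modulus \<kappa> (2 * R)) \<and>
        ((\<forall>x\<in>-Y. f x = 0) \<longrightarrow> \<kappa> = 0)"
    proof (cases "\<forall>x\<in>-Y. f x = 0")
      case True
      then show ?thesis using rel0 \<theta> by (intro exI[of _ 0] exI[of _ 1]) auto
    next
      case False
      then obtain c where c: "0 < c" "\<forall>x\<in>-Y. c \<le> f x" and uc: "uniformly_continuous_on (- Y) f" using f by auto
      define \<kappa> where "\<kappa> = min (1 / 2) (\<theta> / (6 * (Mx + 1)))"
      have "0 < \<kappa>" using \<theta> Mx(1) by (simp add: \<kappa>_def)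
      moreover have "\<kappa> \<le> 1 / 2" unfolding \<kappa>_def by (rule min.cobounded1)
      ultimately have \<kappa>: "0 < \<kappa>" "\<kappa> \<le> 1 / 2" .
      have "\<kappa> * Mx \<le> \<theta> / (6 * (Mx + 1)) * (Mx + 1)"
        using Mx(1) \<kappa> \<theta> by (intro mult_mono) (auto simp: \<kappa>_def)
      also have "\<dots> = \<theta> / 6" using Mx(1) by (simp add: divide_simps)
      finally have \<kappa>M: "\<kappa> * Mx \<le> \<theta> / 6" .
      have "0 < \<kappa> * c" using \<kappa> c by simp
      then obtain \<delta> where \<delta>: "0 < \<delta>" "\<And>x z. x \<in> -Y \<Longrightarrow> z \<in> -Y \<Longrightarrow> dist z x < \<delta> \<Longrightarrow> dist (f z) (f x) < \<kappa> * c"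
        using uc unfolding uniformly_continuous_on_def by meson
      have "rel_modulus \<kappa> (2 * R)" if "R < \<delta> / 2" for R
      proof (rule rel[OF c(2)])
        fix x z assume "x \<notin> Y" "z \<notin> Y" "dist x z < 2 * R"
        then show "f x - f z \<le> \<kappa> * c" using \<delta>(2)[of z x] that by (simp add: dist_real_def)
      qed (use \<kappa> in simp)
      then show ?thesis using \<kappa> \<kappa>M \<delta>(1) False by (intro exI[of _ \<kappa>] exI[of _ "\<delta> / 2"]) auto
    qed
    then obtain \<kappa> r where \<kappa>: "0 \<le> \<kappa>" "\<kappa> \<le> 1 / 2" "\<kappa> * Mx \<le> \<theta> / 6" and r: "0 < r" "\<And>R. R < r \<Longrightarrow> rel_modulus \<kappa> (2 * R)"
      and \<kappa>0: "(\<forall>x\<in>-Y. f x = 0) \<longrightarrow> \<kappa> = 0" by blast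
    define r' where "r' = min r (\<theta> / (21 * (slope L + 1)))"
    have "0 < r'" using r(1) \<theta> sl by (simp add: r'_def)
    moreover have "\<exists>E\<le>\<theta>. step_error R E" if R: "0 < R" "R < r'" for R
    proof (intro exI conjI)
      have "slope L * R \<le> (slope L + 1) * (\<theta> / (21 * (slope L + 1)))"
        using R sl by (intro mult_mono) (auto simp: r'_def)
      also have "\<dots> = \<theta> / 21" using sl by (simp add: divide_simps)
      finally show "2 * (\<theta> / 6) + 7 * slope L * R + 2 * (\<kappa> * Mx) \<le> \<theta>" using \<kappa>(3) by linarith
      show "step_error R (2 * (\<theta> / 6) + 7 * slope L * R + 2 * (\<kappa> * Mx))"
        by (rule error[OF L \<kappa>(1,2) r(2) \<kappa>0]) (use R in \<open>auto simp: r'_def\<close>)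
    qed
    ultimately show ?thesis by blast
  qed
  obtain u where u: "\<And>R E x. 0 < R \<Longrightarrow> R \<le> 1 \<Longrightarrow> step_error R E \<Longrightarrow> \<bar>U R x - u x\<bar> \<le> E"
    "\<And>\<eta> L x y. modulus_on Y F \<eta> L \<Longrightarrow> u x \<le> u y + \<eta> + slope L * dist x y" "\<And>x. x \<in> Y \<Longrightarrow> u x = F x"
    using U_converges[OF small] by blast
  show ?thesis
    unfolding regular_limit_def
  proof (rule exI[of _ u], intro conjI allI impI ballI)
    show "\<exists>r>0. \<forall>eps x. 0 < eps \<longrightarrow> eps < r \<longrightarrow> \<bar>U eps x - u x\<bar> \<le> \<theta>" if \<theta>: "0 < \<theta>" for \<theta>
    proof -
      obtain r where r: "0 < r" "\<And>R. 0 < R \<Longrightarrow> R < r \<Longrightarrow> \<exists>E\<le>\<theta>. step_error R E" using small[OF \<theta>] by blast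
      have "\<bar>U eps x - u x\<bar> \<le> \<theta>" if "0 < eps" "eps < min r 1" for eps x
        using r(2)[of eps] u(1)[of eps _ x] that by (auto intro: order_trans)
      then show ?thesis using r(1) by (intro exI[of _ "min r 1"]) auto
    qed
    show "uniformly_continuous_on UNIV u"
      unfolding uniformly_continuous_on_def
    proof (intro allI impI)
      fix e :: real assume e: "0 < e"
      obtain L where L: "modulus_on Y F (e / 2) L" using mod[of "e / 2"] e by auto
      then have sl: "0 \<le> slope L" by (auto simp: modulus_on_def intro: slope_nonneg)
      define d where "d = e / (2 * (slope L + 1))"
      have d: "0 < d" using e sl by (simp add: d_def)
      have "dist (u y) (u x) < e" if "dist y x < d" for x y
      proof -
        have "slope L * dist y x \<le> slope L * d" using that sl by (intro mult_left_mono) auto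
        also have "\<dots> < (slope L + 1) * d" using d by simp
        also have "\<dots> = e / 2" using sl by (simp add: d_def divide_simps)
        finally show ?thesis using u(2)[OF L, of x y] u(2)[OF L, of y x] by (simp add: dist_real_def dist_commute abs_less_iff)
      qed
      then show "\<exists>d>0. \<forall>x\<in>UNIV. \<forall>y\<in>UNIV. dist y x < d \<longrightarrow> dist (u y) (u x) < e" using d by blast
    qed
    show "u x = F x" if "x \<in> Y" for x using that by (rule u(3))
    show "is_lipschitz_on UNIV u" if "is_lipschitz_on Y F"
    proof -
      obtain L where L: "L-lipschitz_on Y F" using \<open>is_lipschitz_on Y F\<close> unfolding is_lipschitz_on_def by blast
      have "0 \<le> slope L" by (rule slope_nonneg) (rule lipschitz_on_nonneg[OF L])
      then have "(slope L)-lipschitz_on UNIV u"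
      proof (intro lipschitz_onI)
        show "dist (u x) (u y) \<le> slope L * dist x y" for x y
          using u(2)[OF lipschitz_modulus[OF L], of x y] u(2)[OF lipschitz_modulus[OF L], of y x]
          by (simp add: dist_real_def abs_le_iff dist_commute)
      qed
      then show ?thesis unfolding is_lipschitz_on_def by blast
    qed
    show "\<exists>C. \<exists>r>0. \<forall>eps x. 0 < eps \<longrightarrow> eps < r \<longrightarrow> \<bar>U eps x - u x\<bar> \<le> C * eps"
      if lip: "is_lipschitz_on Y F" "is_lipschitz_on (- Y) f"
    proof -
      obtain L Lf where L: "L-lipschitz_on Y F" and Lf: "Lf-lipschitz_on (- Y) f" using lip unfolding is_lipschitz_on_def by blast
      have Lf0: "0 \<le> Lf" by (rule lipschitz_on_nonneg[OF Lf])
      have "\<exists>k r. 0 \<le> k \<and> 0 < r \<and> (\<forall>R. 0 < R \<longrightarrow> R < r \<longrightarrow> k * R \<le> 1 / 2 \<and> rel_modulus (k * R) (2 * R)) \<and>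
          ((\<forall>x\<in>-Y. f x = 0) \<longrightarrow> k = 0)"
      proof (cases "\<forall>x\<in>-Y. f x = 0")
        case True
        then show ?thesis using rel0 by (intro exI[of _ 0] exI[of _ 1]) auto
      next
        case False
        then obtain c where c: "0 < c" "\<forall>x\<in>-Y. c \<le> f x" using f by auto
        \<comment> \<open>Over a distance below \<open>2 * R\<close> the function \<open>f\<close>
          changes by at most \<open>2 * Lf * R = k * R * c\<close>, so
          \<open>\<kappa> = k * R\<close> is linear in the step; with \<open>\<eta> = 0\<close> the
          whole error is then linear.\<close>
        define k where "k = 2 * Lf / c"
        have k: "0 \<le> k" using Lf0 c by (simp add: k_def)
        have "k * R \<le> 1 / 2" if "0 < R" "R < 1 / (2 * (k + 1))" for R
        proof -
          have "k * R \<le> (k + 1) * (1 / (2 * (k + 1)))" using that k by (intro mult_mono) auto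
          also have "\<dots> = 1 / 2" using k by (simp add: divide_simps)
          finally show ?thesis .
        qed
        moreover have "rel_modulus (k * R) (2 * R)" if R: "0 < R" for R
        proof (rule rel[OF c(2)])
          fix x z assume xz: "x \<notin> Y" "z \<notin> Y" "dist x z < 2 * R"
          have "f x - f z \<le> Lf * dist x z" using lipschitz_onD[OF Lf, of x z] xz by (simp add: dist_real_def)
          also have "\<dots> \<le> Lf * (2 * R)" using xz Lf0 by (intro mult_left_mono) auto
          also have "\<dots> = k * R * c" using c(1) by (simp add: k_def)
          finally show "f x - f z \<le> k * R * c" .
        qed (use k R in simp)
        ultimately show ?thesis using k False by (intro exI[of _ k] exI[of _ "1 / (2 * (k + 1))"]) auto
      qed
      then obtain k r where k: "0 \<le> k" "0 < r" "\<And>R. 0 < R \<Longrightarrow> R < r \<Longrightarrow> k * R \<le> 1 / 2 \<and> rel_modulus (k * R) (2 * R)"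
        "(\<forall>x\<in>-Y. f x = 0) \<longrightarrow> k = 0" by blast
      have "\<bar>U eps x - u x\<bar> \<le> (7 * slope L + 2 * (k * Mx)) * eps" if eps: "0 < eps" "eps < min r 1" for eps x
      proof -
        have "step_error eps (2 * 0 + 7 * slope L * eps + 2 * (k * eps * Mx))"
          using k eps by (intro error lipschitz_modulus[OF L]) auto
        from u(1)[OF eps(1) _ this, of x] show ?thesis using eps by (simp add: algebra_simps)
      qed
      then show ?thesis using k(2) by (intro exI[of _ "7 * slope L + 2 * (k * Mx)"] exI[of _ "min r 1"]) auto
    qed
    show "\<exists>v. supersol Y F f m eps v" if "0 < eps" "eps \<le> 1" for eps by (rule supersol_exists[OF that])
  qed
qed

lemma continuum_value_conclusion:
  fixes Y :: "'a::metric_space set" and V :: "real \<Rightarrow> 'a \<Rightarrow> real"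
  assumes r: "0 < r"
    and V: "\<And>eps x. 0 < eps \<Longrightarrow> eps < r \<Longrightarrow> value_I \<S> Y F f eps x = ereal (V eps x) \<and> value_II \<S> Y F f eps x = ereal (V eps x)"
    and lim: "regular_limit Y F f V u"
  shows "is_continuum_value \<S> Y F f u \<and> uniformly_continuous_on UNIV u \<and> (\<forall>y\<in>Y. u y = F y) \<and>
    ((\<lambda>eps. sup_dist u (game_value \<S> Y F f eps)) \<longlongrightarrow> 0) (at_right 0) \<and>
    (is_lipschitz_on Y F \<longrightarrow> is_lipschitz_on UNIV u) \<and>
    (is_lipschitz_on Y F \<and> is_lipschitz_on (- Y) f \<longrightarrow>
      (\<exists>C. \<forall>\<^sub>F eps in at_right 0. sup_dist u (game_value \<S> Y F f eps) \<le> ereal (C * eps)))"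
proof (intro conjI impI ballI)
  have ev: "\<forall>\<^sub>F eps in at_right (0 :: real). P eps" if "0 < s" "\<And>eps. 0 < eps \<Longrightarrow> eps < s \<Longrightarrow> P eps" for s P
    using that unfolding eventually_at_right_field by blast
  have sup: "sup_dist u (game_value \<S> Y F f eps) \<le> ereal c"
    if eps: "0 < eps" "eps < r" and c: "\<And>x. \<bar>V eps x - u x\<bar> \<le> c" for eps c
    unfolding sup_dist_def game_value_def
  proof (rule SUP_least)
    fix x
    show "\<bar>ereal (u x) - value_I \<S> Y F f eps x\<bar> \<le> ereal c" using V[OF eps, of x] c[of x] by (simp add: abs_minus_commute)
  qed
  show "is_continuum_value \<S> Y F f u"
    unfolding is_continuum_value_def
  proof (intro conjI allI)
    show "\<forall>\<^sub>F eps in at_right 0. has_value \<S> Y F f eps"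
      by (rule ev[OF r]) (simp add: has_value_def fun_eq_iff V)
    fix x
    have "((\<lambda>eps. V eps x) \<longlongrightarrow> u x) (at_right 0)"
    proof (rule tendstoI)
      fix e :: real assume "0 < e"
      then obtain s where s: "0 < s" "\<And>eps x. 0 < eps \<Longrightarrow> eps < s \<Longrightarrow> \<bar>V eps x - u x\<bar> \<le> e / 2" using regular_limitD(1)[OF lim, of "e / 2"] by auto
      show "\<forall>\<^sub>F eps in at_right 0. dist (V eps x) (u x) < e"
      proof (rule ev[OF s(1)])
        fix eps assume "0 < eps" "eps < s"
        from s(2)[OF this, of x] show "dist (V eps x) (u x) < e" using \<open>0 < e\<close> by (simp add: dist_real_def)
      qed
    qed
    then have "((\<lambda>eps. ereal (V eps x)) \<longlongrightarrow> ereal (u x)) (at_right 0)" by simp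
    moreover have "\<forall>\<^sub>F eps in at_right 0. ereal (V eps x) = game_value \<S> Y F f eps x"
      by (rule ev[OF r]) (simp add: game_value_def V)
    ultimately show "((\<lambda>eps. game_value \<S> Y F f eps x) \<longlongrightarrow> ereal (u x)) (at_right 0)"
      by (rule Lim_transform_eventually)
  qed
  show "((\<lambda>eps. sup_dist u (game_value \<S> Y F f eps)) \<longlongrightarrow> 0) (at_right 0)"
  proof (rule order_tendstoI)
    fix a :: ereal assume "a < 0"
    moreover have "0 \<le> sup_dist u (game_value \<S> Y F f eps)" for eps
      unfolding sup_dist_def by (rule SUP_upper2[of undefined]) auto
    ultimately show "\<forall>\<^sub>F eps in at_right 0. a < sup_dist u (game_value \<S> Y F f eps)"
      by (intro always_eventually allI) (rule less_le_trans)
  next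
    fix a :: ereal assume "0 < a"
    then obtain b where b: "0 < b" "ereal b < a" by (metis ereal_dense2 ereal_less(2))
    then obtain s where s: "0 < s" "\<And>eps x. 0 < eps \<Longrightarrow> eps < s \<Longrightarrow> \<bar>V eps x - u x\<bar> \<le> b" using regular_limitD(1)[OF lim, of b] by auto
    show "\<forall>\<^sub>F eps in at_right 0. sup_dist u (game_value \<S> Y F f eps) < a"
      by (rule ev[of "min r s"]) (use r s b sup in \<open>auto intro!: le_less_trans[OF sup]\<close>)
  qed
  assume "is_lipschitz_on Y F \<and> is_lipschitz_on (- Y) f"
  then obtain C s where s: "0 < s" "\<And>eps x. 0 < eps \<Longrightarrow> eps < s \<Longrightarrow> \<bar>V eps x - u x\<bar> \<le> C * eps" using regular_limitD(5)[OF lim] by auto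
  have "\<forall>\<^sub>F eps in at_right 0. sup_dist u (game_value \<S> Y F f eps) \<le> ereal (C * eps)"
    by (rule ev[of "min r s"]) (use r s in \<open>auto intro!: sup\<close>)
  then show "\<exists>C. \<forall>\<^sub>F eps in at_right 0. sup_dist u (game_value \<S> Y F f eps) \<le> ereal (C * eps)" by blast
qed (use regular_limitD(2,3,4)[OF lim] in auto)

section \<open>Running payoffs of either sign\<close>

lemma is_lipschitz_on_uminus: "is_lipschitz_on A (\<lambda>x. - g x) \<longleftrightarrow> is_lipschitz_on A g"
  by (simp add: is_lipschitz_on_def lipschitz_on_def dist_real_def abs_minus_commute)

lemma is_lipschitz_on_abs: "is_lipschitz_on A g \<Longrightarrow> is_lipschitz_on A (\<lambda>x. \<bar>g x\<bar>)"
  unfolding is_lipschitz_on_def lipschitz_on_def dist_real_def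
  by (meson abs_triangle_ineq3 order_trans)

theorem theorem1p3:
  fixes Y :: "'a::metric_space set"
    and F f :: "'a \<Rightarrow> real"
    and \<S> :: "real \<Rightarrow> 'a strategy set"
  assumes "\<S> = pure_strategies \<or> \<S> = random_strategies"
    and "length_space TYPE('a)"
    and "Y \<noteq> {}"
    and "bdd_below (F ` Y)"
    and "\<exists>G. uniformly_continuous_on UNIV G \<and> (\<forall>y\<in>Y. G y = F y)"
    and "(\<forall>x\<in>- Y. f x = 0) \<or>
         ((\<exists>c>0. \<forall>x\<in>- Y. c \<le> \<bar>f x\<bar>) \<and>
          uniformly_continuous_on (- Y) f \<and> bounded (f ` (- Y)) \<and>
          bounded (UNIV :: 'a set))"
  shows "\<exists>u :: 'a \<Rightarrow> real.
           is_continuum_value \<S> Y F f u \<and>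
           uniformly_continuous_on UNIV u \<and>
           (\<forall>y\<in>Y. u y = F y) \<and>
           ((\<lambda>\<epsilon>. sup_dist u (game_value \<S> Y F f \<epsilon>)) \<longlongrightarrow> 0) (at_right 0) \<and>
           (is_lipschitz_on Y F \<longrightarrow> is_lipschitz_on UNIV u) \<and>
           (is_lipschitz_on Y F \<and> is_lipschitz_on (- Y) f \<longrightarrow>
              (\<exists>C. \<forall>\<^sub>F \<epsilon> in at_right 0.
                 sup_dist u (game_value \<S> Y F f \<epsilon>) \<le> ereal (C * \<epsilon>)))"
proof -
  have ip: "interpolating TYPE('a)" using assms(2) by (rule length_space_interpolating)
  have moves: "\<exists>A. moves \<S> eps A" if "0 < eps" for eps
    using assms(1) pure_moves[OF that] random_moves[OF that] by blast
  obtain m where m: "\<And>x. x \<in> Y \<Longrightarrow> m \<le> F x" using assms(4) by (auto simp: bdd_below_def)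
  obtain G where G: "uniformly_continuous_on UNIV G" "\<And>y. y \<in> Y \<Longrightarrow> G y = F y" using assms(5) by blast
  have mod: "\<exists>L. modulus_on Y F \<eta> L" if "0 < \<eta>" for \<eta> by (rule uniformly_continuous_modulus[OF ip G that])
  obtain p where p: "p \<in> Y" using assms(3) by blast
  show ?thesis
    using assms(6)
  proof
    assume f0: "\<forall>x\<in>- Y. f x = 0"
    obtain u where lim: "regular_limit Y F f (least_super Y F f m) u"
      and ex: "\<And>eps. 0 < eps \<Longrightarrow> eps \<le> 1 \<Longrightarrow> \<exists>v. supersol Y F f m eps v"
      using limit_of_least_super[OF ip assms(3) m mod disjI1[OF f0]] by blast
    show ?thesis
    proof (rule exI[of _ u], rule continuum_value_conclusion[OF _ _ lim, of 1])
      fix eps :: real and x assume small: "0 < eps" "eps < 1"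
      then obtain A where "moves \<S> eps A" using moves by blast
      then interpret moves \<S> eps A .
      have *: "0 \<le> f x" if "x \<notin> Y" for x using f0 that by simp
      have **: "(\<forall>x. x \<notin> Y \<longrightarrow> f x = 0) \<or> (\<exists>c>0. \<forall>x. x \<notin> Y \<longrightarrow> c \<le> f x)" using f0 by simp
      have ex: "\<exists>v. supersol Y F f m eps v" using ex small by simp
      show "value_I \<S> Y F f eps x = ereal (least_super Y F f m eps x) \<and> value_II \<S> Y F f eps x = ereal (least_super Y F f m eps x)"
        by (intro conjI value_eq_least_super[where f = f and F = F and Y = Y and p = p] ip p m * ** ex)
    qed simp
  next
    assume *: "(\<exists>c>0. \<forall>x\<in>- Y. c \<le> \<bar>f x\<bar>) \<and> uniformly_continuous_on (- Y) f \<and> bounded (f ` (- Y)) \<and>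
          bounded (UNIV :: 'a set)"
    from * obtain c where c: "0 < c" "\<And>x. x \<notin> Y \<Longrightarrow> c \<le> \<bar>f x\<bar>" by blast
    from * have uc: "uniformly_continuous_on (- Y) f" and bd: "bounded (UNIV :: 'a set)" by blast+
    from * obtain K where K: "\<And>x. x \<notin> Y \<Longrightarrow> \<bar>f x\<bar> \<le> K" unfolding bounded_iff by auto
    from bd obtain D where D: "\<And>x y :: 'a. dist x y \<le> D" by (auto simp: bounded_two_points)
    \<comment> \<open>Two auxiliary games have running payoff \<open>\<bar>f\<bar>\<close>: one with
      \<open>F\<close>, and one with \<open>- F\<close> and the players exchanged.\<close>
    define g where "g = (\<lambda>x. \<bar>f x\<bar>)"
    have "uniformly_continuous_on (- Y) g"
      unfolding uniformly_continuous_on_def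
    proof (intro allI impI)
      fix e :: real assume "0 < e"
      then obtain d where "0 < d" "\<forall>x\<in>-Y. \<forall>z\<in>-Y. dist z x < d \<longrightarrow> dist (f z) (f x) < e"
        using uc unfolding uniformly_continuous_on_def by blast
      then show "\<exists>d>0. \<forall>x\<in>-Y. \<forall>z\<in>-Y. dist z x < d \<longrightarrow> dist (g z) (g x) < e"
        unfolding g_def dist_real_def by (metis abs_triangle_ineq3 le_less_trans)
    qed
    then have g: "(\<forall>x\<in>-Y. g x = 0) \<or> ((\<exists>c>0. \<forall>x\<in>-Y. c \<le> g x) \<and> uniformly_continuous_on (- Y) g \<and>
       (\<exists>K. \<forall>x\<in>-Y. g x \<le> K) \<and> bounded (UNIV :: 'a set))"
      using c K bd unfolding g_def by blast
    have g0: "0 \<le> g x" for x by (simp add: g_def)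
    have g_alt: "(\<forall>x. x \<notin> Y \<longrightarrow> g x = 0) \<or> (\<exists>c>0. \<forall>x. x \<notin> Y \<longrightarrow> c \<le> g x)" using c unfolding g_def by blast
    have g_lip: "is_lipschitz_on (- Y) g" if "is_lipschitz_on (- Y) f" using is_lipschitz_on_abs[OF that] by (simp add: g_def)
    \<comment> \<open>Values of \<open>f\<close> of opposite signs differ by at least
      \<open>2 * c\<close>, so the sign is constant over distances below
      \<open>\<delta>\<close>.\<close>
    obtain \<delta> where \<delta>: "0 < \<delta>" and "\<forall>x\<in>-Y. \<forall>z\<in>-Y. dist z x < \<delta> \<longrightarrow> dist (f z) (f x) < 2 * c"
      using uc c(1) unfolding uniformly_continuous_on_def by (metis zero_less_mult_iff zero_less_numeral)
    then have sign: "0 < f z \<longleftrightarrow> 0 < f x" if "x \<notin> Y" "z \<notin> Y" "dist x z < \<delta>" for x z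
      using that c(2)[of x] c(2)[of z] by (fastforce simp: dist_real_def abs_if dist_commute split: if_splits)
    obtain L where L: "modulus_on Y F 1 L" using mod[of 1] by auto
    \<comment> \<open>A lower bound for \<open>- F\<close>: the finite diameter and the modulus
      bound \<open>F\<close> from above.\<close>
    define M where "M = - (F p + 1 + L * D)"
    have M: "M \<le> - F x" if "x \<in> Y" for x
    proof -
      have "F x \<le> F p + 1 + L * dist x p" using L that p by (auto simp: modulus_on_def)
      also have "\<dots> \<le> F p + 1 + L * D" using D L by (intro add_left_mono mult_left_mono) (auto simp: modulus_on_def)
      finally show ?thesis by (simp add: M_def)
    qed
    have modm: "\<exists>L. modulus_on Y (\<lambda>x. - F x) \<eta> L" if "0 < \<eta>" for \<eta>
      by (rule uniformly_continuous_modulus[OF ip uniformly_continuous_on_minus[OF G(1)] _ that]) (simp add: G)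
    obtain u where "regular_limit Y F g (least_super Y F g m) u"
      and u6: "\<And>eps. 0 < eps \<Longrightarrow> eps \<le> 1 \<Longrightarrow> \<exists>v. supersol Y F g m eps v"
      using limit_of_least_super[OF ip assms(3) m mod g] by blast
    note u = regular_limitD[OF this(1)]
    obtain w where "regular_limit Y (\<lambda>x. - F x) g (least_super Y (\<lambda>x. - F x) g M) w"
      and w6: "\<And>eps. 0 < eps \<Longrightarrow> eps \<le> 1 \<Longrightarrow> \<exists>v. supersol Y (\<lambda>x. - F x) g M eps v"
      using limit_of_least_super[OF ip assms(3) M modm g] by blast
    note w = regular_limitD[OF this(1)]
    define pos where "pos = {x. x \<in> Y \<or> 0 < f x}"
    define V where "V eps x = (if x \<in> pos then least_super Y F g m eps x else - least_super Y (\<lambda>x. - F x) g M eps x)" for eps x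
    define q where "q x = (if x \<in> pos then u x else - w x)" for x
    have V_close: "\<bar>V eps x - q x\<bar> \<le> e"
      if "\<bar>least_super Y F g m eps x - u x\<bar> \<le> e" "\<bar>least_super Y (\<lambda>x. - F x) g M eps x - w x\<bar> \<le> e" for eps x e
      using that by (auto simp: V_def q_def abs_le_iff)
    \<comment> \<open>Close points outside \<open>Y\<close> have the same sign, and a point of
      \<open>Y\<close> can be counted with either sign because both \<open>u\<close> and
      \<open>- w\<close> equal \<open>F\<close> there.\<close>
    have near: "(q x = u x \<and> q y = u y) \<or> (q x = - w x \<and> q y = - w y)" if "dist x y < \<delta>" for x y
      using sign[of x y] that by (cases "x \<in> Y"; cases "y \<in> Y") (auto simp: q_def pos_def u(3) w(3))
    have lim: "regular_limit Y F f V q"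
      unfolding regular_limit_def
    proof (intro conjI allI impI ballI)
      show "uniformly_continuous_on UNIV q"
        unfolding uniformly_continuous_on_def
      proof (intro allI impI)
        fix e :: real assume e: "0 < e"
        obtain d where d: "0 < d" "\<And>x y. dist y x < d \<Longrightarrow> dist (u y) (u x) < e"
          using u(2) e unfolding uniformly_continuous_on_def by (metis UNIV_I)
        obtain d' where d': "0 < d'" "\<And>x y. dist y x < d' \<Longrightarrow> dist (w y) (w x) < e"
          using w(2) e unfolding uniformly_continuous_on_def by (metis UNIV_I)
        have "dist (q y) (q x) < e" if "dist y x < min \<delta> (min d d')" for x y
          using near[of y x] d(2)[of y x] d'(2)[of y x] that by (auto simp: dist_minus)
        then show "\<exists>d>0. \<forall>x\<in>UNIV. \<forall>y\<in>UNIV. dist y x < d \<longrightarrow> dist (q y) (q x) < e"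
          using \<delta> d(1) d'(1) by (intro exI[of _ "min \<delta> (min d d')"]) auto
      qed
      show "q y = F y" if "y \<in> Y" for y using that u(3) by (simp add: q_def pos_def)
      show "is_lipschitz_on UNIV q" if lip: "is_lipschitz_on Y F"
      proof -
        obtain A where A: "A-lipschitz_on UNIV u" using u(4)[OF lip] unfolding is_lipschitz_on_def by blast
        obtain B where B: "B-lipschitz_on UNIV w"
          using w(4) lip is_lipschitz_on_uminus[of Y F] unfolding is_lipschitz_on_def by blast
        have AB: "0 \<le> A" "0 \<le> B" using A B by (auto dest: lipschitz_on_nonneg)
        have "0 \<le> D" using D[of p p] by simp
        define b where "b = \<bar>F p\<bar> + (A + B) * D"
        have b: "\<bar>q x\<bar> \<le> b" for x
        proof -
          have "A * dist x p \<le> A * D" "B * dist x p \<le> B * D" using D AB by (auto intro: mult_left_mono)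
          moreover have "0 \<le> A * D" "0 \<le> B * D" using AB \<open>0 \<le> D\<close> by auto
          moreover have "\<bar>u x - F p\<bar> \<le> A * dist x p" "\<bar>w x + F p\<bar> \<le> B * dist x p"
            using lipschitz_onD[OF A, of x p] lipschitz_onD[OF B, of x p] u(3)[OF p] w(3)[OF p] by (simp_all add: dist_real_def)
          ultimately show ?thesis unfolding b_def q_def distrib_right by (auto simp: abs_le_iff abs_if split: if_splits)
        qed
        \<comment> \<open>Below distance \<open>\<delta>\<close> one of the two Lipschitz constants
          applies; beyond it the oscillation of \<open>q\<close> is at most
          \<open>2 * b\<close>.\<close>
        define C where "C = A + B + 2 * b / \<delta>"
        have b0: "0 \<le> 2 * b / \<delta>" using b[of p] \<delta> by auto
        have "C-lipschitz_on UNIV q"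
        proof (rule lipschitz_onI)
          show "0 \<le> C" using AB b0 by (simp add: C_def)
          fix x y :: 'a
          have "A \<le> C" "B \<le> C" "2 * b / \<delta> \<le> C" using AB b0 unfolding C_def by linarith+
          then have *: "A * dist x y \<le> C * dist x y" "B * dist x y \<le> C * dist x y" "2 * b / \<delta> * dist x y \<le> C * dist x y"
            by (simp_all only: mult_right_mono zero_le_dist)
          show "dist (q x) (q y) \<le> C * dist x y"
          proof (cases "dist x y < \<delta>")
            case True
            then show ?thesis
              using near[OF True] lipschitz_onD[OF A, of x y] lipschitz_onD[OF B, of x y] * by (auto simp: dist_minus)
          next
            case False
            have "dist (q x) (q y) \<le> 2 * b" using b[of x] b[of y] by (simp add: dist_real_def abs_le_iff)
            also have "2 * b = 2 * b / \<delta> * \<delta>" using \<delta> by simp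
            also have "\<dots> \<le> 2 * b / \<delta> * dist x y" using False b0 by (intro mult_left_mono) auto
            finally show ?thesis using *(3) by linarith
          qed
        qed
        then show ?thesis unfolding is_lipschitz_on_def by blast
      qed
    next
      fix \<theta> :: real assume \<theta>: "0 < \<theta>"
      obtain r where r: "0 < r" "\<forall>eps x. 0 < eps \<longrightarrow> eps < r \<longrightarrow> \<bar>least_super Y F g m eps x - u x\<bar> \<le> \<theta>"
        using u(1)[OF \<theta>] by blast
      obtain r' where r': "0 < r'"
        "\<forall>eps x. 0 < eps \<longrightarrow> eps < r' \<longrightarrow> \<bar>least_super Y (\<lambda>x. - F x) g M eps x - w x\<bar> \<le> \<theta>"
        using w(1)[OF \<theta>] by blast
      have "\<bar>V eps x - q x\<bar> \<le> \<theta>" if "0 < eps" "eps < min r r'" for eps x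
        using r(2) r'(2) that by (intro V_close) simp_all
      then show "\<exists>r>0. \<forall>eps x. 0 < eps \<longrightarrow> eps < r \<longrightarrow> \<bar>V eps x - q x\<bar> \<le> \<theta>"
        using r(1) r'(1) by (intro exI[of _ "min r r'"]) simp
    next
      assume lip: "is_lipschitz_on Y F" "is_lipschitz_on (- Y) f"
      obtain C r where r: "0 < r"
        "\<forall>eps x. 0 < eps \<longrightarrow> eps < r \<longrightarrow> \<bar>least_super Y F g m eps x - u x\<bar> \<le> C * eps"
        using u(5) lip g_lip by blast
      obtain C' r' where r': "0 < r'"
        "\<forall>eps x. 0 < eps \<longrightarrow> eps < r' \<longrightarrow> \<bar>least_super Y (\<lambda>x. - F x) g M eps x - w x\<bar> \<le> C' * eps"
        using w(5) lip g_lip is_lipschitz_on_uminus by blast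
      have "\<bar>V eps x - q x\<bar> \<le> max C C' * eps" if eps: "0 < eps" "eps < min r r'" for eps x
      proof (rule V_close)
        have "C * eps \<le> max C C' * eps" "C' * eps \<le> max C C' * eps" using eps(1) by (auto intro!: mult_right_mono)
        moreover have "\<bar>least_super Y F g m eps x - u x\<bar> \<le> C * eps"
          "\<bar>least_super Y (\<lambda>x. - F x) g M eps x - w x\<bar> \<le> C' * eps"
          using r(2) r'(2) eps by simp_all
        ultimately show "\<bar>least_super Y F g m eps x - u x\<bar> \<le> max C C' * eps"
          "\<bar>least_super Y (\<lambda>x. - F x) g M eps x - w x\<bar> \<le> max C C' * eps" by linarith+
      qed
      then show "\<exists>C. \<exists>r>0. \<forall>eps x. 0 < eps \<longrightarrow> eps < r \<longrightarrow> \<bar>V eps x - q x\<bar> \<le> C * eps"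
        using r(1) r'(1) by (intro exI[of _ "max C C'"] exI[of _ "min r r'"]) auto
    qed
    show ?thesis
    \<comment> \<open>A move shorter than \<open>\<delta>\<close> between points outside
      \<open>Y\<close> preserves the sign of \<open>f\<close>, so play stays among points of one
      sign until it stops.\<close>
    proof (rule exI[of _ q], rule continuum_value_conclusion[OF _ _ lim, of "min 1 \<delta>"])
      fix eps :: real and x assume small: "0 < eps" "eps < min 1 \<delta>"
      then obtain A where "moves \<S> eps A" using moves by blast
      then interpret moves \<S> eps A .
      show "value_I \<S> Y F f eps x = ereal (V eps x) \<and> value_II \<S> Y F f eps x = ereal (V eps x)"
      proof (cases "x \<in> pos")
        case True
        have step: "z \<in> pos" if "y \<in> pos" "y \<notin> Y" "z \<in> ball y eps" for y z
          using that sign[of y z] small by (auto simp: pos_def)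
        have fg: "f y = g y" if "y \<in> pos" "y \<notin> Y" for y using that by (simp add: pos_def g_def)
        have ex: "\<exists>v. supersol Y F g m eps v" using u6 small by simp
        have "value_I \<S> Y F g eps x = ereal (least_super Y F g m eps x) \<and> value_II \<S> Y F g eps x = ereal (least_super Y F g m eps x)"
          by (intro conjI value_eq_least_super[where f = g and F = F and Y = Y and p = p] ip p m g0 g_alt ex)
        moreover have "value_I \<S> Y F f eps x = value_I \<S> Y F g eps x" "value_II \<S> Y F f eps x = value_II \<S> Y F g eps x"
          by (rule value_cong[where G = pos]; fact True step fg)+
        ultimately show ?thesis using True by (simp add: V_def)
      next
        case False
        define neg where "neg = {x. x \<in> Y \<or> \<not> 0 < f x}"
        have x: "x \<in> neg" using False by (simp add: neg_def pos_def)
        have step: "z \<in> neg" if "y \<in> neg" "y \<notin> Y" "z \<in> ball y eps" for y z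
          using that sign[of y z] small by (auto simp: neg_def)
        have fg: "- f y = g y" if "y \<in> neg" "y \<notin> Y" for y using that by (simp add: neg_def g_def)
        have ex: "\<exists>v. supersol Y (\<lambda>x. - F x) g M eps v" using w6 small by simp
        have "value_I \<S> Y (\<lambda>x. - F x) g eps x = ereal (least_super Y (\<lambda>x. - F x) g M eps x)
            \<and> value_II \<S> Y (\<lambda>x. - F x) g eps x = ereal (least_super Y (\<lambda>x. - F x) g M eps x)"
          by (intro conjI value_eq_least_super[where f = g and F = "\<lambda>x. - F x" and Y = Y and p = p] ip p M g0 g_alt ex)
        moreover have "value_I \<S> Y (\<lambda>x. - F x) (\<lambda>x. - f x) eps x = value_I \<S> Y (\<lambda>x. - F x) g eps x"
          "value_II \<S> Y (\<lambda>x. - F x) (\<lambda>x. - f x) eps x = value_II \<S> Y (\<lambda>x. - F x) g eps x"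
          by (rule value_cong[where G = neg]; fact x step fg)+
        ultimately show ?thesis
          using False by (simp add: V_def value_I_flip[of Y F f] value_II_flip[of Y F f])
      qed
    qed (use \<delta> in auto)
  qed
qed

end
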